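(* Let $h:\{1,\dots,n\}\to\{1,\dots,n\}$ be a Hessenberg function and $X_h$ the associated regular semisimple Hessenberg variety, with Tymoczko's $\mathbb{S}_n$-action on its cohomology. Then $$\mathscr{S}_{X_h}(m,1)=\prod_{i=1}^n\left(m+h(i)-i\right),$$ and $\mathscr{S}_{X_h}(m,t)$ is length log-concave at $t=1$, i.e. the coefficient sequence $(a_k)$ of the polynomial $\mathscr{S}_{X_h}(m,1)=\sum_k a_km^k$ satisfies $a_k^2\ge a_{k-1}a_{k+1}$ for all $k$.
   Context: A Hessenberg function is a non-decreasing $h:[n]\to[n]$, $[n]=\{1,\dots,n\}$, with $h(i)\ge i$ for all $i$. Fix an $n\times n$ complex diagonal matrix $s$ with distinct eigenvalues. The regular semisimple Hessenberg variety is $X_h=\{F_\bullet\in\mathrm{Fl}_n: sF_i\subset F_{h(i)}\ \forall i\}$, a smooth projective subvariety of the variety $\mathrm{Fl}_n$ of complete flags in $\mathbb{C}^n$, with no odd cohomology; its cohomology does not depend on $s$. All cohomology has rational coefficients. The diagonal torus $T\subset\mathrm{GL}_n(\mathbb{C})$ acts on $X_h$ with fixed points indexed by $w\in\mathbb{S}_n$ (the flags with $F_i=\langle e_{w(1)},\dots,e_{w(i)}\rangle$), and by GKM theory $H_T^*(X_h)$ is the ring of tuples $(f(w))_{w\in\mathbb{S}_n}$, $f(w)\in\mathbb{Q}[t_1,\dots,t_n]$ ($\deg t_i=2$), such that $f(w)-f(w\cdot(i\,j))$ is divisible by $t_{w(i)}-t_{w(j)}$ whenever $i<j\le h(i)$.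 Tymoczko's action is $(v\cdot f)(w)=v\big(f(v^{-1}w)\big)$, where $v\in\mathbb{S}_n$ acts on polynomials by $t_i\mapsto t_{v(i)}$; it descends to $H^*(X_h)=H_T^*(X_h)/(t_1,\dots,t_n)$, where each $t_i$ stands for the constant tuple $(t_i)_w$. For an $\mathbb{S}_n$-representation $V$ over $\mathbb{Q}$, $\mathscr{S}_V(m)=\frac1{n!}\sum_{\sigma\in\mathbb{S}_n}\mathrm{Tr}_V(\sigma)m^{\ell(\sigma)}$, with $\ell(\sigma)$ the number of disjoint cycles of $\sigma$; $\mathscr{S}_{X_h}(m,t)=\sum_{k\ge0}\mathscr{S}_{H^{2k}(X_h)}(m)t^k$. *)

theory Defs
  imports
    "Jordan_Normal_Form.VS_Connect"
    "HOL-Algebra.QuotRing"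
    "HOL-Combinatorics.Orbits"
    "HOL-Combinatorics.Transposition"
    "HOL-Computational_Algebra.Polynomial"
    "HOL-Library.Poly_Mapping"
    "HOL-Library.Groups_Big_Fun"
begin

text \<open>
  The set \<open>[n]\<close> is \<open>{1..n}\<close>, and \<open>\<S>\<^sub>n\<close> is the set of all \<open>w :: nat \<Rightarrow> nat\<close> with
  \<open>w permutes {1..n}\<close>. Values of \<open>h\<close> outside \<open>{1..n}\<close> are never used.
\<close>

definition hessenberg_function :: "nat \<Rightarrow> (nat \<Rightarrow> nat) \<Rightarrow> bool" where
  "hessenberg_function n h \<longleftrightarrow>
     (\<forall>i\<in>{1..n}. h i \<in> {1..n} \<and> i \<le> h i) \<and> mono_on {1..n} h"


section \<open>Polynomials in the variables $t_1, t_2, \dots$\<close>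

text \<open>A monomial is a finitely supported exponent vector, a polynomial a finitely supported
  map from monomials to rational coefficients.\<close>

type_synonym tpoly = "(nat \<Rightarrow>\<^sub>0 nat) \<Rightarrow>\<^sub>0 rat"

definition tconst :: "rat \<Rightarrow> tpoly" where
  "tconst c = Poly_Mapping.single 0 c"

definition tvar :: "nat \<Rightarrow> tpoly" where
  "tvar i = Poly_Mapping.single (Poly_Mapping.single i 1) 1"

definition tpolys :: "nat \<Rightarrow> tpoly set" where
  "tpolys n = {p. \<forall>\<alpha>\<in>Poly_Mapping.keys p. Poly_Mapping.keys \<alpha> \<subseteq> {1..n}}"

definition homogeneous :: "nat \<Rightarrow> tpoly \<Rightarrow> bool" where
  "homogeneous k p \<longleftrightarrow>
     (\<forall>\<alpha>\<in>Poly_Mapping.keys p. (\<Sum>i\<in>Poly_Mapping.keys \<alpha>. Poly_Mapping.lookup \<alpha> i) = k)"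

text \<open>The substitution \<open>t\<^sub>i \<mapsto> t\<^bsub>v(i)\<^esub>\<close>.\<close>

definition permute_vars :: "(nat \<Rightarrow> nat) \<Rightarrow> tpoly \<Rightarrow> tpoly" where
  "permute_vars v p =
     (\<Sum>\<alpha>\<in>Poly_Mapping.keys p. tconst (Poly_Mapping.lookup p \<alpha>) *
        (\<Prod>i\<in>Poly_Mapping.keys \<alpha>. tvar (v i) ^ Poly_Mapping.lookup \<alpha> i))"


section \<open>Equivariant cohomology of the regular semisimple Hessenberg variety\<close>

text \<open>
  By GKM theory, restriction to the torus fixed points identifies \<open>H\<^sub>T\<^sup>*(X\<^sub>h)\<close> with the ring
  of tuples below; this description is taken as the definition. Tuples are functions that vanish
  outside \<open>\<S>\<^sub>n\<close>. Divisibility is taken in the ring of polynomials in all variables; since both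
  sides lie in \<open>\<rat>[t\<^sub>1, \<dots>, t\<^sub>n]\<close>, it agrees with divisibility there.
\<close>

definition equivariant_cohomology ::
    "nat \<Rightarrow> (nat \<Rightarrow> nat) \<Rightarrow> ((nat \<Rightarrow> nat) \<Rightarrow> tpoly) ring" where
  "equivariant_cohomology n h =
     \<lparr>carrier = {f.
        (\<forall>w. w permutes {1..n} \<longrightarrow> f w \<in> tpolys n) \<and>
        (\<forall>w. \<not> w permutes {1..n} \<longrightarrow> f w = 0) \<and>
        (\<forall>w i j. w permutes {1..n} \<and> 1 \<le> i \<and> i < j \<and> j \<le> h i \<and> i \<le> n \<longrightarrow>
           (tvar (w i) - tvar (w j)) dvd (f w - f (w \<circ> Transposition.transpose i j)))},
      monoid.mult = (\<lambda>f g w. f w * g w),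
      one = (\<lambda>w. if w permutes {1..n} then 1 else 0),
      zero = (\<lambda>w. 0),
      add = (\<lambda>f g w. f w + g w)\<rparr>"

definition constant_tuple :: "nat \<Rightarrow> tpoly \<Rightarrow> (nat \<Rightarrow> nat) \<Rightarrow> tpoly" where
  "constant_tuple n p = (\<lambda>w. if w permutes {1..n} then p else 0)"

text \<open>Tymoczko's action; note that \<open>f\<close> vanishes at \<open>Hilbert_Choice.inv v \<circ> w\<close> unless \<open>w \<in> \<S>\<^sub>n\<close>.\<close>

definition dot_action ::
    "(nat \<Rightarrow> nat) \<Rightarrow> ((nat \<Rightarrow> nat) \<Rightarrow> tpoly) \<Rightarrow> (nat \<Rightarrow> nat) \<Rightarrow> tpoly" where
  "dot_action v f = (\<lambda>w. permute_vars v (f (Hilbert_Choice.inv v \<circ> w)))"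


section \<open>Ordinary cohomology\<close>

definition t_ideal :: "nat \<Rightarrow> (nat \<Rightarrow> nat) \<Rightarrow> ((nat \<Rightarrow> nat) \<Rightarrow> tpoly) set" where
  "t_ideal n h =
     Idl\<^bsub>equivariant_cohomology n h\<^esub> ((\<lambda>i. constant_tuple n (tvar i)) ` {1..n})"

definition cohomology_ring ::
    "nat \<Rightarrow> (nat \<Rightarrow> nat) \<Rightarrow> ((nat \<Rightarrow> nat) \<Rightarrow> tpoly) set ring" where
  "cohomology_ring n h = equivariant_cohomology n h Quot t_ideal n h"

text \<open>
  The rational vector space \<open>H\<^bsup>2k\<^esup>(X\<^sub>h)\<close>: as every \<open>t\<^sub>i\<close> has degree 2, it consists of the
  classes of the tuples of homogeneous polynomials of polynomial degree \<open>k\<close>. The fields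
  \<open>mult\<close> and \<open>one\<close> are only there because the module record extends the ring record; they
  play no role for a module.
\<close>

definition cohomology ::
    "nat \<Rightarrow> (nat \<Rightarrow> nat) \<Rightarrow> nat \<Rightarrow> (rat, ((nat \<Rightarrow> nat) \<Rightarrow> tpoly) set) module" where
  "cohomology n h k =
     \<lparr>carrier = {t_ideal n h +>\<^bsub>equivariant_cohomology n h\<^esub> f | f.
        f \<in> carrier (equivariant_cohomology n h) \<and> (\<forall>w. homogeneous k (f w))},
      monoid.mult = monoid.mult (cohomology_ring n h),
      one = one (cohomology_ring n h),
      zero = zero (cohomology_ring n h),
      add = add (cohomology_ring n h),
      smult = (\<lambda>q c. (t_ideal n h +>\<^bsub>equivariant_cohomology n h\<^esub> constant_tuple n (tconst q))
                        \<otimes>\<^bsub>cohomology_ring n h\<^esub> c)\<rparr>"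

text \<open>
  The induced action on classes. Since \<open>dot_action v\<close> is an automorphism of the equivariant
  ring that preserves the ideal, it maps the coset of \<open>f\<close> onto the coset of \<open>dot_action v f\<close>.
\<close>

definition tymoczko_action ::
    "(nat \<Rightarrow> nat) \<Rightarrow> ((nat \<Rightarrow> nat) \<Rightarrow> tpoly) set \<Rightarrow> ((nat \<Rightarrow> nat) \<Rightarrow> tpoly) set" where
  "tymoczko_action v c = dot_action v ` c"


section \<open>Traces and the polynomials of a representation\<close>

definition coordinate ::
    "('k::field, 'v, 'c) module_scheme \<Rightarrow> 'v set \<Rightarrow> 'v \<Rightarrow> 'v \<Rightarrow> 'k" where
  "coordinate V B b x = (THE c. \<exists>a. module.lincomb V a B = x \<and> a b = c)"

text \<open>The trace of a linear endomorphism of a finite-dimensional space with respect to some basis;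
  it does not depend on the choice of the basis. The value in the absence of a finite basis is
  a dummy.\<close>

definition endo_trace ::
    "('k::field, 'v, 'c) module_scheme \<Rightarrow> ('v \<Rightarrow> 'v) \<Rightarrow> 'k" where
  "endo_trace V \<phi> =
     (if \<exists>B. finite B \<and> vectorspace.basis class_ring V B
      then let B = (SOME B. finite B \<and> vectorspace.basis class_ring V B)
           in \<Sum>b\<in>B. coordinate V B b (\<phi> b)
      else 0)"

text \<open>Fixed points count as cycles: every \<open>x\<close> lies in \<open>orbit \<sigma> x\<close>.\<close>

definition num_cycles :: "nat \<Rightarrow> (nat \<Rightarrow> nat) \<Rightarrow> nat" where
  "num_cycles n \<sigma> = card (orbit \<sigma> ` {1..n})"

text \<open>\<open>\<S>\<^sub>V(m)\<close> as a polynomial in \<open>m\<close>, for the representation \<open>\<rho>\<close> of \<open>\<S>\<^sub>n\<close> on \<open>V\<close>.\<close>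

definition length_poly ::
    "nat \<Rightarrow> (rat, 'v, 'c) module_scheme \<Rightarrow> ((nat \<Rightarrow> nat) \<Rightarrow> 'v \<Rightarrow> 'v) \<Rightarrow> rat poly" where
  "length_poly n V \<rho> =
     Polynomial.smult (1 / fact n)
       (\<Sum>\<sigma> | \<sigma> permutes {1..n}. Polynomial.monom (endo_trace V (\<rho> \<sigma>)) (num_cycles n \<sigma>))"

text \<open>\<open>\<S>\<^bsub>X\<^sub>h\<^esub>(m, t)\<close> as a polynomial in \<open>t\<close> whose coefficients are polynomials in \<open>m\<close>.
  \<open>Sum_any\<close> is the sum over all \<open>k :: nat\<close>, of which only finitely many contribute.\<close>

definition hessenberg_length_poly :: "nat \<Rightarrow> (nat \<Rightarrow> nat) \<Rightarrow> rat poly poly" where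
  "hessenberg_length_poly n h =
     Sum_any (\<lambda>k. Polynomial.monom (length_poly n (cohomology n h k) tymoczko_action) k)"

text \<open>For \<open>k = 0\<close> the inequality holds trivially, because the coefficient of index \<open>-1\<close> is 0.\<close>

definition log_concave_coeffs :: "rat poly \<Rightarrow> bool" where
  "log_concave_coeffs p \<longleftrightarrow>
     (\<forall>k\<ge>1. (Polynomial.coeff p k)\<^sup>2 \<ge> Polynomial.coeff p (k - 1) * Polynomial.coeff p (k + 1))"

definition length_log_concave_at :: "rat poly poly \<Rightarrow> rat \<Rightarrow> bool" where
  "length_log_concave_at P t \<longleftrightarrow> log_concave_coeffs (poly P [:t:])"

end

theory Submission
  imports Defs "HOL-Library.Function_Algebras"
begin

text \<open>
  The proof rests on the modular law. Let \<open>T\<close> be a clique in a graph on \<open>[n]\<close> whose vertices have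
  the same neighbours outside \<open>T\<close>, let \<open>v\<close> be a vertex outside \<open>T\<close> without neighbours in \<open>T\<close>, and let
  \<open>M\<^sub>0\<close>, \<open>M\<^sub>1\<close>, \<open>M\<^sub>2\<close> be the modules of GKM tuples of the graph with none, one, and all of the edges
  between \<open>v\<close> and \<open>T\<close> added. Newton interpolation at the variables \<open>x\<^sub>l(w) = t\<^bsub>w(l)\<^esub>\<close>, \<open>l \<in> T\<close>, writes
  \<open>M\<^sub>0\<close> and \<open>M\<^sub>2\<close> equivariantly as direct sums of \<open>|T|!\<close> copies of their invariants \<open>N\<^sub>0\<close>, \<open>N\<^sub>2\<close> under the
  permutations of \<open>T\<close>, and \<open>M\<^sub>1\<close> as \<open>(|T| - 1)!\<close> copies of
  \<open>N\<^sub>2 \<oplus> (x\<^sub>v - x\<^sub>k) (N\<^sub>0 \<oplus> x\<^sub>k N\<^sub>0 \<oplus> \<dots> \<oplus> x\<^sub>k\<^bsup>|T|-2\<^esup> N\<^sub>0)\<close>. At the level of characters of the quotients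
  by \<open>(t\<^sub>1, \<dots>, t\<^sub>n)\<close> this is \<open>|T| \<tau>\<^sub>1 = \<tau>\<^sub>2 + (|T| - 1) \<tau>\<^sub>0\<close>.

  The product \<open>\<Prod>\<^sub>i (m + h(i) - i)\<close> obeys the same relation, and the relation reduces every Hessenberg
  function to disjoint unions of complete graphs. There the interpolation argument leaves the
  permutation representation on the cosets of a Young subgroup, whose polynomial counts the
  cycles of the elements of that subgroup.

  The product is log-concave because multiplication by \<open>m + r\<close> with \<open>r \<ge> 0\<close> preserves log-concavity
  of polynomials with nonnegative coefficients and without internal zeros.
\<close>

section \<open>Polynomials\<close>

text \<open>Existence of a character is at stake as well as its value: finite dimensionality of M /
  (t_1, ..., t_n) M is not presupposed, so every step of the reduction must produce a trace. The
  invariants \<open>N0\<close> inherit theirs from \<open>M0\<close>, and \<open>N2\<close> from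
  \<open>M1\<close> or \<open>M2\<close>, as direct summands; this is why traces are taken with
  respect to frames.

  The multipliers in the decompositions raise degrees, so the summands appear with degree shifts. At
  t = 1 the shifts are invisible, and the argument runs on ungraded quotients; the grading returns
  only in the comparison with the cohomology modules.

  All statements about interpolation coefficients come from one trick. Divisibility by t_a - t_b is
  vanishing under t_a := t_b, a ring homomorphism; interpolation at distinct nodes is unique; hence
  properties of the interpolated values pass to the coefficients.

  The modular law is used in two directions: along a row of the Hessenberg function the middle term
  is obtained from the outer ones, along a column the top term from the other two.\<close>

abbreviation lookp where "lookp \<equiv> Poly_Mapping.lookup"
abbreviation sgl where "sgl \<equiv> Poly_Mapping.single"

lemma poly_mapping_sum_single:
  fixes p :: "'a \<Rightarrow>\<^sub>0 'b::comm_monoid_add"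
  shows "p = (\<Sum>\<alpha>\<in>Poly_Mapping.keys p. sgl \<alpha> (lookp p \<alpha>))"
  by (rule poly_mapping_eqI)
     (auto simp: lookup_sum lookup_single when_def not_in_keys_iff_lookup_eq_zero)

lemma tpoly_single_induct [case_names single add]:
  assumes "\<And>\<alpha> c. P (sgl \<alpha> c)" and add: "\<And>p q :: tpoly. P p \<Longrightarrow> P q \<Longrightarrow> P (p + q)"
  shows "P p"
proof -
  have "finite A \<Longrightarrow> P (\<Sum>\<alpha>\<in>A. sgl \<alpha> (lookp p \<alpha>))" for A
    by (induction A rule: finite_induct) (use assms(1)[of 0 0] in \<open>auto intro: assms\<close>)
  from this[of "Poly_Mapping.keys p"] show ?thesis
    using poly_mapping_sum_single[of p] by simp
qed

lemma tvar_power: "tvar i ^ k = sgl (sgl i k) 1"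
  by (induction k) (simp_all add: tvar_def mult_single flip: single_add)

lemma prod_single_one:
  "(\<Prod>i\<in>A. sgl (f i) (1::rat)) = sgl (\<Sum>i\<in>A. f i) 1"
  by (induction A rule: infinite_finite_induct) (simp_all add: mult_single)

lemma single_eq_tconst_prod:
  "sgl \<alpha> c = tconst c * (\<Prod>i\<in>Poly_Mapping.keys \<alpha>. tvar i ^ lookp \<alpha> i)"
  by (simp add: tvar_power prod_single_one tconst_def mult_single poly_mapping_sum_single[symmetric])

lemma tpoly_ring_induct [case_names tconst tvar add mult]:
  assumes "\<And>c. P (tconst c)" and "\<And>i. P (tvar i)"
    and "\<And>p q. P p \<Longrightarrow> P q \<Longrightarrow> P (p + q)" and "\<And>p q. P p \<Longrightarrow> P q \<Longrightarrow> P (p * q)"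
  shows "P (p :: tpoly)"
proof (induction p rule: tpoly_single_induct)
  case (single \<alpha> c)
  have one: "P 1" using assms(1)[of 1] by (simp add: tconst_def)
  have pw: "P (tvar i ^ k)" for i k by (induction k) (auto intro: one assms)
  have "finite A \<Longrightarrow> P (\<Prod>i\<in>A. tvar i ^ lookp \<alpha> i)" for A
    by (induction A rule: finite_induct) (auto intro: one assms pw)
  then show ?case unfolding single_eq_tconst_prod by (intro assms) auto
qed (rule assms)

lemma tconst_add: "tconst (a + b) = tconst a + tconst b"
  by (simp add: tconst_def single_add)

lemma tconst_mult: "tconst (a * b) = tconst a * tconst b"
  by (simp add: tconst_def mult_single)

lemma tconst_0 [simp]: "tconst 0 = 0" and tconst_1 [simp]: "tconst 1 = 1"
  by (simp_all add: tconst_def)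

lemma tvar_eq_iff [simp]: "tvar a = tvar b \<longleftrightarrow> a = b"
proof
  assume "tvar a = tvar b"
  then have "lookp (tvar a) (sgl a 1) = lookp (tvar b) (sgl a 1)" by simp
  then have "sgl a (1::nat) = sgl b 1"
    by (auto simp: tvar_def lookup_single when_def split: if_splits)
  then have "lookp (sgl a (1::nat)) a = lookp (sgl b 1) a" by simp
  then show "a = b" by (auto simp: lookup_single when_def split: if_splits)
qed simp

subsection \<open>Substitution of variables\<close>

text \<open>Exponents add up where \<open>v\<close> identifies indices: \<open>v\<close> need not be
  injective, because the specialisations \<open>id(a := b)\<close> are used as much as
  permutations.\<close>

definition push_exponent :: "(nat \<Rightarrow> nat) \<Rightarrow> (nat \<Rightarrow>\<^sub>0 nat) \<Rightarrow> nat \<Rightarrow>\<^sub>0 nat" where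
  "push_exponent v \<alpha> = (\<Sum>i\<in>Poly_Mapping.keys \<alpha>. sgl (v i) (lookp \<alpha> i))"

lemma push_exponent_superset:
  "finite S \<Longrightarrow> Poly_Mapping.keys \<alpha> \<subseteq> S \<Longrightarrow> push_exponent v \<alpha> = (\<Sum>i\<in>S. sgl (v i) (lookp \<alpha> i))"
  unfolding push_exponent_def
  by (rule sum.mono_neutral_left) (auto simp: not_in_keys_iff_lookup_eq_zero)

lemma push_exponent_add: "push_exponent v (\<alpha> + \<beta>) = push_exponent v \<alpha> + push_exponent v \<beta>"
proof -
  let ?S = "Poly_Mapping.keys \<alpha> \<union> Poly_Mapping.keys \<beta>"
  have "push_exponent v (\<alpha> + \<beta>) = (\<Sum>i\<in>?S. sgl (v i) (lookp (\<alpha> + \<beta>) i))"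
    by (rule push_exponent_superset) (use keys_add[of \<alpha> \<beta>] in auto)
  also have "\<dots> = (\<Sum>i\<in>?S. sgl (v i) (lookp \<alpha> i)) + (\<Sum>i\<in>?S. sgl (v i) (lookp \<beta> i))"
    by (simp add: lookup_add single_add sum.distrib)
  finally show ?thesis by (simp add: push_exponent_superset[where S = ?S])
qed

lemma push_exponent_0 [simp]: "push_exponent v 0 = 0"
  by (simp add: push_exponent_def)

lemma permute_vars_eq_sum:
  assumes "finite S" "Poly_Mapping.keys p \<subseteq> S"
  shows "permute_vars v p = (\<Sum>\<alpha>\<in>S. sgl (push_exponent v \<alpha>) (lookp p \<alpha>))"
proof -
  have "permute_vars v p = (\<Sum>\<alpha>\<in>Poly_Mapping.keys p. sgl (push_exponent v \<alpha>) (lookp p \<alpha>))"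
    unfolding permute_vars_def
    by (simp add: tvar_power prod_single_one tconst_def mult_single push_exponent_def)
  also have "\<dots> = (\<Sum>\<alpha>\<in>S. sgl (push_exponent v \<alpha>) (lookp p \<alpha>))"
    by (rule sum.mono_neutral_left) (use assms in \<open>auto simp: not_in_keys_iff_lookup_eq_zero\<close>)
  finally show ?thesis .
qed

lemma permute_vars_single: "permute_vars v (sgl \<alpha> c) = sgl (push_exponent v \<alpha>) c"
  using permute_vars_eq_sum[of "{\<alpha>}" "sgl \<alpha> c" v] by simp

lemma permute_vars_add: "permute_vars v (p + q) = permute_vars v p + permute_vars v q"
proof -
  let ?S = "Poly_Mapping.keys p \<union> Poly_Mapping.keys q"
  have "permute_vars v (p + q) = (\<Sum>\<alpha>\<in>?S. sgl (push_exponent v \<alpha>) (lookp (p + q) \<alpha>))"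
    by (rule permute_vars_eq_sum) (use keys_add[of p q] in auto)
  then show ?thesis
    by (simp add: lookup_add single_add sum.distrib permute_vars_eq_sum[where S = ?S])
qed

lemma permute_vars_mult: "permute_vars v (p * q) = permute_vars v p * permute_vars v q"
proof (induction p rule: tpoly_single_induct)
  case (single \<alpha> c)
  show ?case
    by (induction q rule: tpoly_single_induct)
       (simp_all add: mult_single permute_vars_single push_exponent_add permute_vars_add distrib_left)
qed (simp add: permute_vars_add distrib_right)

lemma permute_vars_0 [simp]: "permute_vars v 0 = 0"
  by (simp add: permute_vars_def)

lemma permute_vars_tconst [simp]: "permute_vars v (tconst c) = tconst c"
  by (simp add: tconst_def permute_vars_single)

lemma permute_vars_1 [simp]: "permute_vars v 1 = 1"
  using permute_vars_tconst[of v 1] by simp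

lemma permute_vars_tvar [simp]: "permute_vars v (tvar i) = tvar (v i)"
  by (simp add: tvar_def permute_vars_single push_exponent_def)

lemma permute_vars_diff: "permute_vars v (p - q) = permute_vars v p - permute_vars v q"
  using permute_vars_add[of v "p - q" q] by simp

lemma permute_vars_power: "permute_vars v (p ^ k) = permute_vars v p ^ k"
  by (induction k) (simp_all add: permute_vars_mult)

lemma permute_vars_sum: "permute_vars v (\<Sum>i\<in>A. f i) = (\<Sum>i\<in>A. permute_vars v (f i))"
  by (induction A rule: infinite_finite_induct) (simp_all add: permute_vars_add)

lemma permute_vars_id [simp]: "permute_vars id p = p" "permute_vars (\<lambda>x. x) p = p"
proof -
  show "permute_vars id p = p"
    by (induction p rule: tpoly_ring_induct) (simp_all add: permute_vars_mult permute_vars_add)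
  then show "permute_vars (\<lambda>x. x) p = p" by (simp add: id_def)
qed

lemma permute_vars_comp: "permute_vars u (permute_vars v p) = permute_vars (u \<circ> v) p"
  by (induction p rule: tpoly_ring_induct) (simp_all add: permute_vars_mult permute_vars_add)

lemma permute_vars_dvd: "p dvd q \<Longrightarrow> permute_vars v p dvd permute_vars v q"
  by (auto simp: dvd_def permute_vars_mult)

text \<open>The congruence of p with its specialisation holds for constants and variables and is
  preserved by sums and products.\<close>

lemma tvar_diff_dvd_diff_subst: "tvar a - tvar b dvd p - permute_vars (id(a := b)) p"
proof (induction p rule: tpoly_ring_induct)
  case (add p q)
  from dvd_add[OF this] show ?case by (simp add: permute_vars_add algebra_simps)
next
  case (mult p q)
  let ?s = "permute_vars (id(a := b))"
  have "tvar a - tvar b dvd (p - ?s p) * q + ?s p * (q - ?s q)"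
    using mult by (intro dvd_add dvd_mult dvd_mult2)
  then show ?case unfolding permute_vars_mult by (simp add: algebra_simps)
qed auto

text \<open>Turns divisibility into the vanishing of a ring homomorphism, which can be applied term
  by term to an interpolation formula. For \<open>a = b\<close> both sides say p = 0.\<close>

lemma tvar_diff_dvd_iff:
  "tvar a - tvar b dvd p \<longleftrightarrow> permute_vars (id(a := b)) p = 0"
proof
  assume "tvar a - tvar b dvd p"
  from permute_vars_dvd[OF this, of "id(a := b)"] show "permute_vars (id(a := b)) p = 0"
    by (auto simp: permute_vars_diff split: if_splits)
next
  assume "permute_vars (id(a := b)) p = 0"
  then show "tvar a - tvar b dvd p" using tvar_diff_dvd_diff_subst[of a b p] by simp
qed

text \<open>Under t_a := t_b the factor t_c - t_d stays nonzero, and the polynomials form an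
  integral domain. This is the coprimality of distinct differences in the form used by
  interpolation.\<close>

lemma tvar_diff_dvd_cancel:
  assumes "tvar a - tvar b dvd (tvar c - tvar d) * q" "c \<noteq> d" "{a, b} \<noteq> {c, d}"
  shows "tvar a - tvar b dvd q"
proof -
  have "permute_vars (id(a := b)) (tvar c - tvar d) \<noteq> 0"
    using assms(2,3) by (auto simp: permute_vars_diff)
  then show ?thesis using assms(1) by (auto simp: tvar_diff_dvd_iff permute_vars_mult)
qed

subsection \<open>Polynomials in finitely many variables\<close>

lemma tpolys_add: "p \<in> tpolys n \<Longrightarrow> q \<in> tpolys n \<Longrightarrow> p + q \<in> tpolys n"
  unfolding tpolys_def using keys_add[of p q] by blast

lemma tpolys_mult: "p \<in> tpolys n \<Longrightarrow> q \<in> tpolys n \<Longrightarrow> p * q \<in> tpolys n"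
  unfolding tpolys_def
proof (rule CollectI, rule ballI)
  fix \<alpha> assume p: "p \<in> {p. \<forall>\<alpha>\<in>Poly_Mapping.keys p. Poly_Mapping.keys \<alpha> \<subseteq> {1..n}}"
    and q: "q \<in> {p. \<forall>\<alpha>\<in>Poly_Mapping.keys p. Poly_Mapping.keys \<alpha> \<subseteq> {1..n}}"
    and "\<alpha> \<in> Poly_Mapping.keys (p * q)"
  then obtain \<beta> \<gamma> where "\<alpha> = \<beta> + \<gamma>" "\<beta> \<in> Poly_Mapping.keys p" "\<gamma> \<in> Poly_Mapping.keys q"
    using keys_mult[of p q] by blast
  with p q keys_add[of \<beta> \<gamma>] show "Poly_Mapping.keys \<alpha> \<subseteq> {1..n}" by blast
qed

lemma tpolys_tconst [simp]: "tconst c \<in> tpolys n"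
  by (auto simp: tpolys_def tconst_def split: if_splits)

lemma tpolys_0 [simp]: "0 \<in> tpolys n" and tpolys_1 [simp]: "1 \<in> tpolys n"
  using tpolys_tconst[of 0] tpolys_tconst[of 1] by simp_all

lemma tpolys_tvar [simp]: "tvar i \<in> tpolys n \<longleftrightarrow> i \<in> {1..n}"
  by (auto simp: tpolys_def tvar_def split: if_splits)

lemma tpolys_power: "p \<in> tpolys n \<Longrightarrow> p ^ k \<in> tpolys n"
  by (induction k) (auto intro: tpolys_mult)

lemma tpolys_sum: "(\<And>i. i \<in> A \<Longrightarrow> f i \<in> tpolys n) \<Longrightarrow> sum f A \<in> tpolys n"
  by (induction A rule: infinite_finite_induct) (auto intro: tpolys_add)

lemma tpolys_prod: "(\<And>i. i \<in> A \<Longrightarrow> f i \<in> tpolys n) \<Longrightarrow> prod f A \<in> tpolys n"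
  by (induction A rule: infinite_finite_induct) (auto intro: tpolys_mult)

lemma permute_vars_in_tpolys:
  assumes "p \<in> tpolys n" "v ` {1..n} \<subseteq> {1..n}"
  shows "permute_vars v p \<in> tpolys n"
  unfolding permute_vars_def
proof (intro tpolys_sum tpolys_mult tpolys_prod tpolys_power tpolys_tconst)
  fix \<alpha> i assume "\<alpha> \<in> Poly_Mapping.keys p" "i \<in> Poly_Mapping.keys \<alpha>"
  then have "i \<in> {1..n}" using assms(1) by (auto simp: tpolys_def simp del: atLeastAtMost_iff)
  then show "tvar (v i) \<in> tpolys n" using assms(2) by (simp add: image_subset_iff)
qed

text \<open>It places in Q[t_1, ..., t_n] every polynomial that is known to be fixed by such a
  substitution.\<close>

lemma permute_vars_image_in_tpolys: "range v \<subseteq> {1..n} \<Longrightarrow> permute_vars v p \<in> tpolys n"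
  unfolding permute_vars_def
  by (intro tpolys_sum tpolys_mult tpolys_prod tpolys_power tpolys_tconst)
     (auto simp: image_subset_iff)

lemma permute_vars_cong:
  assumes "p \<in> tpolys n" "\<And>i. i \<in> {1..n} \<Longrightarrow> u i = v i"
  shows "permute_vars u p = permute_vars v p"
  unfolding permute_vars_def
proof (intro sum.cong refl arg_cong2[where f = "(*)"] prod.cong)
  fix \<alpha> i assume "\<alpha> \<in> Poly_Mapping.keys p" "i \<in> Poly_Mapping.keys \<alpha>"
  then have "i \<in> {1..n}" using assms(1) by (auto simp: tpolys_def simp del: atLeastAtMost_iff)
  then show "tvar (u i) ^ lookp \<alpha> i = tvar (v i) ^ lookp \<alpha> i" using assms(2) by simp
qed

subsection \<open>Constant coefficients and homogeneous components\<close>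

lemma lookup_0_tconst_mult [simp]: "lookp (tconst c * p) 0 = c * lookp p 0"
  by (induction p rule: tpoly_single_induct)
     (auto simp: tconst_def mult_single lookup_single when_def lookup_add distrib_left)

lemma lookup_0_tvar_mult [simp]: "lookp (tvar i * p) 0 = 0"
proof (induction p rule: tpoly_single_induct)
  case (single \<alpha> c)
  have "lookp (sgl i 1 + \<alpha>) i \<noteq> 0" by (simp add: lookup_add)
  then have "sgl i 1 + \<alpha> \<noteq> 0" by auto
  then show ?case by (simp add: tvar_def mult_single lookup_single when_def)
qed (simp add: distrib_left lookup_add)

lemma lookup_0_permute_vars [simp]: "lookp (permute_vars v p) 0 = lookp p 0"
proof (induction p rule: tpoly_single_induct)
  case (single \<alpha> c)
  have "\<alpha> = 0" if 0: "push_exponent v \<alpha> = 0"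
  proof (rule poly_mapping_eqI)
    fix i show "lookp \<alpha> i = lookp 0 i"
    proof (rule ccontr)
      assume "lookp \<alpha> i \<noteq> lookp 0 i"
      then have i: "i \<in> Poly_Mapping.keys \<alpha>" "lookp \<alpha> i \<noteq> 0" by (auto simp: in_keys_iff)
      have "lookp (push_exponent v \<alpha>) (v i)
          = (\<Sum>j\<in>Poly_Mapping.keys \<alpha>. lookp (sgl (v j) (lookp \<alpha> j)) (v i))"
        by (simp add: push_exponent_def lookup_sum)
      also have "\<dots> \<ge> lookp (sgl (v i) (lookp \<alpha> i)) (v i)"
        using i(1) by (intro member_le_sum) auto
      finally show False using i(2) 0 by simp
    qed
  qed
  then show ?case by (auto simp: permute_vars_single lookup_single when_def)
qed (simp add: permute_vars_add lookup_add)

text \<open>Every monomial other than 1 is divisible by one of its variables; the cofactors are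
  collected variable by variable.\<close>

lemma tpolys_without_constant:
  assumes "p \<in> tpolys n" "lookp p 0 = 0"
  shows "\<exists>q. (\<forall>i\<in>{1..n}. q i \<in> tpolys n) \<and> p = (\<Sum>i\<in>{1..n}. tvar i * q i)"
proof -
  let ?J = "\<lambda>p. \<exists>q. (\<forall>i\<in>{1..n}. q i \<in> tpolys n) \<and> p = (\<Sum>i\<in>{1..n}. tvar i * q i)"
  have add: "?J (a + b)" if "?J a" "?J b" for a b
  proof -
    from that obtain q r where "\<forall>i\<in>{1..n}. q i \<in> tpolys n" "a = (\<Sum>i\<in>{1..n}. tvar i * q i)"
      "\<forall>i\<in>{1..n}. r i \<in> tpolys n" "b = (\<Sum>i\<in>{1..n}. tvar i * r i)" by blast
    then show ?thesis
      by (intro exI[of _ "\<lambda>i. q i + r i"]) (auto simp: tpolys_add distrib_left sum.distrib)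
  qed
  have zero: "\<exists>q. (\<forall>i\<in>{1..n}. q i \<in> tpolys n) \<and> (0::tpoly) = (\<Sum>i\<in>{1..n}. tvar i * q i)"
    by (rule exI[of _ "\<lambda>_. 0"]) simp
  have mon: "?J (sgl \<alpha> (lookp p \<alpha>))" if \<alpha>: "\<alpha> \<in> Poly_Mapping.keys p" for \<alpha>
  proof -
    have "\<alpha> \<noteq> 0" using \<alpha> assms(2) by (auto simp: in_keys_iff)
    then obtain i where i: "lookp \<alpha> i \<noteq> 0" by (metis lookup_zero poly_mapping_eqI)
    have "i \<in> Poly_Mapping.keys \<alpha>" "Poly_Mapping.keys \<alpha> \<subseteq> {1..n}"
      using i \<alpha> assms(1) by (auto simp: tpolys_def in_keys_iff)
    then have i': "i \<in> {1..n}" by blast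
    define \<beta> where "\<beta> = \<alpha> - sgl i 1"
    have \<alpha>_eq: "\<alpha> = sgl i 1 + \<beta>" unfolding \<beta>_def
      by (rule poly_mapping_eqI) (use i in \<open>auto simp: lookup_add lookup_minus lookup_single when_def\<close>)
    have "Poly_Mapping.keys \<beta> \<subseteq> Poly_Mapping.keys \<alpha>"
      by (auto simp: in_keys_iff \<beta>_def lookup_minus)
    then have \<beta>: "sgl \<beta> c \<in> tpolys n" for c
      using \<alpha> assms(1) by (auto simp: tpolys_def)
    let ?q = "\<lambda>j. if j = i then sgl \<beta> (lookp p \<alpha>) else 0"
    have "(\<Sum>j\<in>{1..n}. tvar j * ?q j) = (\<Sum>j\<in>{i}. tvar j * ?q j)"
      using i' by (intro sum.mono_neutral_right) auto
    also have "\<dots> = sgl \<alpha> (lookp p \<alpha>)"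
      by (subst \<alpha>_eq) (simp add: tvar_def mult_single)
    finally show ?thesis using \<beta> by (intro exI[of _ ?q]) auto
  qed
  have "?J (\<Sum>\<alpha>\<in>A. sgl \<alpha> (lookp p \<alpha>))" if "finite A" "A \<subseteq> Poly_Mapping.keys p" for A
    using that
  proof (induction A rule: finite_induct)
    case (insert a A)
    then show ?case by (simp only: sum.insert[OF insert.hyps]) (intro add mon, auto)
  qed (use zero in \<open>simp only: sum.empty\<close>)
  from this[of "Poly_Mapping.keys p"] show ?thesis
    by (simp add: poly_mapping_sum_single[symmetric])
qed

definition mdeg :: "(nat \<Rightarrow>\<^sub>0 nat) \<Rightarrow> nat" where
  "mdeg \<alpha> = (\<Sum>i\<in>Poly_Mapping.keys \<alpha>. lookp \<alpha> i)"

lemma mdeg_superset: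
  "finite S \<Longrightarrow> Poly_Mapping.keys \<alpha> \<subseteq> S \<Longrightarrow> mdeg \<alpha> = (\<Sum>i\<in>S. lookp \<alpha> i)"
  unfolding mdeg_def by (rule sum.mono_neutral_left) (auto simp: not_in_keys_iff_lookup_eq_zero)

lemma mdeg_add: "mdeg (\<alpha> + \<beta>) = mdeg \<alpha> + mdeg \<beta>"
proof -
  let ?S = "Poly_Mapping.keys \<alpha> \<union> Poly_Mapping.keys \<beta>"
  have "mdeg (\<alpha> + \<beta>) = (\<Sum>i\<in>?S. lookp (\<alpha> + \<beta>) i)"
    by (rule mdeg_superset) (use keys_add[of \<alpha> \<beta>] in auto)
  then show ?thesis
    by (simp add: lookup_add sum.distrib mdeg_superset[where S = ?S])
qed

lemma mdeg_0 [simp]: "mdeg 0 = 0" and mdeg_single [simp]: "mdeg (sgl i k) = k"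
  by (simp_all add: mdeg_def)

lemma mdeg_push_exponent: "mdeg (push_exponent v \<alpha>) = mdeg \<alpha>"
proof -
  have "mdeg (\<Sum>i\<in>A. sgl (v i) (f i)) = (\<Sum>i\<in>A. f i)" for A f
    by (induction A rule: infinite_finite_induct) (simp_all add: mdeg_add)
  then show ?thesis by (simp add: push_exponent_def mdeg_def)
qed

definition hom_part :: "nat \<Rightarrow> tpoly \<Rightarrow> tpoly" where
  "hom_part k p = (\<Sum>\<alpha>\<in>{\<alpha>\<in>Poly_Mapping.keys p. mdeg \<alpha> = k}. sgl \<alpha> (lookp p \<alpha>))"

lemma lookup_hom_part: "lookp (hom_part k p) \<alpha> = (if mdeg \<alpha> = k then lookp p \<alpha> else 0)"
  by (auto simp: hom_part_def lookup_sum lookup_single when_def not_in_keys_iff_lookup_eq_zero)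

lemma hom_part_add: "hom_part k (p + q) = hom_part k p + hom_part k q"
  by (rule poly_mapping_eqI) (simp add: lookup_hom_part lookup_add)

lemma hom_part_0 [simp]: "hom_part k 0 = 0"
  by (simp add: hom_part_def)

lemma hom_part_diff: "hom_part k (p - q) = hom_part k p - hom_part k q"
  by (rule poly_mapping_eqI) (simp add: lookup_hom_part lookup_minus)

lemma hom_part_single: "hom_part k (sgl \<alpha> c) = (if mdeg \<alpha> = k then sgl \<alpha> c else 0)"
  by (rule poly_mapping_eqI) (auto simp: lookup_hom_part lookup_single when_def)

lemma hom_part_tconst_mult: "hom_part k (tconst c * p) = tconst c * hom_part k p"
  by (induction p rule: tpoly_single_induct)
     (simp_all add: tconst_def mult_single hom_part_single hom_part_add distrib_left)

lemma hom_part_tvar_mult: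
  "hom_part k (tvar i * p) = (if k = 0 then 0 else tvar i * hom_part (k - 1) p)"
  by (induction p rule: tpoly_single_induct)
     (auto simp: tvar_def mult_single hom_part_single hom_part_add distrib_left mdeg_add)

lemma hom_part_permute_vars: "hom_part k (permute_vars v p) = permute_vars v (hom_part k p)"
  by (induction p rule: tpoly_single_induct)
     (auto simp: permute_vars_single hom_part_single hom_part_add permute_vars_add mdeg_push_exponent)

lemma hom_part_in_tpolys: "p \<in> tpolys n \<Longrightarrow> hom_part k p \<in> tpolys n"
  by (auto simp: tpolys_def in_keys_iff lookup_hom_part split: if_splits)

lemma homogeneous_iff_hom_part: "homogeneous k p \<longleftrightarrow> hom_part k p = p"
  unfolding homogeneous_def mdeg_def[symmetric]
  by (auto simp: poly_mapping_eq_iff fun_eq_iff lookup_hom_part in_keys_iff)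

lemma hom_part_hom_part: "hom_part k (hom_part j p) = (if k = j then hom_part k p else 0)"
  by (rule poly_mapping_eqI) (simp add: lookup_hom_part)

lemma hom_part_eventually_0: "\<exists>N. \<forall>k\<ge>N. hom_part k p = 0"
proof (intro exI allI impI)
  fix k assume "Suc (\<Sum>\<alpha>\<in>Poly_Mapping.keys p. mdeg \<alpha>) \<le> k"
  then have "mdeg \<alpha> \<noteq> k" if "\<alpha> \<in> Poly_Mapping.keys p" for \<alpha>
    using member_le_sum[OF that, of mdeg] by simp
  then have "{\<alpha>\<in>Poly_Mapping.keys p. mdeg \<alpha> = k} = {}" by blast
  then show "hom_part k p = 0" unfolding hom_part_def by (simp only: sum.empty)
qed

lemma sum_hom_part:
  assumes "\<forall>k\<ge>N. hom_part k p = 0"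
  shows "(\<Sum>k<N. hom_part k p) = p"
proof (rule poly_mapping_eqI)
  fix \<alpha>
  have "lookp (\<Sum>k<N. hom_part k p) \<alpha> = (if mdeg \<alpha> < N then lookp p \<alpha> else 0)"
    by (simp add: lookup_sum lookup_hom_part)
  moreover have "lookp p \<alpha> = 0" if "\<not> mdeg \<alpha> < N"
    using assms[rule_format, of "mdeg \<alpha>"] that lookup_hom_part[of "mdeg \<alpha>" p \<alpha>] by simp
  ultimately show "lookp (\<Sum>k<N. hom_part k p) \<alpha> = lookp p \<alpha>" by auto
qed

section \<open>Traces on quotients\<close>

type_synonym tuple = "(nat \<Rightarrow> nat) \<Rightarrow> tpoly"

definition pscale :: "tpoly \<Rightarrow> tuple \<Rightarrow> tuple" where
  "pscale p f = (\<lambda>w. p * f w)"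

abbreviation qscale :: "rat \<Rightarrow> tuple \<Rightarrow> tuple" where
  "qscale q \<equiv> pscale (tconst q)"

lemma pscale_apply: "pscale p f w = p * f w"
  by (simp add: pscale_def)

lemma pscale_add: "pscale p (f + g) = pscale p f + pscale p g"
  by (simp add: fun_eq_iff distrib_left pscale_apply)

lemma pscale_0 [simp]: "pscale p 0 = 0" and pscale_1 [simp]: "pscale 1 f = f"
  and pscale_0_left [simp]: "pscale 0 f = 0"
  by (simp_all add: fun_eq_iff pscale_apply)

lemma pscale_sum: "pscale p (\<Sum>i\<in>A. f i) = (\<Sum>i\<in>A. pscale p (f i))"
  using sum_comp_morphism[of "pscale p" f A] by (simp add: o_def pscale_add)

lemma pscale_pscale: "pscale p (pscale q f) = pscale (p * q) f"
  by (simp add: fun_eq_iff mult.assoc pscale_apply)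

lemma pscale_commute: "pscale p (pscale q f) = pscale q (pscale p f)"
  by (simp add: fun_eq_iff mult_ac pscale_apply)

lemma pscale_mult_right: "f * pscale p g = pscale p (f * g)"
  by (simp add: fun_eq_iff mult_ac pscale_apply)

lemma qscale_minus_1: "qscale (- 1) f = - f"
proof -
  have "tconst (- 1) = - 1" using tconst_add[of "-1" 1] by (simp add: eq_neg_iff_add_eq_0)
  then show ?thesis by (simp add: fun_eq_iff pscale_apply)
qed

lemma sum_tuple_apply: "(\<Sum>i\<in>A. f i) w = (\<Sum>i\<in>A. (f i :: tuple) w)"
  by (induction A rule: infinite_finite_induct) simp_all

definition qsubspace :: "tuple set \<Rightarrow> bool" where
  "qsubspace A \<longleftrightarrow> 0 \<in> A \<and> (\<forall>f\<in>A. \<forall>g\<in>A. f + g \<in> A) \<and> (\<forall>q. \<forall>f\<in>A. qscale q f \<in> A)"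

lemma qsubspace_add: "qsubspace A \<Longrightarrow> f \<in> A \<Longrightarrow> g \<in> A \<Longrightarrow> f + g \<in> A"
  and qsubspace_scale: "qsubspace A \<Longrightarrow> f \<in> A \<Longrightarrow> qscale q f \<in> A"
  and qsubspace_0: "qsubspace A \<Longrightarrow> 0 \<in> A"
  by (auto simp: qsubspace_def)

lemma qsubspace_uminus: "qsubspace A \<Longrightarrow> f \<in> A \<Longrightarrow> - f \<in> A"
  using qsubspace_scale[of A f "-1"] by (simp add: qscale_minus_1)

lemma qsubspace_diff: "qsubspace A \<Longrightarrow> f \<in> A \<Longrightarrow> g \<in> A \<Longrightarrow> f - g \<in> A"
  using qsubspace_add[OF _ _ qsubspace_uminus] by fastforce

lemma qsubspace_sum: "qsubspace A \<Longrightarrow> (\<And>i. i \<in> I \<Longrightarrow> f i \<in> A) \<Longrightarrow> sum f I \<in> A"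
  by (induction I rule: infinite_finite_induct) (auto simp: qsubspace_0 intro: qsubspace_add)

definition qlinear_on :: "tuple set \<Rightarrow> (tuple \<Rightarrow> tuple) \<Rightarrow> bool" where
  "qlinear_on A \<phi> \<longleftrightarrow> (\<forall>f\<in>A. \<forall>g\<in>A. \<phi> (f + g) = \<phi> f + \<phi> g) \<and>
     (\<forall>q. \<forall>f\<in>A. \<phi> (qscale q f) = qscale q (\<phi> f))"

definition qfunctional_on :: "tuple set \<Rightarrow> (tuple \<Rightarrow> rat) \<Rightarrow> bool" where
  "qfunctional_on A \<xi> \<longleftrightarrow> (\<forall>f\<in>A. \<forall>g\<in>A. \<xi> (f + g) = \<xi> f + \<xi> g) \<and>
     (\<forall>q. \<forall>f\<in>A. \<xi> (qscale q f) = q * \<xi> f)"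

lemma qlinear_on_0: "qlinear_on A \<phi> \<Longrightarrow> qsubspace A \<Longrightarrow> \<phi> 0 = 0"
  unfolding qlinear_on_def qsubspace_def by (metis pscale_0_left tconst_0)

lemma qfunctional_on_0: "qfunctional_on A \<xi> \<Longrightarrow> qsubspace A \<Longrightarrow> \<xi> 0 = 0"
  unfolding qfunctional_on_def qsubspace_def by (metis pscale_0_left tconst_0 mult_zero_left)

lemma qlinear_on_lincomb:
  assumes "qlinear_on A \<phi>" "qsubspace A" "\<And>i. i \<in> I \<Longrightarrow> e i \<in> A"
  shows "\<phi> (\<Sum>i\<in>I. qscale (c i) (e i)) = (\<Sum>i\<in>I. qscale (c i) (\<phi> (e i)))"
  using assms(3)
proof (induction I rule: infinite_finite_induct)
  case (insert i I)
  have "qscale (c i) (e i) \<in> A" "(\<Sum>i\<in>I. qscale (c i) (e i)) \<in> A"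
    using insert.prems assms(2) by (auto intro: qsubspace_scale qsubspace_sum)
  moreover have "\<phi> (\<Sum>i\<in>I. qscale (c i) (e i)) = (\<Sum>i\<in>I. qscale (c i) (\<phi> (e i)))"
    by (rule insert.IH) (use insert.prems in auto)
  ultimately have "\<phi> (qscale (c i) (e i) + (\<Sum>i\<in>I. qscale (c i) (e i)))
      = qscale (c i) (\<phi> (e i)) + (\<Sum>i\<in>I. qscale (c i) (\<phi> (e i)))"
    using insert.prems assms(1) by (simp add: qlinear_on_def)
  then show ?case unfolding sum.insert[OF insert.hyps] .
next
  case empty
  show ?case unfolding sum.empty by (rule qlinear_on_0[OF assms(1,2)])
next
  case (infinite I)
  show ?case unfolding sum.infinite[OF infinite.hyps] by (rule qlinear_on_0[OF assms(1,2)])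
qed

lemma qfunctional_on_lincomb:
  assumes "qfunctional_on A \<xi>" "qsubspace A" "\<And>i. i \<in> I \<Longrightarrow> e i \<in> A"
  shows "\<xi> (\<Sum>i\<in>I. qscale (c i) (e i)) = (\<Sum>i\<in>I. c i * \<xi> (e i))"
  using assms(3)
proof (induction I rule: infinite_finite_induct)
  case (insert i I)
  have "qscale (c i) (e i) \<in> A" "(\<Sum>i\<in>I. qscale (c i) (e i)) \<in> A"
    using insert.prems assms(2) by (auto intro: qsubspace_scale qsubspace_sum)
  moreover have "\<xi> (\<Sum>i\<in>I. qscale (c i) (e i)) = (\<Sum>i\<in>I. c i * \<xi> (e i))"
    by (rule insert.IH) (use insert.prems in auto)
  ultimately have "\<xi> (qscale (c i) (e i) + (\<Sum>i\<in>I. qscale (c i) (e i)))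
      = c i * \<xi> (e i) + (\<Sum>i\<in>I. c i * \<xi> (e i))"
    using insert.prems assms(1) by (simp add: qfunctional_on_def)
  then show ?case unfolding sum.insert[OF insert.hyps] .
next
  case empty
  show ?case unfolding sum.empty by (rule qfunctional_on_0[OF assms(1,2)])
next
  case (infinite I)
  show ?case unfolding sum.infinite[OF infinite.hyps] by (rule qfunctional_on_0[OF assms(1,2)])
qed

text \<open>A frame of \<open>A / B\<close>: a finite family with functionals reproducing every class. Unlike a
  basis it may be linearly dependent, so frames pass to direct summands and can be averaged.\<close>

definition is_frame ::
    "tuple set \<Rightarrow> tuple set \<Rightarrow> 'i set \<Rightarrow> ('i \<Rightarrow> tuple) \<Rightarrow> ('i \<Rightarrow> tuple \<Rightarrow> rat) \<Rightarrow> bool" where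
  "is_frame A B I e \<xi> \<longleftrightarrow> finite I \<and>
     (\<forall>i\<in>I. e i \<in> A \<and> qfunctional_on A (\<xi> i) \<and> (\<forall>f\<in>B. \<xi> i f = 0)) \<and>
     (\<forall>f\<in>A. f - (\<Sum>i\<in>I. qscale (\<xi> i f) (e i)) \<in> B)"

definition has_trace :: "tuple set \<Rightarrow> tuple set \<Rightarrow> (tuple \<Rightarrow> tuple) \<Rightarrow> rat \<Rightarrow> bool" where
  "has_trace A B \<phi> \<tau> \<longleftrightarrow>
     (\<exists>(I::nat set) e \<xi>. is_frame A B I e \<xi> \<and> \<tau> = (\<Sum>i\<in>I. \<xi> i (\<phi> (e i))))"

text \<open>\<open>has_trace\<close> quantifies over index sets of natural numbers, since an
  existential cannot range over types. A finite index set of any type is transported there by a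
  bijection.\<close>

lemma has_traceI:
  assumes fr: "is_frame A B I e \<xi>" and \<tau>: "\<tau> = (\<Sum>i\<in>I. \<xi> i (\<phi> (e i)))"
  shows "has_trace A B \<phi> \<tau>"
proof -
  have "finite I" using fr by (simp add: is_frame_def)
  then obtain h where h: "bij_betw h {0..<card I} I" by (metis ex_bij_betw_nat_finite)
  have "is_frame A B {0..<card I} (e \<circ> h) (\<xi> \<circ> h)"
    unfolding is_frame_def
  proof (intro conjI ballI)
    fix f assume "f \<in> A"
    have "(\<Sum>i\<in>{0..<card I}. qscale ((\<xi> \<circ> h) i f) ((e \<circ> h) i)) = (\<Sum>i\<in>I. qscale (\<xi> i f) (e i))"
      using sum.reindex_bij_betw[OF h, of "\<lambda>i. qscale (\<xi> i f) (e i)"] by simp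
    then show "f - (\<Sum>i\<in>{0..<card I}. qscale ((\<xi> \<circ> h) i f) ((e \<circ> h) i)) \<in> B"
      using fr \<open>f \<in> A\<close> by (simp add: is_frame_def)
  next
    fix i assume "i \<in> {0..<card I}"
    then have "h i \<in> I" using h by (auto simp: bij_betw_def)
    then show "(e \<circ> h) i \<in> A" "qfunctional_on A ((\<xi> \<circ> h) i)" "f \<in> B \<Longrightarrow> (\<xi> \<circ> h) i f = 0" for f
      using fr by (simp_all add: is_frame_def)
  qed simp
  moreover have "\<tau> = (\<Sum>i\<in>{0..<card I}. (\<xi> \<circ> h) i (\<phi> ((e \<circ> h) i)))"
    using sum.reindex_bij_betw[OF h, of "\<lambda>i. \<xi> i (\<phi> (e i))"] \<tau> by simp
  ultimately show ?thesis unfolding has_trace_def by blast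
qed

lemma is_frame_functional_eq:
  assumes fr: "is_frame A B I e \<xi>" and "qsubspace A" "qsubspace B" "B \<subseteq> A"
    and \<zeta>: "qfunctional_on A \<zeta>" "\<And>f. f \<in> B \<Longrightarrow> \<zeta> f = 0" and f: "f \<in> A"
  shows "\<zeta> f = (\<Sum>i\<in>I. \<xi> i f * \<zeta> (e i))"
proof -
  let ?s = "\<Sum>i\<in>I. qscale (\<xi> i f) (e i)"
  have e: "\<And>i. i \<in> I \<Longrightarrow> e i \<in> A" and d: "f - ?s \<in> B" using fr f by (auto simp: is_frame_def)
  have "?s \<in> A" by (intro qsubspace_sum qsubspace_scale assms e)
  then have "\<zeta> ((f - ?s) + ?s) = \<zeta> (f - ?s) + \<zeta> ?s"
    using \<zeta>(1) d \<open>B \<subseteq> A\<close> unfolding qfunctional_on_def by blast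
  then show ?thesis using \<zeta>(2)[OF d] qfunctional_on_lincomb[OF \<zeta>(1) assms(2) e] by simp
qed

text \<open>The argument for Tr(XY) = Tr(YX): expand each frame in the other and interchange the
  sums. Linear independence never enters, only the reproducing property.\<close>

lemma frame_trace_unique:
  assumes fr: "is_frame A B I e \<xi>" and fr': "is_frame A B J e' \<xi>'"
    and AB: "qsubspace A" "qsubspace B" "B \<subseteq> A"
    and \<phi>: "qlinear_on A \<phi>" "\<And>f. f \<in> A \<Longrightarrow> \<phi> f \<in> A" "\<And>f. f \<in> B \<Longrightarrow> \<phi> f \<in> B"
  shows "(\<Sum>i\<in>I. \<xi> i (\<phi> (e i))) = (\<Sum>j\<in>J. \<xi>' j (\<phi> (e' j)))"
proof -
  have e: "\<And>i. i \<in> I \<Longrightarrow> e i \<in> A" and e': "\<And>j. j \<in> J \<Longrightarrow> e' j \<in> A"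
    and \<xi>: "\<And>i. i \<in> I \<Longrightarrow> qfunctional_on A (\<xi> i)" "\<And>i f. i \<in> I \<Longrightarrow> f \<in> B \<Longrightarrow> \<xi> i f = 0"
    and \<xi>': "\<And>i. i \<in> J \<Longrightarrow> qfunctional_on A (\<xi>' i)" "\<And>i f. i \<in> J \<Longrightarrow> f \<in> B \<Longrightarrow> \<xi>' i f = 0"
    using fr fr' by (auto simp: is_frame_def)
  have "\<xi> i (\<phi> (e i)) = (\<Sum>j\<in>J. \<xi>' j (e i) * \<xi> i (\<phi> (e' j)))" if i: "i \<in> I" for i
  proof (rule is_frame_functional_eq[OF fr' AB _ _ e[OF i], of "\<lambda>f. \<xi> i (\<phi> f)"])
    show "qfunctional_on A (\<lambda>f. \<xi> i (\<phi> f))"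
      using \<xi>(1)[OF i] \<phi>(1,2) by (simp add: qfunctional_on_def qlinear_on_def)
  qed (use \<xi>(2)[OF i] \<phi>(3) in simp)
  then have "(\<Sum>i\<in>I. \<xi> i (\<phi> (e i))) = (\<Sum>i\<in>I. \<Sum>j\<in>J. \<xi>' j (e i) * \<xi> i (\<phi> (e' j)))" by simp
  also have "\<dots> = (\<Sum>j\<in>J. \<Sum>i\<in>I. \<xi> i (\<phi> (e' j)) * \<xi>' j (e i))"
    by (subst sum.swap) (simp add: mult.commute)
  also have "\<dots> = (\<Sum>j\<in>J. \<xi>' j (\<phi> (e' j)))"
    by (intro sum.cong refl is_frame_functional_eq[OF fr AB \<xi>', symmetric] \<phi>(2) e')
  finally show ?thesis .
qed

section \<open>Modules with a semilinear action\<close>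

definition rmodule :: "nat \<Rightarrow> tuple set \<Rightarrow> bool" where
  "rmodule n M \<longleftrightarrow> 0 \<in> M \<and> (\<forall>f\<in>M. \<forall>g\<in>M. f + g \<in> M) \<and> (\<forall>p\<in>tpolys n. \<forall>f\<in>M. pscale p f \<in> M)"

definition augmentation :: "nat \<Rightarrow> tuple set \<Rightarrow> tuple set" where
  "augmentation n M = {(\<Sum>i\<in>{1..n}. pscale (tvar i) (g i)) | g. \<forall>i\<in>{1..n}. g i \<in> M}"

definition stable_rmodule :: "nat \<Rightarrow> tuple set \<Rightarrow> bool" where
  "stable_rmodule n M \<longleftrightarrow>
     rmodule n M \<and> (\<forall>\<sigma> f. \<sigma> permutes {1..n} \<longrightarrow> f \<in> M \<longrightarrow> dot_action \<sigma> f \<in> M)"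

lemma rmodule_qsubspace: "rmodule n M \<Longrightarrow> qsubspace M"
  by (simp add: rmodule_def qsubspace_def)

lemma rmodule_pscale: "rmodule n M \<Longrightarrow> p \<in> tpolys n \<Longrightarrow> f \<in> M \<Longrightarrow> pscale p f \<in> M"
  by (simp add: rmodule_def)

lemma augmentation_subset: "rmodule n M \<Longrightarrow> augmentation n M \<subseteq> M"
  unfolding augmentation_def
  by (auto intro!: qsubspace_sum[OF rmodule_qsubspace] rmodule_pscale)

lemma augmentationI:
  "(\<And>i. i \<in> {1..n} \<Longrightarrow> g i \<in> M) \<Longrightarrow> (\<Sum>i\<in>{1..n}. pscale (tvar i) (g i)) \<in> augmentation n M"
  unfolding augmentation_def by blast

lemma rmodule_augmentation:
  assumes M: "rmodule n M"
  shows "rmodule n (augmentation n M)"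
  unfolding rmodule_def
proof (intro conjI ballI)
  show "0 \<in> augmentation n M"
    using augmentationI[of n "\<lambda>_. 0" M] M by (simp add: rmodule_def)
next
  fix f f' assume f: "f \<in> augmentation n M" "f' \<in> augmentation n M"
  obtain g where 1: "\<And>i. i \<in> {1..n} \<Longrightarrow> g i \<in> M" "f = (\<Sum>i\<in>{1..n}. pscale (tvar i) (g i))"
    using f(1) unfolding augmentation_def by blast
  obtain g' where 2: "\<And>i. i \<in> {1..n} \<Longrightarrow> g' i \<in> M" "f' = (\<Sum>i\<in>{1..n}. pscale (tvar i) (g' i))"
    using f(2) unfolding augmentation_def by blast
  have "f + f' = (\<Sum>i\<in>{1..n}. pscale (tvar i) (g i + g' i))"
    by (simp add: 1(2) 2(2) pscale_add sum.distrib)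
  also have "\<dots> \<in> augmentation n M"
    by (rule augmentationI) (use 1(1) 2(1) M in \<open>simp add: rmodule_def\<close>)
  finally show "f + f' \<in> augmentation n M" .
next
  fix p f assume p: "p \<in> tpolys n" and "f \<in> augmentation n M"
  then obtain g where *: "\<And>i. i \<in> {1..n} \<Longrightarrow> g i \<in> M" "f = (\<Sum>i\<in>{1..n}. pscale (tvar i) (g i))"
    unfolding augmentation_def by blast
  have "pscale p f = (\<Sum>i\<in>{1..n}. pscale (tvar i) (pscale p (g i)))"
    unfolding *(2) pscale_sum by (intro sum.cong refl pscale_commute)
  also have "\<dots> \<in> augmentation n M"
    by (rule augmentationI) (use * M p in \<open>simp add: rmodule_def\<close>)
  finally show "pscale p f \<in> augmentation n M" .
qed

lemma dot_action_add: "dot_action \<sigma> (f + g) = dot_action \<sigma> f + dot_action \<sigma> g"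
  by (simp add: dot_action_def fun_eq_iff permute_vars_add)

lemma dot_action_pscale: "dot_action \<sigma> (pscale p f) = pscale (permute_vars \<sigma> p) (dot_action \<sigma> f)"
  by (simp add: dot_action_def fun_eq_iff permute_vars_mult pscale_apply)

lemma dot_action_0 [simp]: "dot_action \<sigma> 0 = 0"
  by (simp add: dot_action_def fun_eq_iff)

lemma dot_action_sum: "dot_action \<sigma> (\<Sum>i\<in>A. f i) = (\<Sum>i\<in>A. dot_action \<sigma> (f i))"
  using sum_comp_morphism[of "dot_action \<sigma>" f A] by (simp add: o_def dot_action_add)

lemma qlinear_on_dot_action: "qlinear_on A (dot_action \<sigma>)"
  by (simp add: qlinear_on_def dot_action_add dot_action_pscale)

lemma dot_action_augmentation:
  assumes \<sigma>: "\<sigma> permutes {1..n}" and M: "stable_rmodule n M" and f: "f \<in> augmentation n M"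
  shows "dot_action \<sigma> f \<in> augmentation n M"
proof -
  obtain g where g: "\<And>i. i \<in> {1..n} \<Longrightarrow> g i \<in> M" "f = (\<Sum>i\<in>{1..n}. pscale (tvar i) (g i))"
    using f unfolding augmentation_def by blast
  have inv: "Hilbert_Choice.inv \<sigma> permutes {1..n}" using \<sigma> by (rule permutes_inv)
  have "dot_action \<sigma> f = (\<Sum>i\<in>{1..n}. pscale (tvar (\<sigma> i)) (dot_action \<sigma> (g i)))"
    by (simp add: g(2) dot_action_sum dot_action_pscale)
  \<comment> \<open>The action moves the variables too; reindexing by the inverse of \<sigma>
    restores the form required by \<open>augmentation\<close>.\<close>
  also have "\<dots> = (\<Sum>i\<in>{1..n}. pscale (tvar i) (dot_action \<sigma> (g (Hilbert_Choice.inv \<sigma> i))))"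
    using sum.permute[OF inv, of "\<lambda>i. pscale (tvar (\<sigma> i)) (dot_action \<sigma> (g i))"]
    by (simp add: o_def permutes_inverses[OF \<sigma>])
  also have "\<dots> \<in> augmentation n M"
    by (rule augmentationI)
       (use M g \<sigma> permutes_in_image[OF inv] in \<open>simp add: stable_rmodule_def\<close>)
  finally show ?thesis .
qed

text \<open>\<open>\<tau> \<sigma>\<close> is the trace of \<open>\<sigma>\<close> on the ungraded quotient \<open>M / (t\<^sub>1, \<dots>, t\<^sub>n) M\<close>.\<close>

definition has_character :: "nat \<Rightarrow> tuple set \<Rightarrow> ((nat \<Rightarrow> nat) \<Rightarrow> rat) \<Rightarrow> bool" where
  "has_character n M \<tau> \<longleftrightarrow>
     (\<forall>\<sigma>. \<sigma> permutes {1..n} \<longrightarrow> has_trace M (augmentation n M) (dot_action \<sigma>) (\<tau> \<sigma>))"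

lemma has_character_unique:
  assumes M: "stable_rmodule n M" and "has_character n M \<tau>" "has_character n M \<tau>'"
    and \<sigma>: "\<sigma> permutes {1..n}"
  shows "\<tau> \<sigma> = \<tau>' \<sigma>"
proof -
  have r: "rmodule n M" using M by (simp add: stable_rmodule_def)
  obtain I :: "nat set" and e \<xi> where 1: "is_frame M (augmentation n M) I e \<xi>"
      "\<tau> \<sigma> = (\<Sum>i\<in>I. \<xi> i (dot_action \<sigma> (e i)))"
    using assms(2) \<sigma> unfolding has_character_def has_trace_def by blast
  obtain J :: "nat set" and e' \<xi>' where 2: "is_frame M (augmentation n M) J e' \<xi>'"
      "\<tau>' \<sigma> = (\<Sum>i\<in>J. \<xi>' i (dot_action \<sigma> (e' i)))"
    using assms(3) \<sigma> unfolding has_character_def has_trace_def by blast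
  show ?thesis unfolding 1(2) 2(2)
  proof (rule frame_trace_unique[OF 1(1) 2(1) rmodule_qsubspace[OF r]
        rmodule_qsubspace[OF rmodule_augmentation[OF r]] augmentation_subset[OF r]
        qlinear_on_dot_action])
    show "dot_action \<sigma> f \<in> M" if "f \<in> M" for f using M \<sigma> that by (simp add: stable_rmodule_def)
  qed (rule dot_action_augmentation[OF \<sigma> M])
qed

text \<open>M is the internal direct sum of the \<open>c p\<close> multiples of the
  \<open>N p\<close>. The multipliers need not lie in M; they commute with the action, so each
  summand is a copy of \<open>N p\<close> both as a module and as a representation.\<close>

definition direct_sum ::
    "nat \<Rightarrow> tuple set \<Rightarrow> nat set \<Rightarrow> (nat \<Rightarrow> tuple) \<Rightarrow> (nat \<Rightarrow> tuple set) \<Rightarrow> bool" where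
  "direct_sum n M P c N \<longleftrightarrow> finite P \<and> stable_rmodule n M \<and> (\<forall>p\<in>P. stable_rmodule n (N p)) \<and>
     (\<forall>p\<in>P. \<forall>g\<in>N p. c p * g \<in> M) \<and>
     (\<forall>p\<in>P. \<forall>\<sigma> g. \<sigma> permutes {1..n} \<longrightarrow> g \<in> N p \<longrightarrow> dot_action \<sigma> (c p * g) = c p * dot_action \<sigma> g) \<and>
     (\<forall>f\<in>M. \<exists>g. (\<forall>p\<in>P. g p \<in> N p) \<and> f = (\<Sum>p\<in>P. c p * g p)) \<and>
     (\<forall>g. (\<forall>p\<in>P. g p \<in> N p) \<longrightarrow> (\<Sum>p\<in>P. c p * g p) = 0 \<longrightarrow> (\<forall>p\<in>P. g p = 0))"

definition projections ::
    "nat \<Rightarrow> tuple set \<Rightarrow> nat set \<Rightarrow> (nat \<Rightarrow> tuple) \<Rightarrow> (nat \<Rightarrow> tuple set) \<Rightarrow> (nat \<Rightarrow> tuple \<Rightarrow> tuple) \<Rightarrow> bool"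
  where "projections n M P c N \<pi> \<longleftrightarrow> (\<forall>p\<in>P. \<forall>f\<in>M. \<pi> p f \<in> N p) \<and>
     (\<forall>f\<in>M. f = (\<Sum>p\<in>P. c p * \<pi> p f)) \<and>
     (\<forall>p\<in>P. \<forall>q\<in>P. \<forall>g\<in>N p. \<pi> q (c p * g) = (if q = p then g else 0)) \<and>
     (\<forall>p\<in>P. \<forall>f\<in>M. \<forall>g\<in>M. \<pi> p (f + g) = \<pi> p f + \<pi> p g) \<and>
     (\<forall>p\<in>P. \<forall>f\<in>M. \<forall>r\<in>tpolys n. \<pi> p (pscale r f) = pscale r (\<pi> p f)) \<and>
     (\<forall>p\<in>P. \<forall>f\<in>M. \<forall>\<sigma>. \<sigma> permutes {1..n} \<longrightarrow> \<pi> p (dot_action \<sigma> f) = dot_action \<sigma> (\<pi> p f)) \<and>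
     (\<forall>p\<in>P. \<forall>f\<in>augmentation n M. \<pi> p f \<in> augmentation n (N p))"

lemma projectionsD:
  assumes "projections n M P c N \<pi>"
  shows "\<And>p f. p \<in> P \<Longrightarrow> f \<in> M \<Longrightarrow> \<pi> p f \<in> N p"
    and "\<And>f. f \<in> M \<Longrightarrow> f = (\<Sum>p\<in>P. c p * \<pi> p f)"
    and "\<And>p q g. p \<in> P \<Longrightarrow> q \<in> P \<Longrightarrow> g \<in> N p \<Longrightarrow> \<pi> q (c p * g) = (if q = p then g else 0)"
    and "\<And>p f g. p \<in> P \<Longrightarrow> f \<in> M \<Longrightarrow> g \<in> M \<Longrightarrow> \<pi> p (f + g) = \<pi> p f + \<pi> p g"
    and "\<And>p f r. p \<in> P \<Longrightarrow> f \<in> M \<Longrightarrow> r \<in> tpolys n \<Longrightarrow> \<pi> p (pscale r f) = pscale r (\<pi> p f)"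
    and "\<And>p f \<sigma>. p \<in> P \<Longrightarrow> f \<in> M \<Longrightarrow> \<sigma> permutes {1..n} \<Longrightarrow> \<pi> p (dot_action \<sigma> f) = dot_action \<sigma> (\<pi> p f)"
    and "\<And>p f. p \<in> P \<Longrightarrow> f \<in> augmentation n M \<Longrightarrow> \<pi> p f \<in> augmentation n (N p)"
proof -
  note * = assms[unfolded projections_def]
  show "\<And>p f. p \<in> P \<Longrightarrow> f \<in> M \<Longrightarrow> \<pi> p f \<in> N p"
    by (rule *[THEN conjunct1, rule_format])
  show "\<And>f. f \<in> M \<Longrightarrow> f = (\<Sum>p\<in>P. c p * \<pi> p f)"
    by (rule *[THEN conjunct2, THEN conjunct1, rule_format])
  show "\<And>p q g. p \<in> P \<Longrightarrow> q \<in> P \<Longrightarrow> g \<in> N p \<Longrightarrow> \<pi> q (c p * g) = (if q = p then g else 0)"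
    by (rule *[THEN conjunct2, THEN conjunct2, THEN conjunct1, rule_format])
  show "\<And>p f g. p \<in> P \<Longrightarrow> f \<in> M \<Longrightarrow> g \<in> M \<Longrightarrow> \<pi> p (f + g) = \<pi> p f + \<pi> p g"
    by (rule *[THEN conjunct2, THEN conjunct2, THEN conjunct2, THEN conjunct1, rule_format])
  show "\<And>p f r. p \<in> P \<Longrightarrow> f \<in> M \<Longrightarrow> r \<in> tpolys n \<Longrightarrow> \<pi> p (pscale r f) = pscale r (\<pi> p f)"
    by (rule *[THEN conjunct2, THEN conjunct2, THEN conjunct2, THEN conjunct2, THEN conjunct1, rule_format])
  show "\<And>p f \<sigma>. p \<in> P \<Longrightarrow> f \<in> M \<Longrightarrow> \<sigma> permutes {1..n} \<Longrightarrow> \<pi> p (dot_action \<sigma> f) = dot_action \<sigma> (\<pi> p f)"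
    by (rule *[THEN conjunct2, THEN conjunct2, THEN conjunct2, THEN conjunct2, THEN conjunct2, THEN conjunct1, rule_format])
  show "\<And>p f. p \<in> P \<Longrightarrow> f \<in> augmentation n M \<Longrightarrow> \<pi> p f \<in> augmentation n (N p)"
    by (rule *[THEN conjunct2, THEN conjunct2, THEN conjunct2, THEN conjunct2, THEN conjunct2, THEN conjunct2, rule_format])
qed

text \<open>The coefficients of a decomposition are unique, so any choice of them is automatically
  additive, linear over the polynomials and equivariant.\<close>

lemma direct_sum_projections:
  assumes "direct_sum n M P c N"
  shows "\<exists>\<pi>. projections n M P c N \<pi>"
proof -
  have P: "finite P" and M: "stable_rmodule n M" "rmodule n M"
    and N: "\<And>p. p \<in> P \<Longrightarrow> stable_rmodule n (N p)" "\<And>p. p \<in> P \<Longrightarrow> rmodule n (N p)"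
    and cM: "\<And>p g. p \<in> P \<Longrightarrow> g \<in> N p \<Longrightarrow> c p * g \<in> M"
    and cdot: "\<And>p g \<sigma>. p \<in> P \<Longrightarrow> \<sigma> permutes {1..n} \<Longrightarrow> g \<in> N p \<Longrightarrow>
                  dot_action \<sigma> (c p * g) = c p * dot_action \<sigma> g"
    and ex: "\<forall>f\<in>M. \<exists>g. (\<forall>p\<in>P. g p \<in> N p) \<and> f = (\<Sum>p\<in>P. c p * g p)"
    using assms by (simp_all add: direct_sum_def stable_rmodule_def)
  have unique0: "g p = 0" if "\<And>p. p \<in> P \<Longrightarrow> g p \<in> N p" "(\<Sum>p\<in>P. c p * g p) = 0" "p \<in> P" for g p
    using assms that unfolding direct_sum_def by blast
  from ex obtain G where G: "\<And>f p. f \<in> M \<Longrightarrow> p \<in> P \<Longrightarrow> G f p \<in> N p"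
      "\<And>f. f \<in> M \<Longrightarrow> f = (\<Sum>p\<in>P. c p * G f p)"
    by metis
  note sub = rmodule_qsubspace[OF N(2)]
  have GI: "G f p = g p" if "\<And>p. p \<in> P \<Longrightarrow> g p \<in> N p" "f = (\<Sum>p\<in>P. c p * g p)" "p \<in> P" for f g p
  proof -
    have fM: "f \<in> M" unfolding that(2)
      by (intro qsubspace_sum[OF rmodule_qsubspace[OF M(2)]] cM that)
    have "(\<Sum>p\<in>P. c p * (G f p - g p)) = f - f"
      unfolding right_diff_distrib sum_subtractf
      by (rule arg_cong2[where f = "(-)", OF G(2)[OF fM, symmetric] that(2)[symmetric]])
    then have "G f p - g p = 0"
      by (intro unique0[of "\<lambda>p. G f p - g p"]) (use that G(1)[OF fM] in \<open>auto intro: qsubspace_diff[OF sub]\<close>)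
    then show ?thesis by simp
  qed
  have scale: "G (pscale r f) p = pscale r (G f p)" if "p \<in> P" "f \<in> M" "r \<in> tpolys n" for p f r
  proof (rule GI)
    have "pscale r f = (\<Sum>p\<in>P. pscale r (c p * G f p))"
      unfolding pscale_sum[symmetric] by (rule arg_cong[OF G(2)[OF that(2)]])
    then show "pscale r f = (\<Sum>p\<in>P. c p * pscale r (G f p))" by (simp add: pscale_mult_right)
  qed (use that G(1) in \<open>auto intro: rmodule_pscale[OF N(2)]\<close>)
  have add: "G (f + g) p = G f p + G g p" if "p \<in> P" "f \<in> M" "g \<in> M" for p f g
  proof (rule GI)
    have "f + g = (\<Sum>p\<in>P. c p * G f p) + (\<Sum>p\<in>P. c p * G g p)"
      by (rule arg_cong2[where f = "(+)", OF G(2)[OF that(2)] G(2)[OF that(3)]])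
    then show "f + g = (\<Sum>p\<in>P. c p * (G f p + G g p))"
      by (simp add: distrib_left sum.distrib)
  qed (blast intro: qsubspace_add[OF sub] G(1) that)+
  have G0: "G 0 p = 0" if "p \<in> P" for p
    using scale[OF that, of 0 0] M(2) by (simp add: rmodule_def)
  have sum: "G (\<Sum>i\<in>I. f i) p = (\<Sum>i\<in>I. G (f i) p)"
    if "p \<in> P" "\<And>i. i \<in> I \<Longrightarrow> f i \<in> M" for p f and I :: "nat set"
    using that(2)
  proof (induction I rule: infinite_finite_induct)
    case (insert i I)
    have "G (f i + (\<Sum>i\<in>I. f i)) p = G (f i) p + G (\<Sum>i\<in>I. f i) p"
      using insert.prems by (intro add that(1) qsubspace_sum[OF rmodule_qsubspace[OF M(2)]]) auto
    moreover have "G (\<Sum>i\<in>I. f i) p = (\<Sum>i\<in>I. G (f i) p)"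
      by (rule insert.IH) (use insert.prems in auto)
    ultimately show ?case unfolding sum.insert[OF insert.hyps] by (simp only:)
  next
    case empty
    show ?case unfolding sum.empty by (rule G0[OF that(1)])
  next
    case (infinite I)
    show ?case unfolding sum.infinite[OF infinite.hyps] by (rule G0[OF that(1)])
  qed
  have "projections n M P c N (\<lambda>p f. G f p)"
    unfolding projections_def
  proof (intro conjI ballI allI impI)
    fix p q g assume "p \<in> P" "q \<in> P" "g \<in> N p"
    show "G (c p * g) q = (if q = p then g else 0)"
    proof (rule GI[where g = "\<lambda>q. if q = p then g else 0"])
      have "(\<Sum>q\<in>P. c q * (if q = p then g else 0)) = (\<Sum>q\<in>P. if q = p then c q * g else 0)"
        by (rule sum.cong) auto
      then show "c p * g = (\<Sum>q\<in>P. c q * (if q = p then g else 0))"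
        using P \<open>p \<in> P\<close> by simp
    qed (use \<open>g \<in> N p\<close> \<open>q \<in> P\<close> qsubspace_0[OF sub] in auto)
  next
    fix p f \<sigma> assume *: "p \<in> P" "f \<in> M" "\<sigma> permutes {1..n}"
    show "G (dot_action \<sigma> f) p = dot_action \<sigma> (G f p)"
    proof (rule GI)
      have "dot_action \<sigma> f = dot_action \<sigma> (\<Sum>p\<in>P. c p * G f p)"
        by (rule arg_cong[OF G(2)[OF *(2)]])
      then show "dot_action \<sigma> f = (\<Sum>p\<in>P. c p * dot_action \<sigma> (G f p))"
        using cdot[OF _ *(3) G(1)[OF *(2)]] by (simp add: dot_action_sum)
    qed (use * N(1) G(1) in \<open>auto simp: stable_rmodule_def\<close>)
  next
    fix p f assume p: "p \<in> P" and "f \<in> augmentation n M"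
    then obtain g where g: "\<And>i. i \<in> {1..n} \<Longrightarrow> g i \<in> M" "f = (\<Sum>i\<in>{1..n}. pscale (tvar i) (g i))"
      unfolding augmentation_def by blast
    have "G f p = (\<Sum>i\<in>{1..n}. G (pscale (tvar i) (g i)) p)"
      unfolding g(2) using g(1) M(2) p by (intro sum) (auto intro: rmodule_pscale)
    also have "\<dots> = (\<Sum>i\<in>{1..n}. pscale (tvar i) (G (g i) p))"
      by (intro sum.cong refl scale p g) auto
    also have "\<dots> \<in> augmentation n (N p)" by (rule augmentationI) (use p g G in auto)
    finally show "G f p \<in> augmentation n (N p)" .
  qed (use G scale add in blast)+
  then show ?thesis by blast
qed

lemma direct_sum_augmentation:
  assumes "direct_sum n M P c N" "p \<in> P" "g \<in> augmentation n (N p)"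
  shows "c p * g \<in> augmentation n M"
proof -
  from assms(3) obtain h where h: "\<And>i. i \<in> {1..n} \<Longrightarrow> h i \<in> N p" "g = (\<Sum>i\<in>{1..n}. pscale (tvar i) (h i))"
    unfolding augmentation_def by blast
  have "c p * g = (\<Sum>i\<in>{1..n}. pscale (tvar i) (c p * h i))"
    by (simp add: h(2) sum_distrib_left pscale_mult_right)
  also have "\<dots> \<in> augmentation n M"
    by (rule augmentationI) (use assms(1,2) h in \<open>simp_all add: direct_sum_def\<close>)
  finally show ?thesis .
qed

lemma direct_sum_stable:
  assumes "direct_sum n M P c N"
  shows "stable_rmodule n M" "p \<in> P \<Longrightarrow> stable_rmodule n (N p)"
proof -
  have "stable_rmodule n M \<and> (\<forall>p\<in>P. stable_rmodule n (N p))"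
    using assms unfolding direct_sum_def by (elim conjE) (intro conjI; assumption)
  then show "stable_rmodule n M" "p \<in> P \<Longrightarrow> stable_rmodule n (N p)" by blast+
qed

text \<open>Projecting the vectors of a frame and restricting its functionals along the inclusion
  gives a frame of the summand, whereas the projection of a basis is in general dependent. Only
  existence is claimed; the value is recovered later from multiplicities.\<close>

lemma has_character_summand:
  assumes ds: "direct_sum n M P c N" and "has_character n M \<tau>" and p: "p \<in> P"
  shows "\<exists>\<tau>'. has_character n (N p) \<tau>'"
proof -
  obtain \<pi> where "projections n M P c N \<pi>" using direct_sum_projections[OF ds] by blast
  note \<pi> = projectionsD[OF this]
  have cM: "\<And>g. g \<in> N p \<Longrightarrow> c p * g \<in> M" using ds p by (simp_all add: direct_sum_def)
  have M: "rmodule n M" and Np: "rmodule n (N p)"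
    using direct_sum_stable[OF ds] p by (auto simp: stable_rmodule_def)
  note Ms = rmodule_qsubspace[OF M]
  have ql: "qlinear_on M (\<pi> p)" using \<pi>(4,5) p by (simp add: qlinear_on_def)
  have "\<exists>\<tau>'. has_trace (N p) (augmentation n (N p)) (dot_action \<sigma>) \<tau>'" if "\<sigma> permutes {1..n}" for \<sigma>
  proof -
    from assms(2) that obtain I :: "nat set" and e \<xi> where fr: "is_frame M (augmentation n M) I e \<xi>"
      unfolding has_character_def has_trace_def by blast
    have e: "\<And>i. i \<in> I \<Longrightarrow> e i \<in> M" using fr by (auto simp: is_frame_def)
    have "is_frame (N p) (augmentation n (N p)) I (\<lambda>i. \<pi> p (e i)) (\<lambda>i g. \<xi> i (c p * g))"
      unfolding is_frame_def
    proof (intro conjI ballI)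
      fix g assume g: "g \<in> N p"
      let ?s = "\<Sum>i\<in>I. qscale (\<xi> i (c p * g)) (e i)"
      have s: "?s \<in> M" by (intro qsubspace_sum[OF Ms] qsubspace_scale[OF Ms] e)
      have "c p * g - ?s \<in> augmentation n M" using fr cM[OF g] by (auto simp: is_frame_def)
      then have "\<pi> p (c p * g - ?s) \<in> augmentation n (N p)" by (rule \<pi>(7)[OF p])
      also have "\<pi> p (c p * g - ?s) = \<pi> p (c p * g + qscale (-1) ?s)" by (simp add: qscale_minus_1)
      also have "\<dots> = \<pi> p (c p * g) + \<pi> p (qscale (-1) ?s)"
        by (intro \<pi>(4) p cM g qsubspace_scale[OF Ms] s)
      also have "\<pi> p (qscale (-1) ?s) = qscale (-1) (\<pi> p ?s)" by (intro \<pi>(5) p s) simp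
      also have "\<pi> p ?s = (\<Sum>i\<in>I. qscale (\<xi> i (c p * g)) (\<pi> p (e i)))"
        by (rule qlinear_on_lincomb[OF ql Ms e])
      also have "\<pi> p (c p * g) = g" using \<pi>(3)[OF p p g] by simp
      finally show "g - (\<Sum>i\<in>I. qscale (\<xi> i (c p * g)) (\<pi> p (e i))) \<in> augmentation n (N p)"
        by (simp only: qscale_minus_1 add_uminus_conv_diff)
    next
      fix i assume i: "i \<in> I"
      show "\<pi> p (e i) \<in> N p" by (rule \<pi>(1)[OF p e[OF i]])
      show "qfunctional_on (N p) (\<lambda>g. \<xi> i (c p * g))"
        using fr i cM by (auto simp: is_frame_def qfunctional_on_def distrib_left pscale_mult_right)
      show "\<xi> i (c p * f) = 0" if "f \<in> augmentation n (N p)" for f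
        using direct_sum_augmentation[OF ds p that] fr i by (auto simp: is_frame_def)
    qed (use fr in \<open>simp add: is_frame_def\<close>)
    then show ?thesis using has_traceI by blast
  qed
  then show ?thesis unfolding has_character_def by metis
qed

text \<open>Frames of the summands, with vectors multiplied by \<open>c p\<close> and functionals
  composed with the projections, join to one frame of M; equivariance of the projections makes the
  trace split.\<close>

lemma has_character_direct_sum:
  assumes ds: "direct_sum n M P c N" and ch: "\<And>p. p \<in> P \<Longrightarrow> has_character n (N p) (\<tau> p)"
  shows "has_character n M (\<lambda>\<sigma>. \<Sum>p\<in>P. \<tau> p \<sigma>)"
  unfolding has_character_def
proof (intro allI impI)
  fix \<sigma> assume \<sigma>: "\<sigma> permutes {1..n}"
  obtain \<pi> where "projections n M P c N \<pi>" using direct_sum_projections[OF ds] by blast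
  note \<pi> = projectionsD[OF this]
  have P: "finite P" and cM: "\<And>p g. p \<in> P \<Longrightarrow> g \<in> N p \<Longrightarrow> c p * g \<in> M"
    using ds by (simp_all add: direct_sum_def)
  have M: "rmodule n M" using direct_sum_stable[OF ds] by (auto simp: stable_rmodule_def)
  note B = rmodule_qsubspace[OF rmodule_augmentation[OF M]]
  have "\<exists>(I::nat set) e \<xi>. is_frame (N p) (augmentation n (N p)) I e \<xi> \<and>
      \<tau> p \<sigma> = (\<Sum>i\<in>I. \<xi> i (dot_action \<sigma> (e i)))" if "p \<in> P" for p
    using ch[OF that] \<sigma> by (auto simp: has_character_def has_trace_def)
  then obtain I e \<xi> where fr: "\<And>p. p \<in> P \<Longrightarrow> is_frame (N p) (augmentation n (N p)) (I p :: nat set) (e p) (\<xi> p)"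
    and tr: "\<And>p. p \<in> P \<Longrightarrow> \<tau> p \<sigma> = (\<Sum>i\<in>I p. \<xi> p i (dot_action \<sigma> (e p i)))"
    by metis
  have I: "\<And>p. p \<in> P \<Longrightarrow> finite (I p)" and e: "\<And>p i. p \<in> P \<Longrightarrow> i \<in> I p \<Longrightarrow> e p i \<in> N p"
    using fr by (auto simp: is_frame_def)
  have "is_frame M (augmentation n M) (Sigma P I) (\<lambda>(p, i). c p * e p i) (\<lambda>(p, i) f. \<xi> p i (\<pi> p f))"
    unfolding is_frame_def
  proof (intro conjI ballI)
    show "finite (Sigma P I)" using P I by simp
  next
    fix f assume f: "f \<in> M"
    have "(\<Sum>x\<in>Sigma P I. qscale ((case x of (p, i) \<Rightarrow> \<lambda>f. \<xi> p i (\<pi> p f)) f) (case x of (p, i) \<Rightarrow> c p * e p i))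
        = (\<Sum>p\<in>P. \<Sum>i\<in>I p. qscale (\<xi> p i (\<pi> p f)) (c p * e p i))"
      by (subst sum.Sigma) (use P I in \<open>auto intro!: sum.cong\<close>)
    also have "\<dots> = (\<Sum>p\<in>P. c p * (\<Sum>i\<in>I p. qscale (\<xi> p i (\<pi> p f)) (e p i)))"
      by (simp add: sum_distrib_left pscale_mult_right)
    finally have "f - (\<Sum>x\<in>Sigma P I. qscale ((case x of (p, i) \<Rightarrow> \<lambda>f. \<xi> p i (\<pi> p f)) f) (case x of (p, i) \<Rightarrow> c p * e p i))
        = (\<Sum>p\<in>P. c p * \<pi> p f) - (\<Sum>p\<in>P. c p * (\<Sum>i\<in>I p. qscale (\<xi> p i (\<pi> p f)) (e p i)))"
      by (rule arg_cong2[where f = "(-)", OF \<pi>(2)[OF f]])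
    also have "\<dots> = (\<Sum>p\<in>P. c p * (\<pi> p f - (\<Sum>i\<in>I p. qscale (\<xi> p i (\<pi> p f)) (e p i))))"
      by (simp add: right_diff_distrib sum_subtractf)
    also have "\<dots> \<in> augmentation n M"
      by (intro qsubspace_sum[OF B] direct_sum_augmentation[OF ds])
         (use fr \<pi>(1)[OF _ f] in \<open>auto simp: is_frame_def\<close>)
    finally show "f - (\<Sum>x\<in>Sigma P I. qscale ((case x of (p, i) \<Rightarrow> \<lambda>f. \<xi> p i (\<pi> p f)) f) (case x of (p, i) \<Rightarrow> c p * e p i))
        \<in> augmentation n M" .
  next
    fix x assume "x \<in> Sigma P I"
    then obtain p i where x: "x = (p, i)" "p \<in> P" "i \<in> I p" by auto
    show "(case x of (p, i) \<Rightarrow> c p * e p i) \<in> M" using x cM e by simp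
    have \<xi>: "qfunctional_on (N p) (\<xi> p i)" "\<forall>f\<in>augmentation n (N p). \<xi> p i f = 0"
      using fr[OF x(2)] x(3) by (auto simp: is_frame_def)
    then show "qfunctional_on M (case x of (p, i) \<Rightarrow> \<lambda>f. \<xi> p i (\<pi> p f))"
      using x \<pi>(1,4,5) by (simp add: qfunctional_on_def)
    show "(case x of (p, i) \<Rightarrow> \<lambda>f. \<xi> p i (\<pi> p f)) f = 0" if "f \<in> augmentation n M" for f
      using x \<pi>(7) that \<xi> by simp
  qed
  then show "has_trace M (augmentation n M) (dot_action \<sigma>) (\<Sum>p\<in>P. \<tau> p \<sigma>)"
  proof (rule has_traceI)
    have "\<xi> p i (dot_action \<sigma> (e p i)) = \<xi> p i (\<pi> p (dot_action \<sigma> (c p * e p i)))"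
      if "p \<in> P" "i \<in> I p" for p i
      using \<pi>(3)[OF that(1,1) e[OF that]] \<pi>(6)[OF that(1) cM[OF that(1) e[OF that]] \<sigma>] by simp
    then have "(\<Sum>p\<in>P. \<tau> p \<sigma>) = (\<Sum>p\<in>P. \<Sum>i\<in>I p. \<xi> p i (\<pi> p (dot_action \<sigma> (c p * e p i))))"
      using tr by simp
    then show "(\<Sum>p\<in>P. \<tau> p \<sigma>) = (\<Sum>x\<in>Sigma P I. (case x of (p, i) \<Rightarrow> \<lambda>f. \<xi> p i (\<pi> p f))
        (dot_action \<sigma> (case x of (p, i) \<Rightarrow> c p * e p i)))"
      by (subst (asm) sum.Sigma) (use P I in \<open>auto intro!: sum.cong\<close>)
  qed
qed

section \<open>Interpolation over an integral domain\<close>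

lemma dvd_prod_cancel:
  fixes u :: "'a::idom"
  assumes "finite S" and "\<And>i q. i \<in> S \<Longrightarrow> u dvd y i * q \<Longrightarrow> u dvd q" and "u dvd (\<Prod>i\<in>S. y i) * q"
  shows "u dvd q"
  using assms
proof (induction S arbitrary: q rule: finite_induct)
  case (insert s S)
  have "u dvd y s * ((\<Prod>i\<in>S. y i) * q)" using insert.prems(2) insert.hyps by (simp add: mult.assoc)
  then have "u dvd (\<Prod>i\<in>S. y i) * q" using insert.prems(1) by blast
  then show ?case using insert.IH insert.prems(1) by blast
qed simp

text \<open>The last hypothesis is pairwise coprimality expressed as cancellation, the form supplied
  by \<open>tvar_diff_dvd_cancel\<close>.\<close>

lemma prod_dvd_of_cancel:
  fixes y :: "'i \<Rightarrow> 'a::idom"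
  assumes "finite S" and "\<And>i. i \<in> S \<Longrightarrow> y i dvd d"
    and "\<And>i j q. i \<in> S \<Longrightarrow> j \<in> S \<Longrightarrow> i \<noteq> j \<Longrightarrow> y i dvd y j * q \<Longrightarrow> y i dvd q"
  shows "(\<Prod>i\<in>S. y i) dvd d"
  using assms
proof (induction S rule: finite_induct)
  case (insert s S)
  have "(\<Prod>i\<in>S. y i) dvd d"
    by (rule insert.IH) (use insert.prems in blast)+
  then obtain q where q: "d = (\<Prod>i\<in>S. y i) * q" by (auto simp: dvd_def)
  have "y s dvd q"
  proof (rule dvd_prod_cancel[OF insert.hyps(1)])
    show "y s dvd q" if "i \<in> S" "y s dvd y i * q" for i q
      using that insert.prems(2) insert.hyps(2) by blast
    show "y s dvd (\<Prod>i\<in>S. y i) * q" using insert.prems(1)[of s] q by simp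
  qed
  then show ?case using insert.hyps q by (simp add: mult.commute mult_dvd_mono)
qed simp

lemma poly_diff_dvd: "a - b dvd poly P a - poly P (b::'a::comm_ring_1)"
proof (induction P)
  case (pCons c P)
  have "a - b dvd (a - b) * poly P a + b * (poly P a - poly P b)"
    using pCons.IH by (intro dvd_add dvd_mult dvd_triv_left)
  then show ?case by (simp add: algebra_simps)
qed simp

text \<open>The error of the previous interpolant at a new node is divisible by each difference of
  nodes, hence by their product; the quotient is the next Newton coefficient.\<close>

lemma newton_interpolation_poly:
  fixes x y :: "'i \<Rightarrow> 'a::idom"
  assumes "finite T" and "\<And>i j. i \<in> T \<Longrightarrow> j \<in> T \<Longrightarrow> x i - x j dvd y i - y j"
    and "\<And>i j l q. i \<in> T \<Longrightarrow> j \<in> T \<Longrightarrow> l \<in> T \<Longrightarrow> i \<noteq> j \<Longrightarrow> i \<noteq> l \<Longrightarrow> j \<noteq> l \<Longrightarrow>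
                 x i - x j dvd (x i - x l) * q \<Longrightarrow> x i - x j dvd q"
  shows "\<exists>P. (\<forall>i\<in>T. poly P (x i) = y i) \<and> (\<forall>m\<ge>card T. Polynomial.coeff P m = 0)"
  using assms
proof (induction T rule: finite_induct)
  case empty
  show ?case by (rule exI[of _ 0]) simp
next
  case (insert a T)
  have "\<exists>P. (\<forall>i\<in>T. poly P (x i) = y i) \<and> (\<forall>m\<ge>card T. Polynomial.coeff P m = 0)"
    by (rule insert.IH) (use insert.prems in blast)+
  then obtain P where P: "\<forall>i\<in>T. poly P (x i) = y i" "\<forall>m\<ge>card T. Polynomial.coeff P m = 0" by blast
  have "(\<Prod>i\<in>T. x a - x i) dvd y a - poly P (x a)"
  proof (rule prod_dvd_of_cancel[OF insert.hyps(1)])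
    fix i assume i: "i \<in> T"
    have "x a - x i dvd (y a - y i) - (poly P (x a) - poly P (x i))"
      using insert.prems(1)[of a i] i by (intro dvd_diff[OF _ poly_diff_dvd]) auto
    then show "x a - x i dvd y a - poly P (x a)" using P(1) i by simp
  next
    fix i j q assume "i \<in> T" "j \<in> T" "i \<noteq> j" "x a - x i dvd (x a - x j) * q"
    then show "x a - x i dvd q" using insert.prems(2)[of a i j q] insert.hyps(2) by auto
  qed
  then obtain c where c: "y a - poly P (x a) = (\<Prod>i\<in>T. x a - x i) * c" by (auto simp: dvd_def)
  define N where "N = (\<Prod>i\<in>T. [:- x i, 1:])"
  have N: "poly N z = (\<Prod>i\<in>T. z - x i)" for z by (simp add: N_def poly_prod)
  have "Polynomial.degree N \<le> (\<Sum>i\<in>T. Polynomial.degree [:- x i, 1:])"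
    unfolding N_def using insert.hyps(1)
  proof (induction T rule: finite_induct)
    case (insert s S)
    then show ?case using degree_mult_le[of "[:- x s, 1:]" "\<Prod>i\<in>S. [:- x i, 1:]"] by simp
  qed simp
  then have dN: "Polynomial.degree N \<le> card T" by simp
  show ?case
  proof (rule exI[of _ "P + Polynomial.smult c N"], intro conjI ballI allI impI)
    fix i assume "i \<in> insert a T"
    then show "poly (P + Polynomial.smult c N) (x i) = y i"
    proof
      assume "i = a"
      then show ?thesis using c by (simp add: N algebra_simps)
    next
      assume "i \<in> T"
      then have "poly N (x i) = 0" using insert.hyps(1) by (auto simp: N prod_zero_iff)
      then show ?thesis using P(1) \<open>i \<in> T\<close> by simp
    qed
  next
    fix m assume "card (insert a T) \<le> m"
    then have m: "card T < m" using insert.hyps by simp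
    then have "Polynomial.coeff N m = 0" using dN by (intro coeff_eq_0) simp
    then show "Polynomial.coeff (P + Polynomial.smult c N) m = 0" using P(2) m by simp
  qed
qed

lemma poly_eq_sum_lessThan:
  fixes P :: "'a::comm_semiring_1 poly"
  assumes "\<forall>m\<ge>r. Polynomial.coeff P m = 0"
  shows "poly P x = (\<Sum>p<r. Polynomial.coeff P p * x ^ p)"
proof -
  have "poly P x = (\<Sum>p\<le>Polynomial.degree P. Polynomial.coeff P p * x ^ p)" by (rule poly_altdef)
  also have "\<dots> = (\<Sum>p\<in>{..degree P} \<inter> {..<r}. Polynomial.coeff P p * x ^ p)"
    by (rule sum.mono_neutral_right) (use assms in \<open>auto simp: not_less\<close>)
  also have "\<dots> = (\<Sum>p<r. Polynomial.coeff P p * x ^ p)"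
    by (rule sum.mono_neutral_left) (auto intro: le_degree)
  finally show ?thesis .
qed

lemma newton_interpolation:
  fixes x y :: "'i \<Rightarrow> 'a::idom"
  assumes "finite T" and "\<And>i j. i \<in> T \<Longrightarrow> j \<in> T \<Longrightarrow> x i - x j dvd y i - y j"
    and "\<And>i j l q. i \<in> T \<Longrightarrow> j \<in> T \<Longrightarrow> l \<in> T \<Longrightarrow> i \<noteq> j \<Longrightarrow> i \<noteq> l \<Longrightarrow> j \<noteq> l \<Longrightarrow>
                 x i - x j dvd (x i - x l) * q \<Longrightarrow> x i - x j dvd q"
  shows "\<exists>c. \<forall>i\<in>T. (\<Sum>p<card T. c p * x i ^ p) = y i"
proof -
  obtain P where "\<forall>i\<in>T. poly P (x i) = y i" "\<forall>m\<ge>card T. Polynomial.coeff P m = 0"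
    using newton_interpolation_poly[of T x y] assms by blast
  then show ?thesis by (intro exI[of _ "Polynomial.coeff P"]) (simp add: poly_eq_sum_lessThan)
qed

lemma poly_zero_of_roots:
  fixes P :: "'a::idom poly"
  assumes "finite T" "inj_on x T" "\<And>i. i \<in> T \<Longrightarrow> poly P (x i) = 0" "\<forall>m\<ge>card T. Polynomial.coeff P m = 0"
  shows "P = 0"
proof (rule ccontr)
  assume "P \<noteq> 0"
  then have "Polynomial.degree P < card T" using assms(4) by (metis leading_coeff_0_iff not_le)
  moreover have "card (x ` T) = card T" using assms(2) by (rule card_image)
  ultimately have "P = 0"
    using assms(3) by (intro poly_eqI_degree[of "x ` T" P 0]) auto
  with \<open>P \<noteq> 0\<close> show False by simp
qed

lemma interpolation_unique:
  fixes x :: "'i \<Rightarrow> 'a::idom"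
  assumes "finite T" "inj_on x T"
    and "\<And>i. i \<in> T \<Longrightarrow> (\<Sum>p<card T. c p * x i ^ p) = (\<Sum>p<card T. d p * x i ^ p)"
    and "p < card T"
  shows "c p = d p"
proof -
  define P where "P = (\<Sum>p<card T. Polynomial.monom (c p - d p) p)"
  have co: "Polynomial.coeff P m = (if m < card T then c m - d m else 0)" for m
    by (simp add: P_def coeff_sum)
  have "P = 0"
  proof (rule poly_zero_of_roots[OF assms(1,2)])
    fix i assume "i \<in> T"
    have "poly P (x i) = (\<Sum>p<card T. Polynomial.coeff P p * x i ^ p)"
      by (rule poly_eq_sum_lessThan) (simp add: co)
    also have "\<dots> = 0"
      using assms(3)[OF \<open>i \<in> T\<close>] by (simp add: co algebra_simps sum_subtractf)
    finally show "poly P (x i) = 0" .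
  qed (simp add: co)
  then show ?thesis using co[of p] assms(4) by simp
qed

text \<open>With B(z) the polynomial with coefficients \<open>c p\<close>, g + (a - z) B(z) has
  degree below r and r roots, so it is zero. Setting z = a leaves g = 0, and then B = 0. In the
  middle decomposition a is t_{w(v)}.\<close>

lemma interpolation_unique_linear:
  fixes x :: "'i \<Rightarrow> 'a::idom"
  assumes "finite T" "inj_on x T" "r = card T" "r > 0"
    and zero: "\<And>i. i \<in> T \<Longrightarrow> g + (a - x i) * (\<Sum>p<r - 1. c p * x i ^ p) = 0"
  shows "g = 0 \<and> (\<forall>p<r - 1. c p = 0)"
proof -
  define B where "B = (\<Sum>p<r - 1. Polynomial.monom (c p) p)"
  have co: "Polynomial.coeff B m = (if m < r - 1 then c m else 0)" for m
    by (simp add: B_def coeff_sum)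
  have pB: "poly B z = (\<Sum>p<r - 1. c p * z ^ p)" for z
    using poly_eq_sum_lessThan[of "r - 1" B z] by (simp add: co)
  define P where "P = [:g:] + [:a, - 1:] * B"
  have "P = 0"
  proof (rule poly_zero_of_roots[OF assms(1,2)])
    show "poly P (x i) = 0" if "i \<in> T" for i
      using zero[OF that] by (simp add: P_def pB algebra_simps)
    show "\<forall>m\<ge>card T. Polynomial.coeff P m = 0"
      using assms(3,4) by (auto simp: P_def co coeff_pCons split: nat.splits)
  qed
  then have "poly P a = 0" by simp
  then have g: "g = 0" by (simp add: P_def)
  then have "[:a, - 1:] * B = 0" using \<open>P = 0\<close> unfolding P_def by simp
  then have "B = 0" unfolding mult_eq_0_iff by simp
  then have "c p = 0" if "p < r - 1" for p using co[of p] that by simp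
  with g show ?thesis by blast
qed

section \<open>Modules attached to graphs\<close>

abbreviation tr :: "nat \<Rightarrow> nat \<Rightarrow> nat \<Rightarrow> nat" where
  "tr \<equiv> Transposition.transpose"

lemma comp_tr: "inj s \<Longrightarrow> s \<circ> tr a b = tr (s a) (s b) \<circ> s"
  by (auto simp: fun_eq_iff Transposition.transpose_def inj_eq)

lemma tr_comp_tr: "tr a b \<circ> tr i j = tr (tr a b i) (tr a b j) \<circ> tr a b"
  by (rule comp_tr) (rule inj_transpose)

lemma permutes_comp_tr: "w permutes S \<Longrightarrow> i \<in> S \<Longrightarrow> j \<in> S \<Longrightarrow> (w \<circ> tr i j) permutes S"
  by (intro permutes_compose permutes_swap_id)

text \<open>For \<open>Q = {}\<close> and the Hessenberg edges this is the ring of \<open>equivariant_cohomology\<close>. The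
  invariants under the transpositions in \<open>Q\<close> occur as the coefficients of Newton interpolation.\<close>

definition graph_module :: "nat \<Rightarrow> (nat \<times> nat) set \<Rightarrow> (nat \<times> nat) set \<Rightarrow> tuple set" where
  "graph_module n E Q = {f.
     (\<forall>w. w permutes {1..n} \<longrightarrow> f w \<in> tpolys n) \<and>
     (\<forall>w. \<not> w permutes {1..n} \<longrightarrow> f w = 0) \<and>
     (\<forall>w i j. w permutes {1..n} \<longrightarrow> (i, j) \<in> E \<longrightarrow> tvar (w i) - tvar (w j) dvd f w - f (w \<circ> tr i j)) \<and>
     (\<forall>w i j. w permutes {1..n} \<longrightarrow> (i, j) \<in> Q \<longrightarrow> f (w \<circ> tr i j) = f w)}"

lemma graph_moduleI:
  assumes "\<And>w. w permutes {1..n} \<Longrightarrow> f w \<in> tpolys n" "\<And>w. \<not> w permutes {1..n} \<Longrightarrow> f w = 0"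
    and "\<And>w i j. w permutes {1..n} \<Longrightarrow> (i, j) \<in> E \<Longrightarrow> tvar (w i) - tvar (w j) dvd f w - f (w \<circ> tr i j)"
    and "\<And>w i j. w permutes {1..n} \<Longrightarrow> (i, j) \<in> Q \<Longrightarrow> f (w \<circ> tr i j) = f w"
  shows "f \<in> graph_module n E Q"
  using assms by (simp add: graph_module_def)

lemma graph_moduleD:
  assumes "f \<in> graph_module n E Q"
  shows "w permutes {1..n} \<Longrightarrow> f w \<in> tpolys n" "\<not> w permutes {1..n} \<Longrightarrow> f w = 0"
    and "w permutes {1..n} \<Longrightarrow> (i, j) \<in> E \<Longrightarrow> tvar (w i) - tvar (w j) dvd f w - f (w \<circ> tr i j)"
    and "w permutes {1..n} \<Longrightarrow> (i, j) \<in> Q \<Longrightarrow> f (w \<circ> tr i j) = f w"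
  using assms by (simp_all add: graph_module_def)

lemma graph_module_mono: "E' \<subseteq> E \<Longrightarrow> Q' \<subseteq> Q \<Longrightarrow> graph_module n E Q \<subseteq> graph_module n E' Q'"
  unfolding graph_module_def by blast

text \<open>The conditions involve right multiplication by transpositions, the action left
  multiplication, and the two commute; \<open>permute_vars \<sigma>\<close> carries the divisor
  belonging to \<open>inv \<sigma> \<circ> w\<close> to the one belonging to
  \<open>w\<close>.\<close>

lemma stable_graph_module: "stable_rmodule n (graph_module n E Q)"
  unfolding stable_rmodule_def rmodule_def
proof (intro conjI ballI allI impI)
  show "0 \<in> graph_module n E Q" by (rule graph_moduleI) simp_all
next
  fix f g assume fg: "f \<in> graph_module n E Q" "g \<in> graph_module n E Q"
  show "f + g \<in> graph_module n E Q"
  proof (rule graph_moduleI)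
    fix w i j assume w: "w permutes {1..n}" and "(i, j) \<in> E"
    then have "tvar (w i) - tvar (w j) dvd (f w - f (w \<circ> tr i j)) + (g w - g (w \<circ> tr i j))"
      using fg by (intro dvd_add graph_moduleD)
    then show "tvar (w i) - tvar (w j) dvd (f + g) w - (f + g) (w \<circ> tr i j)"
      by (simp add: algebra_simps)
  qed (use fg in \<open>simp_all add: graph_moduleD tpolys_add\<close>)
next
  fix p f assume p: "p \<in> tpolys n" and f: "f \<in> graph_module n E Q"
  show "pscale p f \<in> graph_module n E Q"
  proof (rule graph_moduleI)
    fix w i j assume w: "w permutes {1..n}" and "(i, j) \<in> E"
    then have "tvar (w i) - tvar (w j) dvd p * (f w - f (w \<circ> tr i j))"
      using f by (intro dvd_mult graph_moduleD)
    then show "tvar (w i) - tvar (w j) dvd (pscale p f) w - (pscale p f) (w \<circ> tr i j)"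
      by (simp add: algebra_simps pscale_apply)
  qed (use f p in \<open>simp_all add: graph_moduleD tpolys_mult pscale_apply\<close>)
next
  fix \<sigma> f assume \<sigma>: "\<sigma> permutes {1..n}" and f: "f \<in> graph_module n E Q"
  let ?i = "Hilbert_Choice.inv \<sigma>"
  have i: "?i permutes {1..n}" using \<sigma> by (rule permutes_inv)
  have iw: "(?i \<circ> w) permutes {1..n} \<longleftrightarrow> w permutes {1..n}" for w
  proof
    assume "(?i \<circ> w) permutes {1..n}"
    from permutes_compose[OF this \<sigma>] show "w permutes {1..n}"
      by (simp add: comp_assoc[symmetric] permutes_inv_o[OF \<sigma>])
  qed (use i in \<open>auto intro: permutes_compose\<close>)
  show "dot_action \<sigma> f \<in> graph_module n E Q"
  proof (rule graph_moduleI)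
    fix w assume w: "w permutes {1..n}"
    then show "dot_action \<sigma> f w \<in> tpolys n"
      unfolding dot_action_def
      by (intro permute_vars_in_tpolys graph_moduleD(1)[OF f])
         (simp_all only: iw permutes_image[OF \<sigma>] order_refl)
    fix k j
    show "tvar (w k) - tvar (w j) dvd dot_action \<sigma> f w - dot_action \<sigma> f (w \<circ> tr k j)" if "(k, j) \<in> E"
    proof -
      have "tvar ((?i \<circ> w) k) - tvar ((?i \<circ> w) j) dvd f (?i \<circ> w) - f ((?i \<circ> w) \<circ> tr k j)"
        by (rule graph_moduleD(3)[OF f iw[THEN iffD2, OF w] that])
      from permute_vars_dvd[OF this, of \<sigma>] show ?thesis
        by (simp add: dot_action_def permute_vars_diff permutes_inverses[OF \<sigma>] comp_assoc)
    qed
    show "dot_action \<sigma> f (w \<circ> tr k j) = dot_action \<sigma> f w" if "(k, j) \<in> Q"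
      using graph_moduleD(4)[OF f iw[THEN iffD2, OF w] that]
      by (simp add: dot_action_def comp_assoc)
  next
    fix w :: "nat \<Rightarrow> nat" assume "\<not> w permutes {1..n}"
    then have "\<not> (?i \<circ> w) permutes {1..n}" using iw by blast
    from graph_moduleD(2)[OF f this] show "dot_action \<sigma> f w = 0" by (simp add: dot_action_def)
  qed
qed

lemma rmodule_graph_module: "rmodule n (graph_module n E Q)"
  using stable_graph_module by (simp add: stable_rmodule_def)

text \<open>Unlike the constant tuples t_i, which are permuted, x_k is fixed by the action: \<sigma>
  sends the variable at index \<open>inv \<sigma> (w k)\<close> to t_{w(k)}. It is not cut off
  outside the permutations and serves only as a multiplier.\<close>

definition xvar :: "nat \<Rightarrow> tuple" where
  "xvar k = (\<lambda>w. tvar (w k))"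

definition xpow :: "nat \<Rightarrow> nat \<Rightarrow> tuple" where
  "xpow k p = (\<lambda>w. tvar (w k) ^ p)"

lemma xpow_0: "xpow k 0 = 1" and xpow_Suc: "xpow k (Suc p) = xvar k * xpow k p"
  by (simp_all add: xpow_def xvar_def fun_eq_iff)

lemma xvar_dvd_diff: "tvar (w i) - tvar (w j) dvd tvar (w k) - tvar ((w \<circ> tr i j) k)"
  using dvd_minus_iff[of "tvar (w i) - tvar (w j)" "tvar (w i) - tvar (w j)"]
  by (cases "k = i"; cases "k = j") (auto simp: transpose_apply_other)

lemma xvar_mult_in_graph_module:
  assumes k: "k \<in> {1..n}" and Q: "\<And>i j. (i, j) \<in> Q \<Longrightarrow> tr i j k = k" and f: "f \<in> graph_module n E Q"
  shows "xvar k * f \<in> graph_module n E Q"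
proof (rule graph_moduleI)
  fix w assume w: "w permutes {1..n}"
  then have wk: "w k \<in> {1..n}" using k permutes_in_image[OF w] by blast
  then show "(xvar k * f) w \<in> tpolys n"
    using graph_moduleD(1)[OF f w] wk by (simp add: xvar_def tpolys_mult)
  fix i j
  show "tvar (w i) - tvar (w j) dvd (xvar k * f) w - (xvar k * f) (w \<circ> tr i j)" if "(i, j) \<in> E"
  proof -
    let ?u = "w \<circ> tr i j"
    have "tvar (w i) - tvar (w j) dvd tvar (w k) * (f w - f ?u) + (tvar (w k) - tvar (?u k)) * f ?u"
      using f w that by (intro dvd_add dvd_mult dvd_mult2 xvar_dvd_diff graph_moduleD)
    then show ?thesis by (simp add: xvar_def algebra_simps)
  qed
  show "(xvar k * f) (w \<circ> tr i j) = (xvar k * f) w" if "(i, j) \<in> Q"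
    using graph_moduleD(4)[OF f w that] Q[OF that] by (simp add: xvar_def)
qed (use f in \<open>simp add: graph_moduleD\<close>)

lemma xpow_mult_in_graph_module:
  assumes "k \<in> {1..n}" "\<And>i j. (i, j) \<in> Q \<Longrightarrow> tr i j k = k" "f \<in> graph_module n E Q"
  shows "xpow k p * f \<in> graph_module n E Q"
proof (induction p)
  case (Suc p)
  have "xvar k * (xpow k p * f) \<in> graph_module n E Q"
    using assms Suc by (intro xvar_mult_in_graph_module)
  then show ?case unfolding xpow_Suc mult.assoc .
qed (use assms in \<open>simp add: xpow_0\<close>)

lemma dot_action_xvar_mult:
  assumes "\<sigma> permutes {1..n}"
  shows "dot_action \<sigma> (xvar k * f) = xvar k * dot_action \<sigma> f"
  by (simp add: dot_action_def xvar_def fun_eq_iff permute_vars_mult permutes_inverses[OF assms])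

lemma dot_action_xpow_mult:
  assumes "\<sigma> permutes {1..n}"
  shows "dot_action \<sigma> (xpow k p * f) = xpow k p * dot_action \<sigma> f"
  by (simp add: dot_action_def xpow_def fun_eq_iff permute_vars_mult permute_vars_power
      permutes_inverses[OF assms])

text \<open>\<open>T\<close> is a clique of vertices with the same neighbours outside \<open>T\<close>.\<close>

definition twin_clique :: "nat \<Rightarrow> (nat \<times> nat) set \<Rightarrow> nat set \<Rightarrow> bool" where
  "twin_clique n E T \<longleftrightarrow> T \<subseteq> {1..n} \<and> E \<subseteq> {1..n} \<times> {1..n} \<and> T \<times> T \<subseteq> E \<and>
     (\<forall>a\<in>T. \<forall>b\<in>T. \<forall>i j. (i, j) \<in> E \<longrightarrow> (tr a b i, tr a b j) \<in> E)"

lemma tr_in_iff: "a \<in> T \<Longrightarrow> b \<in> T \<Longrightarrow> tr a b i \<in> T \<longleftrightarrow> i \<in> T"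
  by (auto simp: Transposition.transpose_def)

text \<open>By invariance under permutations of \<open>T - {k}\<close>, the value of f after
  composing w with a permutation of T depends only on the image of k, and both compositions send k
  to \<open>tr i j l\<close> before w is applied.\<close>

lemma tr_star_eq:
  assumes f: "\<And>w i j. w permutes {1..n} \<Longrightarrow> i \<in> T - {k} \<Longrightarrow> j \<in> T - {k} \<Longrightarrow> f (w \<circ> tr i j) = f w"
    and w: "w permutes {1..n}" and T: "T \<subseteq> {1..n}" and ijl: "i \<in> T" "j \<in> T" "l \<in> T" "k \<in> T"
  shows "f (w \<circ> tr i j \<circ> tr l k) = f (w \<circ> tr (tr i j l) k)"
proof -
  have *: "f (w \<circ> tr m k \<circ> tr l k) = f (w \<circ> tr (tr m k l) k)" if m: "m \<in> T" "m \<noteq> k" for m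
  proof -
    consider "l = k" | "l = m" "l \<noteq> k" | "l \<noteq> k" "l \<noteq> m" by blast
    then show ?thesis
    proof cases
      case 3
      have "tr m k \<circ> tr l k = tr l k \<circ> tr m l"
        using tr_comp_tr[of l k m l] 3 m by (simp add: transpose_apply_other)
      moreover have "f (w \<circ> tr l k \<circ> tr m l) = f (w \<circ> tr l k)"
        using 3 m ijl w T by (intro f permutes_comp_tr) auto
      ultimately show ?thesis using 3 m by (simp add: comp_assoc transpose_apply_other)
    qed (simp_all add: comp_assoc transpose_commute)
  qed
  consider "k \<noteq> i" "k \<noteq> j" | "i = j" | "k = i" "j \<noteq> k" | "k = j" "i \<noteq> k" by blast
  then show ?thesis
  proof cases
    case 1
    have "tr i j \<circ> tr l k = tr (tr i j l) k \<circ> tr i j"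
      using tr_comp_tr[of i j l k] 1 by (simp add: transpose_apply_other)
    moreover have "f (w \<circ> tr (tr i j l) k \<circ> tr i j) = f (w \<circ> tr (tr i j l) k)"
      using 1 ijl w T tr_in_iff[of i T j l] by (intro f permutes_comp_tr) auto
    ultimately show ?thesis by (simp add: comp_assoc)
  next
    case 3
    then have e: "tr i j = tr j k" by (metis transpose_commute)
    show ?thesis unfolding e using *[of j] ijl 3 by simp
  next
    case 4
    then show ?thesis using *[of i] ijl by simp
  qed simp
qed

text \<open>For fixed w, interpolate the values f(w . (l k)) at the nodes t_{w(l)}, l in T. At the
  node t_{w(k)} the interpolant returns f(w), and its coefficients are the components of f:
  permuting T permutes nodes and values together, so the coefficients are T-invariant. Every
  property of the coefficients is deduced from uniqueness of interpolation.\<close>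

lemma newton_direct_sum:
  assumes tw: "twin_clique n E T" and k: "k \<in> T" and Q: "Q \<subseteq> {1..n} \<times> {1..n}"
    and QT: "(T - {k}) \<times> (T - {k}) \<subseteq> Q"
    and Qc: "\<And>i j. (i, j) \<in> Q \<Longrightarrow> (i, j) \<in> (T - {k}) \<times> (T - {k}) \<or> i \<notin> T \<and> j \<notin> T"
  shows "direct_sum n (graph_module n E Q) {..<card T} (xpow k) (\<lambda>_. graph_module n E (Q \<union> T \<times> T))"
    (is "direct_sum n ?M ?P _ (\<lambda>_. ?N)")
proof -
  have T: "T \<subseteq> {1..n}" and E: "E \<subseteq> {1..n} \<times> {1..n}" and TE: "T \<times> T \<subseteq> E"
    and inv: "\<And>a b i j. a \<in> T \<Longrightarrow> b \<in> T \<Longrightarrow> (i, j) \<in> E \<Longrightarrow> (tr a b i, tr a b j) \<in> E"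
    using tw by (auto simp: twin_clique_def)
  have fin: "finite T" using T by (rule finite_subset) simp
  have kn: "k \<in> {1..n}" using k T by blast
  have Qk: "tr i j k = k" if "(i, j) \<in> Q" for i j
    using Qc[OF that] k by (auto intro: transpose_apply_other)
  have inj: "inj_on (\<lambda>l. tvar (w l)) T" if "w permutes {1..n}" for w
    by (rule inj_onI) (use permutes_inj[OF that] in \<open>simp add: inj_eq\<close>)
  have ex: "\<exists>g. (\<forall>p\<in>?P. g p \<in> ?N) \<and> f = (\<Sum>p\<in>?P. xpow k p * g p)" if f: "f \<in> ?M" for f
  proof -
    have inv_f: "f (w \<circ> tr i j) = f w" if "w permutes {1..n}" "i \<in> T - {k}" "j \<in> T - {k}" for w i j
      using graph_moduleD(4)[OF f that(1)] QT that by blast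
    note star = tr_star_eq[where f = f and k = k and T = T and n = n, OF inv_f _ T]
    have "\<exists>c. \<forall>i\<in>T. (\<Sum>p<card T. c p * tvar (w i) ^ p) = f (w \<circ> tr i k)"
      if w: "w permutes {1..n}" for w
    proof (rule newton_interpolation[OF fin])
      fix i j assume ij: "i \<in> T" "j \<in> T"
      show "tvar (w i) - tvar (w j) dvd f (w \<circ> tr i k) - f (w \<circ> tr j k)"
      proof (cases "i = k \<or> i = j")
        case True
        then show ?thesis
        proof
          assume "i = k"
          have "tvar (w k) - tvar (w j) dvd f w - f (w \<circ> tr k j)"
            using graph_moduleD(3)[OF f w] TE ij k by blast
          then show ?thesis using \<open>i = k\<close> by (simp add: transpose_commute)
        qed simp
      next
        case False
        let ?u = "w \<circ> tr i k"
        have u: "?u permutes {1..n}" using w ij k T by (intro permutes_comp_tr) auto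
        show ?thesis
        proof (cases "j = k")
          case True
          have "tvar (w i) - tvar (w k) dvd f w - f (w \<circ> tr i k)"
            using graph_moduleD(3)[OF f w] TE ij k by blast
          then show ?thesis using True dvd_minus_iff[of _ "f w - f (w \<circ> tr i k)"] by simp
        next
          case jk: False
          \<comment> \<open>Since ?u k = w i and ?u j = w j, the edge k j at \<open>?u\<close> has
            the divisor wanted, and the star formula turns its second value into the one at node
            j.\<close>
          have "tvar (?u k) - tvar (?u j) dvd f ?u - f (?u \<circ> tr k j)"
            using graph_moduleD(3)[OF f u] TE ij k by blast
          moreover have "f (?u \<circ> tr j k) = f (w \<circ> tr (tr i k j) k)"
            by (rule star) (use w ij k in auto)
          ultimately show ?thesis
            using False jk by (simp add: transpose_commute transpose_apply_other)
        qed
      qed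
    next
      fix i j l q assume "i \<in> T" "j \<in> T" "l \<in> T" and ne: "i \<noteq> j" "i \<noteq> l" "j \<noteq> l"
        and dvd: "tvar (w i) - tvar (w j) dvd (tvar (w i) - tvar (w l)) * q"
      have "w i \<noteq> w j" "w i \<noteq> w l" "w j \<noteq> w l" using permutes_inj[OF w] ne by (simp_all add: inj_eq)
      then have "{w i, w j} \<noteq> {w i, w l}" by (simp add: doubleton_eq_iff)
      with \<open>w i \<noteq> w l\<close> show "tvar (w i) - tvar (w j) dvd q" by (rule tvar_diff_dvd_cancel[OF dvd])
    qed
    then obtain c where c: "\<And>w i. w permutes {1..n} \<Longrightarrow> i \<in> T \<Longrightarrow>
        (\<Sum>p<card T. c w p * tvar (w i) ^ p) = f (w \<circ> tr i k)"
      by metis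
    define g where "g p w = (if w permutes {1..n} then c w p else 0)" for p w
    have "g p \<in> ?N" if p: "p < card T" for p
    proof (rule graph_moduleI)
      fix w assume w: "w permutes {1..n}"
      have wk: "w k \<in> {1..n}" using permutes_in_image[OF w] kn by blast
      \<comment> \<open>\<open>\<pi>\<close> fixes the indices in {1..n} and sends stray ones to w
        k. It fixes all nodes and values, hence by uniqueness the coefficients, which must therefore
        lie in Q[t_1, ..., t_n].\<close>
      define \<pi> where "\<pi> i = (if i \<in> {1..n} then i else w k)" for i
      have \<pi>: "permute_vars \<pi> q = q" if "q \<in> tpolys n" for q
        using permute_vars_cong[OF that, of \<pi> id] by (simp add: \<pi>_def)
      have "permute_vars \<pi> (c w p) = c w p"
      proof (rule interpolation_unique[OF fin inj[OF w] _ p, of "\<lambda>p. permute_vars \<pi> (c w p)" "c w"])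
        fix i assume i: "i \<in> T"
        have ik: "(w \<circ> tr i k) permutes {1..n}" using w i k T by (intro permutes_comp_tr) auto
        have "w i \<in> {1..n}" using permutes_in_image[OF w] i T by blast
        then have "\<pi> (w i) = w i" by (simp add: \<pi>_def)
        then have "(\<Sum>p<card T. permute_vars \<pi> (c w p) * tvar (w i) ^ p)
            = permute_vars \<pi> (\<Sum>p<card T. c w p * tvar (w i) ^ p)"
          by (simp add: permute_vars_sum permute_vars_mult permute_vars_power)
        also have "\<dots> = (\<Sum>p<card T. c w p * tvar (w i) ^ p)"
          unfolding c[OF w i] by (rule \<pi>) (rule graph_moduleD(1)[OF f ik])
        finally show "(\<Sum>p<card T. permute_vars \<pi> (c w p) * tvar (w i) ^ p)
            = (\<Sum>p<card T. c w p * tvar (w i) ^ p)" .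
      qed
      moreover have "permute_vars \<pi> (c w p) \<in> tpolys n"
        by (rule permute_vars_image_in_tpolys) (use wk in \<open>auto simp: \<pi>_def\<close>)
      ultimately show "g p w \<in> tpolys n" using w by (simp add: g_def)
    next
      fix w i j assume w: "w permutes {1..n}" and ij: "(i, j) \<in> Q \<union> T \<times> T"
      have ijn: "i \<in> {1..n}" "j \<in> {1..n}" using ij Q T by auto
      let ?u = "w \<circ> tr i j"
      have u: "?u permutes {1..n}" using w ijn by (rule permutes_comp_tr)
      \<comment> \<open>For a pair inside T, passing to \<open>?u\<close> permutes nodes and values
        together; for a pair of Q off T it changes neither. In both cases the same data are
        interpolated.\<close>
      have "c ?u p = c w p"
      proof (rule interpolation_unique[OF fin inj[OF u] _ p, of "c ?u" "c w"])
        fix l assume l: "l \<in> T"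
        have "(\<Sum>p<card T. c w p * tvar (?u l) ^ p) = f (?u \<circ> tr l k)"
        proof (cases "(i, j) \<in> T \<times> T")
          case True
          then have "f (?u \<circ> tr l k) = f (w \<circ> tr (tr i j l) k)"
            using l k by (intro star w) auto
          also have "\<dots> = (\<Sum>p<card T. c w p * tvar (w (tr i j l)) ^ p)"
            using True l w by (intro c[symmetric]) (auto simp: tr_in_iff)
          finally show ?thesis by simp
        next
          case False
          then have ijT: "i \<notin> T" "j \<notin> T" and ijQ: "(i, j) \<in> Q" using ij Qc by blast+
          have "tr i j \<circ> tr l k = tr l k \<circ> tr i j"
            using tr_comp_tr[of i j l k] ijT l k by (metis transpose_apply_other)
          then have "f (?u \<circ> tr l k) = f (w \<circ> tr l k \<circ> tr i j)" by (simp add: comp_assoc)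
          also have "\<dots> = f (w \<circ> tr l k)"
            using w l k T ijQ by (intro graph_moduleD(4)[OF f] permutes_comp_tr) auto
          also have "\<dots> = (\<Sum>p<card T. c w p * tvar (w l) ^ p)" by (rule c[OF w l, symmetric])
          also have "w l = ?u l" using ijT l by (metis comp_apply transpose_apply_other)
          finally show ?thesis by (rule sym)
        qed
        then show "(\<Sum>p<card T. c ?u p * tvar (?u l) ^ p) = (\<Sum>p<card T. c w p * tvar (?u l) ^ p)"
          using c[OF u l] by simp
      qed
      then show "g p (w \<circ> tr i j) = g p w" using w u by (simp add: g_def)
    next
      fix w i j assume w: "w permutes {1..n}" and ij: "(i, j) \<in> E"
      have ijn: "i \<in> {1..n}" "j \<in> {1..n}" using ij E by auto
      let ?u = "w \<circ> tr i j"
      have u: "?u permutes {1..n}" using w ijn by (rule permutes_comp_tr)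
      show "tvar (w i) - tvar (w j) dvd g p w - g p (w \<circ> tr i j)"
      proof (cases "(i, j) \<in> T \<times> T")
        case True
        have "c ?u p = c w p"
        proof (rule interpolation_unique[OF fin inj[OF u] _ p, of "c ?u" "c w"])
          fix l assume l: "l \<in> T"
          have "f (?u \<circ> tr l k) = f (w \<circ> tr (tr i j l) k)"
            using l k True by (intro star w) auto
          also have "\<dots> = (\<Sum>p<card T. c w p * tvar (w (tr i j l)) ^ p)"
            using True l w by (intro c[symmetric]) (auto simp: tr_in_iff)
          finally show "(\<Sum>p<card T. c ?u p * tvar (?u l) ^ p) = (\<Sum>p<card T. c w p * tvar (?u l) ^ p)"
            using c[OF u l] by simp
        qed
        then show ?thesis using w u by (simp add: g_def)
      next
        case False
        \<comment> \<open>Specialise t_{w(i)} to t_{w(j)}. As i and j are not both in T, no two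
          nodes collapse, so uniqueness of interpolation survives the specialisation.\<close>
        define \<theta> where "\<theta> = id(w i := w j)"
        have injw: "inj w" using w by (rule permutes_inj)
        have \<theta>inj: "inj_on (\<lambda>l. tvar (\<theta> (w l))) T"
        proof (rule inj_onI)
          fix a b assume ab: "a \<in> T" "b \<in> T" "tvar (\<theta> (w a)) = tvar (\<theta> (w b))"
          have "\<theta> (w l) = w (if l = i then j else l)" for l by (simp add: \<theta>_def inj_eq[OF injw])
          then have "(if a = i then j else a) = (if b = i then j else b)"
            using ab(3) by (simp only: tvar_eq_iff inj_eq[OF injw])
          then show "a = b" using False ab(1,2) by (auto split: if_splits)
        qed
        have node: "\<theta> (?u l) = \<theta> (w l)" for l
          by (auto simp: \<theta>_def Transposition.transpose_def)
        have "permute_vars \<theta> (c w p) = permute_vars \<theta> (c ?u p)"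
        proof (rule interpolation_unique[OF fin \<theta>inj _ p,
              of "\<lambda>p. permute_vars \<theta> (c w p)" "\<lambda>p. permute_vars \<theta> (c ?u p)"])
          fix l assume l: "l \<in> T"
          \<comment> \<open>The transposition (l k) carries the edge i j to the pair
            \<open>?i\<close>, \<open>?j\<close>, an edge because T consists of twins. At
            \<open>?v\<close> its divisor is again t_{w(i)} - t_{w(j)}, so the values at node l
            agree after specialisation.\<close>
          let ?v = "w \<circ> tr l k" and ?i = "tr l k i" and ?j = "tr l k j"
          have v: "?v permutes {1..n}" using w l k T by (intro permutes_comp_tr) auto
          have "(\<Sum>p<card T. permute_vars \<theta> (c w p) * tvar (\<theta> (w l)) ^ p)
              = permute_vars \<theta> (\<Sum>p<card T. c w p * tvar (w l) ^ p)"
            by (simp add: permute_vars_sum permute_vars_mult permute_vars_power)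
          also have "\<dots> = permute_vars \<theta> (f ?v)" by (simp only: c[OF w l])
          also have "tr i j \<circ> tr l k = tr l k \<circ> tr ?i ?j"
            using tr_comp_tr[of l k ?i ?j] by simp
          then have uv: "?u \<circ> tr l k = ?v \<circ> tr ?i ?j" by (simp add: comp_assoc)
          have "tvar (?v ?i) - tvar (?v ?j) dvd f ?v - f (?v \<circ> tr ?i ?j)"
            by (intro graph_moduleD(3)[OF f v] inv l k ij)
          then have "tvar (w i) - tvar (w j) dvd f ?v - f (?u \<circ> tr l k)"
            unfolding uv by simp
          then have "permute_vars \<theta> (f ?v) = permute_vars \<theta> (f (?u \<circ> tr l k))"
            by (simp add: tvar_diff_dvd_iff \<theta>_def permute_vars_diff)
          also have "\<dots> = permute_vars \<theta> (\<Sum>p<card T. c ?u p * tvar (?u l) ^ p)"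
            by (simp only: c[OF u l])
          also have "\<dots> = (\<Sum>p<card T. permute_vars \<theta> (c ?u p) * tvar (\<theta> (w l)) ^ p)"
            using node by (simp add: permute_vars_sum permute_vars_mult permute_vars_power)
          finally show "(\<Sum>p<card T. permute_vars \<theta> (c w p) * tvar (\<theta> (w l)) ^ p)
              = (\<Sum>p<card T. permute_vars \<theta> (c ?u p) * tvar (\<theta> (w l)) ^ p)" .
        qed
        then show ?thesis
          using w u by (simp add: g_def tvar_diff_dvd_iff permute_vars_diff \<theta>_def)
      qed
    qed (simp add: g_def)
    moreover have "f = (\<Sum>p\<in>?P. xpow k p * g p)"
    proof
      fix w show "f w = (\<Sum>p\<in>?P. xpow k p * g p) w"
      proof (cases "w permutes {1..n}")
        case True
        then show ?thesis using c[OF True k]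
          by (simp add: sum_tuple_apply xpow_def g_def mult.commute)
      next
        case False
        then show ?thesis using graph_moduleD(2)[OF f False] by (simp add: sum_tuple_apply g_def)
      qed
    qed
    ultimately show ?thesis by (intro exI[of _ g]) simp
  qed
  have uniq: "g p = 0" if g: "\<And>p. p < card T \<Longrightarrow> g p \<in> ?N" and "(\<Sum>p<card T. xpow k p * g p) = 0"
    and p: "p < card T" for g p
  proof
    fix w show "g p w = 0 w"
    proof (cases "w permutes {1..n}")
      case w: True
      \<comment> \<open>Evaluating the relation at w . (l k) moves the node but not the T-invariant
        coefficients: one polynomial vanishes at |T| distinct points.\<close>
      have "g p w = (\<lambda>_. 0) p"
      proof (rule interpolation_unique[OF fin inj[OF w] _ p, of "\<lambda>p. g p w"])
        fix l assume l: "l \<in> T"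
        have "(\<Sum>p<card T. g p w * tvar (w l) ^ p)
            = (\<Sum>p<card T. xpow k p (w \<circ> tr l k) * g p (w \<circ> tr l k))"
        proof (rule sum.cong)
          fix p assume "p \<in> {..<card T}"
          then have "g p (w \<circ> tr l k) = g p w"
            using l k by (intro graph_moduleD(4)[OF g w]) auto
          then show "g p w * tvar (w l) ^ p = xpow k p (w \<circ> tr l k) * g p (w \<circ> tr l k)"
            by (simp add: xpow_def)
        qed simp
        also have "\<dots> = (\<Sum>p<card T. xpow k p * g p) (w \<circ> tr l k)"
          by (simp add: sum_tuple_apply)
        also have "\<dots> = 0" unfolding that(2) by simp
        finally show "(\<Sum>p<card T. g p w * tvar (w l) ^ p) = (\<Sum>p<card T. 0 * tvar (w l) ^ p)" by simp
      qed
      then show ?thesis by simp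
    qed (use graph_moduleD(2)[OF g[OF p]] in simp)
  qed
  have NM: "?N \<subseteq> ?M" by (rule graph_module_mono) auto
  show ?thesis unfolding direct_sum_def
  proof (intro conjI ballI allI impI)
    show "xpow k p * g \<in> ?M" if "g \<in> ?N" for p g
      by (rule xpow_mult_in_graph_module[OF kn Qk]) (use that NM in auto)
    show "dot_action \<sigma> (xpow k p * g) = xpow k p * dot_action \<sigma> g" if "\<sigma> permutes {1..n}" for p \<sigma> g
      by (rule dot_action_xpow_mult[OF that])
    show "\<exists>g. (\<forall>p\<in>?P. g p \<in> ?N) \<and> f = (\<Sum>p\<in>?P. xpow k p * g p)" if "f \<in> ?M" for f
      by (rule ex[OF that])
    show "g p = 0" if "\<forall>p\<in>?P. g p \<in> ?N" "(\<Sum>p\<in>?P. xpow k p * g p) = 0" "p \<in> ?P" for g p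
      by (rule uniq) (use that in auto)
  qed (simp_all add: stable_graph_module)
qed

section \<open>The modular law\<close>

lemma has_character_direct_sum_const:
  assumes "direct_sum n M {..<r} c (\<lambda>_. N)" "has_character n N \<tau>"
  shows "has_character n M (\<lambda>\<sigma>. of_nat r * \<tau> \<sigma>)"
  using has_character_direct_sum[OF assms(1), of "\<lambda>_. \<tau>"] assms(2) by simp

lemma twin_clique_subset:
  assumes "twin_clique n E T" "U \<subseteq> T"
  shows "twin_clique n E U"
proof -
  have E: "T \<subseteq> {1..n}" "E \<subseteq> {1..n} \<times> {1..n}" "T \<times> T \<subseteq> E"
    and inv: "\<And>a b i j. a \<in> T \<Longrightarrow> b \<in> T \<Longrightarrow> (i, j) \<in> E \<Longrightarrow> (tr a b i, tr a b j) \<in> E"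
    using assms(1) by (simp_all add: twin_clique_def)
  have "U \<times> U \<subseteq> T \<times> T" using assms(2) by blast
  then have "U \<times> U \<subseteq> E" using E(3) by (rule subset_trans)
  moreover have "(tr a b i, tr a b j) \<in> E" if "a \<in> U" "b \<in> U" "(i, j) \<in> E" for a b i j
    using that assms(2) by (intro inv) (simp_all add: subsetD)
  ultimately show ?thesis
    unfolding twin_clique_def using E(2) subset_trans[OF assms(2) E(1)] by simp
qed

lemma twin_clique_finite: "twin_clique n E T \<Longrightarrow> finite T"
  unfolding twin_clique_def by (metis finite_subset finite_atLeastAtMost)

text \<open>One step in the chain of symmetric groups: U-invariants split into |U| + 1 copies of the
  invariants of the enlarged set.\<close>

lemma newton_direct_sum_insert:
  assumes "twin_clique n E (insert a U)" "a \<notin> U" and "Q \<subseteq> {1..n} \<times> {1..n}"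
    and "\<And>i j. (i, j) \<in> Q \<Longrightarrow> i \<notin> insert a U \<and> j \<notin> insert a U"
  shows "direct_sum n (graph_module n E (Q \<union> U \<times> U)) {..<card (insert a U)} (xpow a)
           (\<lambda>_. graph_module n E (Q \<union> insert a U \<times> insert a U))"
proof -
  have "U \<subseteq> {1..n}" using assms(1) by (auto simp: twin_clique_def)
  then have "direct_sum n (graph_module n E (Q \<union> U \<times> U)) {..<card (insert a U)} (xpow a)
      (\<lambda>_. graph_module n E ((Q \<union> U \<times> U) \<union> insert a U \<times> insert a U))"
    using assms by (intro newton_direct_sum) blast+
  moreover have "(Q \<union> U \<times> U) \<union> insert a U \<times> insert a U = Q \<union> insert a U \<times> insert a U" by blast
  ultimately show ?thesis by simp
qed

text \<open>The multiplicities 1, 2, ..., |U| of the successive steps multiply to |U|!.\<close>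

lemma clique_character:
  assumes "twin_clique n E U" and "Q \<subseteq> {1..n} \<times> {1..n}" and "\<And>i j. (i, j) \<in> Q \<Longrightarrow> i \<notin> U \<and> j \<notin> U"
    and "has_character n (graph_module n E (Q \<union> U \<times> U)) \<tau>"
  shows "has_character n (graph_module n E Q) (\<lambda>\<sigma>. fact (card U) * \<tau> \<sigma>)"
  using twin_clique_finite[OF assms(1)] assms(1,3,4)
proof (induction U arbitrary: \<tau> rule: finite_induct)
  case (insert a U)
  note ds = newton_direct_sum_insert[OF insert.prems(1) insert.hyps(2) assms(2) insert.prems(2)]
  have "has_character n (graph_module n E Q)
      (\<lambda>\<sigma>. fact (card U) * (of_nat (card (insert a U)) * \<tau> \<sigma>))"
  proof (rule insert.IH)
    show "twin_clique n E U" using insert.prems(1) by (rule twin_clique_subset) blast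
    show "i \<notin> U \<and> j \<notin> U" if "(i, j) \<in> Q" for i j using insert.prems(2)[OF that] by blast
  qed (rule has_character_direct_sum_const[OF ds insert.prems(3)])
  then show ?case using insert.hyps by (simp add: mult_ac)
qed simp

text \<open>The same chain in the opposite direction: the invariants of each larger symmetric group
  are a direct summand of the preceding ones.\<close>

lemma clique_character_ex:
  assumes "twin_clique n E U" and "Q \<subseteq> {1..n} \<times> {1..n}" and "\<And>i j. (i, j) \<in> Q \<Longrightarrow> i \<notin> U \<and> j \<notin> U"
    and "has_character n (graph_module n E Q) \<tau>"
  shows "\<exists>\<tau>'. has_character n (graph_module n E (Q \<union> U \<times> U)) \<tau>'"
  using twin_clique_finite[OF assms(1)] assms(1,3)
proof (induction U rule: finite_induct)
  case (insert a U)
  note ds = newton_direct_sum_insert[OF insert.prems(1) insert.hyps(2) assms(2) insert.prems(2)]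
  have "\<exists>\<tau>'. has_character n (graph_module n E (Q \<union> U \<times> U)) \<tau>'"
  proof (rule insert.IH)
    show "twin_clique n E U" using insert.prems(1) by (rule twin_clique_subset) blast
    show "i \<notin> U \<and> j \<notin> U" if "(i, j) \<in> Q" for i j using insert.prems(2)[OF that] by blast
  qed
  then obtain \<tau>' where "has_character n (graph_module n E (Q \<union> U \<times> U)) \<tau>'" by blast
  from has_character_summand[OF ds this, of 0] insert.hyps(1) show ?case by (simp add: card_gt_0_iff)
qed (use assms(4) in auto)

text \<open>With the left side written as P(x), this is P(x) = P(y) + (y - x) B(x); the geometric
  expansion of each x^p - y^p displays the coefficients of B.\<close>

lemma sum_power_shift:
  fixes x y :: "'a::comm_ring_1"
  shows "(\<Sum>p\<le>m. x ^ p * g p) = (\<Sum>p\<le>m. y ^ p * g p) +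
           (y - x) * (\<Sum>q<m. x ^ q * - (\<Sum>p=Suc q..m. y ^ (p - Suc q) * g p))"
proof -
  have "(\<Sum>p\<le>m. x ^ p * g p) - (\<Sum>p\<le>m. y ^ p * g p) = (\<Sum>p\<le>m. (x ^ p - y ^ p) * g p)"
    by (simp add: sum_subtractf left_diff_distrib)
  also have "\<dots> = (\<Sum>p\<le>m. \<Sum>q<p. (x - y) * (y ^ (p - Suc q) * x ^ q * g p))"
    by (simp add: power_diff_sumr2 sum_distrib_left sum_distrib_right mult.assoc)
  also have "\<dots> = (\<Sum>q<m. \<Sum>p=Suc q..m. (x - y) * (y ^ (p - Suc q) * x ^ q * g p))"
    by (rule sum.nested_swap')
  also have "\<dots> = (y - x) * (\<Sum>q<m. x ^ q * - (\<Sum>p=Suc q..m. y ^ (p - Suc q) * g p))"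
    unfolding sum_distrib_left sum_negf[symmetric]
    by (intro sum.cong refl) (simp add: algebra_simps)
  finally show ?thesis by (simp add: algebra_simps)
qed

section \<open>The module with a single edge between v and the clique\<close>

lemma xpow_eq_power: "xpow k p = xvar k ^ p"
  by (induction p) (simp_all only: xpow_0 xpow_Suc power_0 power_Suc)

lemma graph_module_diff: "f \<in> graph_module n E Q \<Longrightarrow> g \<in> graph_module n E Q \<Longrightarrow> f - g \<in> graph_module n E Q"
  and graph_module_uminus: "f \<in> graph_module n E Q \<Longrightarrow> - f \<in> graph_module n E Q"
  by (rule qsubspace_diff qsubspace_uminus,
      rule rmodule_qsubspace[OF rmodule_graph_module]; assumption)+

lemma graph_module_sum:
  "(\<And>i. i \<in> I \<Longrightarrow> f i \<in> graph_module n E Q) \<Longrightarrow> sum f I \<in> graph_module n E Q"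
  by (rule qsubspace_sum[OF rmodule_qsubspace[OF rmodule_graph_module]])

lemma graph_module_insert_iff:
  "f \<in> graph_module n (insert (v, k) E) Q \<longleftrightarrow> f \<in> graph_module n E Q \<and>
     (\<forall>w. w permutes {1..n} \<longrightarrow> tvar (w v) - tvar (w k) dvd f w - f (w \<circ> tr v k))"
  by (auto simp: graph_module_def)

lemma graph_module_Un_iff:
  "f \<in> graph_module n (E \<union> E') Q \<longleftrightarrow> f \<in> graph_module n E Q \<and>
     (\<forall>w i j. w permutes {1..n} \<longrightarrow> (i, j) \<in> E' \<longrightarrow> tvar (w i) - tvar (w j) dvd f w - f (w \<circ> tr i j))"
  by (auto simp: graph_module_def)

text \<open>Every element of the middle module is \<open>P(x\<^sub>k)\<close> for a polynomial \<open>P\<close> with coefficients in the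
  \<open>T\<close>-invariants of the bottom module; \<open>P(x\<^sub>v)\<close> is then \<open>T\<close>-invariant, and divisibility along the
  single edge \<open>v k\<close> spreads to all edges between \<open>v\<close> and \<open>T\<close>.\<close>

lemma middle_direct_sum:
  assumes tw: "twin_clique n E T" and k: "k \<in> T" and v: "v \<in> {1..n}" "v \<notin> T"
  shows "direct_sum n (graph_module n (insert (v, k) E) ((T - {k}) \<times> (T - {k}))) {..<card T}
           (\<lambda>p. if p = 0 then 1 else (xvar v - xvar k) * xpow k (p - 1))
           (\<lambda>p. graph_module n (if p = 0 then E \<union> {v} \<times> T else E) (T \<times> T))"
    (is "direct_sum n ?M ?P ?c ?N")
proof -
  let ?A = "graph_module n E ((T - {k}) \<times> (T - {k}))" and ?B = "graph_module n E (T \<times> T)"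
  have T: "T \<subseteq> {1..n}" using tw by (auto simp: twin_clique_def)
  have fin: "finite T" using tw by (rule twin_clique_finite)
  have kn: "k \<in> {1..n}" using k T by blast
  obtain m where r: "card T = Suc m" using fin k by (metis card_Suc_Diff1)
  have ds: "direct_sum n ?A ?P (xpow k) (\<lambda>_. ?B)"
    using newton_direct_sum_insert[of n E k "T - {k}" "{}"] tw k by (simp add: insert_absorb)
  have vQ: "tr i j v = v" if "(i, j) \<in> T \<times> T" for i j
    using that v by (intro transpose_apply_other) auto
  have vQ': "tr i j v = v" if "(i, j) \<in> (T - {k}) \<times> (T - {k})" for i j
    using that v by (intro transpose_apply_other) auto
  have kQ': "tr i j k = k" if "(i, j) \<in> (T - {k}) \<times> (T - {k})" for i j
    using that by (intro transpose_apply_other) auto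
  have N0A: "?B \<subseteq> ?A" by (rule graph_module_mono) auto
  have cA: "(xvar v - xvar k) * (xpow k p * g) \<in> ?M" if g: "g \<in> ?A" for p g
    unfolding graph_module_insert_iff
  proof (intro conjI allI impI)
    have 1: "xpow k p * g \<in> ?A" by (rule xpow_mult_in_graph_module[OF kn kQ' g])
    show "(xvar v - xvar k) * (xpow k p * g) \<in> ?A"
      unfolding left_diff_distrib
      by (intro graph_module_diff xvar_mult_in_graph_module[OF v(1) vQ' 1]
          xvar_mult_in_graph_module[OF kn kQ' 1])
    fix w assume "w permutes {1..n}"
    let ?f = "xpow k p * g"
    \<comment> \<open>Composition with (v k) reverses the sign of x_v - x_k, hence the plus sign on
      the right; this is why multiplication by x_v - x_k carries the bottom module into the middle
      one.\<close>
    have "((xvar v - xvar k) * ?f) w - ((xvar v - xvar k) * ?f) (w \<circ> tr v k)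
        = (tvar (w v) - tvar (w k)) * (?f w + ?f (w \<circ> tr v k))"
      by (simp add: xvar_def algebra_simps)
    then show "tvar (w v) - tvar (w k) dvd
        ((xvar v - xvar k) * ?f) w - ((xvar v - xvar k) * ?f) (w \<circ> tr v k)"
      by simp
  qed
  have ex: "\<exists>g. (\<forall>p\<in>?P. g p \<in> ?N p) \<and> f = (\<Sum>p\<in>?P. ?c p * g p)" if f: "f \<in> ?M" for f
  proof -
    have "f \<in> ?A" using f by (simp add: graph_module_insert_iff)
    then obtain g where g: "\<And>p. p \<in> ?P \<Longrightarrow> g p \<in> ?B" "f = (\<Sum>p\<in>?P. xpow k p * g p)"
      using ds unfolding direct_sum_def by blast
    \<comment> \<open>With f = P(x_k), G is P(x_v), and the \<open>b q\<close> are the coefficients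
      of the quotient of P(x_k) - P(x_v) by x_v - x_k.\<close>
    define G where "G = (\<Sum>p\<le>m. xpow v p * g p)"
    define b where "b q = - (\<Sum>p=Suc q..m. xpow v (p - Suc q) * g p)" for q
    have vN0: "xpow v p * h \<in> ?B" if "h \<in> ?B" for p h
      by (rule xpow_mult_in_graph_module[OF v(1) vQ that])
    have G: "G \<in> ?B" unfolding G_def using g(1) r by (intro graph_module_sum vN0) auto
    have b: "b q \<in> ?B" for q
      unfolding b_def using g(1) r by (intro graph_module_uminus graph_module_sum vN0) auto
    have sum_c: "(\<Sum>p\<in>?P. ?c p * h p) = h 0 + (xvar v - xvar k) * (\<Sum>q<m. xpow k q * h (Suc q))" for h
      by (simp add: r lessThan_Suc_eq_insert_0 sum.reindex sum_distrib_left mult.assoc)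
    have f_eq: "f = G + (xvar v - xvar k) * (\<Sum>q<m. xpow k q * b q)"
      unfolding g(2) r lessThan_Suc_atMost G_def b_def xpow_eq_power by (rule sum_power_shift)
    have vk: "tvar (w v) - tvar (w k) dvd G w - G (w \<circ> tr v k)" if w: "w permutes {1..n}" for w
    proof -
      have "(xvar v - xvar k) * (\<Sum>q<m. xpow k q * b q) = (\<Sum>q<m. (xvar v - xvar k) * (xpow k q * b q))"
        by (rule sum_distrib_left)
      also have "\<dots> \<in> ?M" using b N0A by (intro graph_module_sum cA) blast
      finally have "f - (xvar v - xvar k) * (\<Sum>q<m. xpow k q * b q) \<in> ?M" by (rule graph_module_diff[OF f])
      then have "G \<in> ?M" unfolding f_eq by (simp only: add_diff_cancel_right')
      then show ?thesis using w by (simp add: graph_module_insert_iff)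
    qed
    have "G \<in> graph_module n (E \<union> {v} \<times> T) (T \<times> T)"
      unfolding graph_module_Un_iff
    proof (intro conjI allI impI G)
      fix w i l assume w: "w permutes {1..n}" and "(i, l) \<in> {v} \<times> T"
      then have i: "i = v" and l: "l \<in> T" by auto
      \<comment> \<open>Conjugation by (l k) carries the edge v k to v l. As G is invariant under (l
        k), its divisibility along v k at \<open>?u\<close> is divisibility along v l at w.\<close>
      let ?u = "w \<circ> tr l k"
      have u: "?u permutes {1..n}" using w l k T by (intro permutes_comp_tr) auto
      have vl: "(w \<circ> tr v l) permutes {1..n}" using w l v T by (intro permutes_comp_tr) auto
      have v': "tr l k v = v" using vQ l k by blast
      have "tr l k \<circ> tr v k = tr v l \<circ> tr l k" using tr_comp_tr[of l k v k] v' by simp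
      then have "?u \<circ> tr v k = w \<circ> tr v l \<circ> tr l k" by (simp add: comp_assoc)
      then have "G (?u \<circ> tr v k) = G (w \<circ> tr v l)"
        using graph_moduleD(4)[OF G vl] l k by simp
      moreover have "G ?u = G w" using graph_moduleD(4)[OF G w] l k by simp
      ultimately show "tvar (w i) - tvar (w l) dvd G w - G (w \<circ> tr i l)"
        using vk[OF u] v' i by simp
    qed
    moreover have "f = (\<Sum>p\<in>?P. ?c p * (case p of 0 \<Rightarrow> G | Suc q \<Rightarrow> b q))"
      unfolding sum_c by (simp only: f_eq nat.case)
    ultimately show ?thesis
      using b by (intro exI[of _ "\<lambda>p. case p of 0 \<Rightarrow> G | Suc q \<Rightarrow> b q"] conjI) (auto split: nat.split)
  qed
  have "graph_module n (E \<union> {v} \<times> T) (T \<times> T) \<subseteq> ?B" by (rule graph_module_mono) simp_all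
  then have NN0: "?N p \<subseteq> ?B" for p by simp
  have uniq: "g p = 0" if g: "\<And>p. p \<in> ?P \<Longrightarrow> g p \<in> ?N p" and 0: "(\<Sum>p\<in>?P. ?c p * g p) = 0"
    and p: "p \<in> ?P" for g p
  proof
    fix w show "g p w = 0 w"
    proof (cases "w permutes {1..n}")
      case w: True
      have gN0: "g p \<in> ?B" if "p \<in> ?P" for p using g[OF that] NN0 by blast
      have "inj_on (\<lambda>l. tvar (w l)) T"
        by (rule inj_onI) (use permutes_inj[OF w] in \<open>simp add: inj_eq\<close>)
      \<comment> \<open>At w . (l k) the factor x_v keeps its value t_{w(v)} while x_k becomes
        t_{w(l)}: each l in T yields one relation between the same coefficients.\<close>
      then have "g 0 w = 0 \<and> (\<forall>q<Suc m - 1. g (Suc q) w = 0)"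
      proof (rule interpolation_unique_linear[OF fin, where a = "tvar (w v)"])
        fix l assume l: "l \<in> T"
        let ?u = "w \<circ> tr l k"
        have inv: "g p ?u = g p w" if "p \<in> ?P" for p
          by (rule graph_moduleD(4)[OF gN0[OF that] w]) (use l k in auto)
        have uv: "?u v = w v" using vQ l k by simp
        have "0 = (\<Sum>p\<in>?P. ?c p * g p) ?u" unfolding 0 by simp
        also have "\<dots> = (\<Sum>p\<in>?P. ?c p ?u * g p w)"
          unfolding sum_tuple_apply by (intro sum.cong refl) (simp add: inv)
        also have "\<dots> = g 0 w + (\<Sum>q<m. (tvar (w v) - tvar (w l)) * tvar (w l) ^ q * g (Suc q) w)"
          using uv by (simp add: r lessThan_Suc_eq_insert_0 sum.reindex xvar_def xpow_def)
        finally show "g 0 w + (tvar (w v) - tvar (w l)) * (\<Sum>q<Suc m - 1. g (Suc q) w * tvar (w l) ^ q) = 0"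
          by (simp add: sum_distrib_left mult_ac)
      qed (simp_all add: r)
      then show ?thesis using p r by (cases p) auto
    qed (use graph_moduleD(2)[OF g[OF p]] in simp)
  qed
  show ?thesis unfolding direct_sum_def
  proof (intro conjI ballI allI impI)
    fix p g assume p: "p \<in> ?P" and g: "g \<in> ?N p"
    show "?c p * g \<in> ?M"
    proof (cases "p = 0")
      case True
      have "g \<in> ?M"
        by (rule graph_module_mono[THEN subsetD, OF _ _ g]) (use True k in auto)
      then show ?thesis unfolding True by (simp only: if_True refl mult_1_left)
    next
      case False
      then have "g \<in> ?A" using g NN0 N0A by blast
      from cA[OF this, of "p - 1"] False show ?thesis by (simp only: if_False mult.assoc)
    qed
    fix \<sigma> assume \<sigma>: "\<sigma> permutes {1..n}"
    have diff: "dot_action \<sigma> (f - h) = dot_action \<sigma> f - dot_action \<sigma> h" for f h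
      by (simp add: dot_action_def fun_eq_iff permute_vars_diff)
    show "dot_action \<sigma> (?c p * g) = ?c p * dot_action \<sigma> g"
    proof (cases "p = 0")
      case False
      have "dot_action \<sigma> ((xvar v - xvar k) * (xpow k (p - 1) * g))
          = (xvar v - xvar k) * (xpow k (p - 1) * dot_action \<sigma> g)"
        by (simp only: left_diff_distrib diff dot_action_xvar_mult[OF \<sigma>] dot_action_xpow_mult[OF \<sigma>])
      with False show ?thesis by (simp only: if_False mult.assoc)
    qed simp
  next
    show "\<exists>g. (\<forall>p\<in>?P. g p \<in> ?N p) \<and> f = (\<Sum>p\<in>?P. ?c p * g p)" if "f \<in> ?M" for f
      by (rule ex[OF that])
    show "g p = 0" if "\<forall>p\<in>?P. g p \<in> ?N p" "(\<Sum>p\<in>?P. ?c p * g p) = 0" "p \<in> ?P" for g p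
      by (rule uniq[OF _ that(2,3)]) (use that(1) in blast)
  qed (simp_all add: stable_graph_module)
qed

lemma twin_clique_star:
  assumes "twin_clique n E T" "v \<in> {1..n}" "v \<notin> T"
  shows "twin_clique n (E \<union> {v} \<times> T) T"
proof -
  have "(tr a b i, tr a b j) \<in> E \<union> {v} \<times> T" if "a \<in> T" "b \<in> T" "(i, j) \<in> E \<union> {v} \<times> T" for a b i j
  proof -
    have "tr a b v = v" using that(1,2) assms(3) by (intro transpose_apply_other) auto
    then show ?thesis using that assms(1) tr_in_iff[of a T b j] by (auto simp: twin_clique_def)
  qed
  then show ?thesis using assms by (auto simp: twin_clique_def)
qed

text \<open>The edge v k singles out k, so only the remaining vertices of T stay twins;
  interpolation over them produces the factor (|T| - 1)!.\<close>

lemma twin_clique_middle: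
  assumes "twin_clique n E T" "v \<in> {1..n}" "v \<notin> T" "k \<in> T"
  shows "twin_clique n (insert (v, k) E) (T - {k})"
proof -
  have "(tr a b i, tr a b j) \<in> insert (v, k) E"
    if "a \<in> T - {k}" "b \<in> T - {k}" "(i, j) \<in> insert (v, k) E" for a b i j
  proof -
    have "tr a b v = v" "tr a b k = k"
      using that(1,2) assms(3) by (auto intro!: transpose_apply_other)
    then show ?thesis using that assms(1) by (auto simp: twin_clique_def)
  qed
  then show ?thesis using assms by (auto simp: twin_clique_def)
qed

section \<open>Characters of the three modules in the modular law\<close>

context
  fixes n :: nat and E :: "(nat \<times> nat) set" and T :: "nat set" and k v :: nat
  assumes tw: "twin_clique n E T" and k: "k \<in> T" and v: "v \<in> {1..n}" "v \<notin> T"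
begin

private abbreviation "M0 \<equiv> graph_module n E {}"
private abbreviation "M1 \<equiv> graph_module n (insert (v, k) E) {}"
private abbreviation "M2 \<equiv> graph_module n (E \<union> {v} \<times> T) {}"
private abbreviation "N0 \<equiv> graph_module n E (T \<times> T)"
private abbreviation "N2 \<equiv> graph_module n (E \<union> {v} \<times> T) (T \<times> T)"

lemma bottom_character: "has_character n N0 \<nu> \<Longrightarrow> has_character n M0 (\<lambda>\<sigma>. fact (card T) * \<nu> \<sigma>)"
  using clique_character[OF tw, of "{}" \<nu>] by simp

lemma top_character: "has_character n N2 \<nu> \<Longrightarrow> has_character n M2 (\<lambda>\<sigma>. fact (card T) * \<nu> \<sigma>)"
  using clique_character[OF twin_clique_star[OF tw v], of "{}" \<nu>] by simp

lemma bottom_invariants_character: "has_character n M0 \<tau> \<Longrightarrow> \<exists>\<nu>. has_character n N0 \<nu>"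
  using clique_character_ex[OF tw, of "{}"] by simp

lemma top_invariants_character: "has_character n M2 \<tau> \<Longrightarrow> \<exists>\<nu>. has_character n N2 \<nu>"
  using clique_character_ex[OF twin_clique_star[OF tw v], of "{}"] by simp

lemma card_clique: "card T = Suc (card (T - {k}))"
  using twin_clique_finite[OF tw] k by (metis card_Suc_Diff1)

lemma middle_character:
  assumes "has_character n N0 \<nu>0" "has_character n N2 \<nu>2"
  shows "has_character n M1
    (\<lambda>\<sigma>. fact (card (T - {k})) * (\<nu>2 \<sigma> + of_nat (card (T - {k})) * \<nu>0 \<sigma>))"
proof -
  have "has_character n (graph_module n (insert (v, k) E) ((T - {k}) \<times> (T - {k})))
      (\<lambda>\<sigma>. \<Sum>p<card T. (if p = 0 then \<nu>2 else \<nu>0) \<sigma>)"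
    by (rule has_character_direct_sum[OF middle_direct_sum[OF tw k v]]) (use assms in simp)
  then have "has_character n (graph_module n (insert (v, k) E) ((T - {k}) \<times> (T - {k})))
      (\<lambda>\<sigma>. \<nu>2 \<sigma> + of_nat (card (T - {k})) * \<nu>0 \<sigma>)"
    by (simp add: card_clique lessThan_Suc_eq_insert_0 sum.reindex)
  then show ?thesis using clique_character[OF twin_clique_middle[OF tw v k], of "{}"] by simp
qed

text \<open>\<open>N2\<close> is the summand of index 0 in the middle decomposition, so a character
  of \<open>M1\<close> already yields one for the invariants of the top module.\<close>

lemma middle_invariants_character:
  assumes "has_character n M1 \<tau>"
  shows "\<exists>\<nu>. has_character n N2 \<nu>"
proof -
  obtain \<tau>' where "has_character n (graph_module n (insert (v, k) E) ((T - {k}) \<times> (T - {k}))) \<tau>'"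
    using clique_character_ex[OF twin_clique_middle[OF tw v k], of "{}"] assms by auto
  from has_character_summand[OF middle_direct_sum[OF tw k v] this, of 0] card_clique show ?thesis by simp
qed

text \<open>With r = |T| and \<nu>0, \<nu>2 the characters of the invariants, the three characters
  are r! \<nu>0, (r - 1)! (\<nu>2 + (r - 1) \<nu>0) and r! \<nu>2. Uniqueness of characters
  identifies the given ones with these.\<close>

lemma modular_law_middle:
  assumes "has_character n M0 \<tau>0" "has_character n M2 \<tau>2"
  shows "\<exists>\<tau>1. has_character n M1 \<tau>1 \<and> (\<forall>\<sigma>. \<sigma> permutes {1..n} \<longrightarrow>
    of_nat (card T) * \<tau>1 \<sigma> = \<tau>2 \<sigma> + of_nat (card T - 1) * \<tau>0 \<sigma>)"
proof -
  obtain \<nu>0 \<nu>2 where \<nu>: "has_character n N0 \<nu>0" "has_character n N2 \<nu>2"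
    using bottom_invariants_character top_invariants_character assms by blast
  have "\<tau>0 \<sigma> = fact (card T) * \<nu>0 \<sigma>" "\<tau>2 \<sigma> = fact (card T) * \<nu>2 \<sigma>" if "\<sigma> permutes {1..n}" for \<sigma>
    using has_character_unique[OF stable_graph_module assms(1) bottom_character[OF \<nu>(1)] that]
      has_character_unique[OF stable_graph_module assms(2) top_character[OF \<nu>(2)] that] by blast+
  then show ?thesis
    by (intro exI[of _ "\<lambda>\<sigma>. fact (card (T - {k})) * (\<nu>2 \<sigma> + of_nat (card (T - {k})) * \<nu>0 \<sigma>)"]
        conjI middle_character \<nu>) (simp add: card_clique algebra_simps)
qed

text \<open>Here the top module is the unknown, so \<nu>2 has to be extracted from the middle
  one.\<close>

lemma modular_law_top:
  assumes "has_character n M0 \<tau>0" "has_character n M1 \<tau>1"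
  shows "\<exists>\<tau>2. has_character n M2 \<tau>2 \<and> (\<forall>\<sigma>. \<sigma> permutes {1..n} \<longrightarrow>
    of_nat (card T) * \<tau>1 \<sigma> = \<tau>2 \<sigma> + of_nat (card T - 1) * \<tau>0 \<sigma>)"
proof -
  obtain \<nu>0 \<nu>2 where \<nu>: "has_character n N0 \<nu>0" "has_character n N2 \<nu>2"
    using bottom_invariants_character middle_invariants_character assms by blast
  have "\<tau>0 \<sigma> = fact (card T) * \<nu>0 \<sigma>"
      "\<tau>1 \<sigma> = fact (card (T - {k})) * (\<nu>2 \<sigma> + of_nat (card (T - {k})) * \<nu>0 \<sigma>)"
    if "\<sigma> permutes {1..n}" for \<sigma>
    using has_character_unique[OF stable_graph_module assms(1) bottom_character[OF \<nu>(1)] that]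
      has_character_unique[OF stable_graph_module assms(2) middle_character[OF \<nu>] that] by blast+
  then show ?thesis
    by (intro exI[of _ "\<lambda>\<sigma>. fact (card T) * \<nu>2 \<sigma>"] conjI top_character \<nu>)
       (simp add: card_clique algebra_simps)
qed

end

section \<open>Disjoint unions of complete graphs\<close>

lemma orbit_comp_tr:
  assumes u: "u permutes S" "finite S" and k: "k \<notin> S" and i: "i \<in> S" and x: "x \<in> S"
  shows "orbit (u \<circ> tr i k) x = orbit u x \<union> (if i \<in> orbit u x then {k} else {})"
    (is "orbit ?v x = ?R")
proof -
  have perm: "permutation u" using u by (auto simp: permutation_permutes)
  have uk: "u k = k" using u(1) k by (simp add: permutes_def)
  \<comment> \<open>The cycle through i now runs i, k, u i: the new point is spliced in right after
    i, and all other cycles are unchanged.\<close>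
  have vk: "?v k = u i" and vi: "?v i = k" using uk by simp_all
  have v: "?v y = u y" if "y \<noteq> i" "y \<noteq> k" for y using that by simp
  have S: "orbit u x \<subseteq> S" using permutes_orbit_subset[OF u(1) x] .
  have self: "y \<in> orbit u y" for y using permutation_self_in_orbit[OF perm] .
  have "y \<in> ?R" if "y \<in> orbit ?v x" for y
    using that
  proof induction
    case base
    show ?case
    proof (cases "x = i")
      case True
      then show ?thesis using vi self[of i] by simp
    next
      case False
      then have "?v x = u x" using v x k by metis
      then show ?thesis using orbit.base[of u x] by simp
    qed
  next
    case (step y)
    consider "y = k" "i \<in> orbit u x" | "y = i" "i \<in> orbit u x" | "y \<noteq> i" "y \<in> orbit u x" "y \<noteq> k"
      using step.IH S k by (auto split: if_splits)
    then show ?case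
    proof cases
      case 1
      then show ?thesis using vk orbit.step[of i u x] by simp
    next
      case 2
      then show ?thesis using vi by simp
    next
      case 3
      then have "?v y = u y" using v by metis
      then show ?thesis using 3 orbit.step[of y u x] by simp
    qed
  qed
  moreover have sub: "y \<in> orbit ?v x" if "y \<in> orbit u x" for y
    using that
  proof induction
    case base
    show ?case
    proof (cases "x = i")
      case True
      have "?v (?v x) \<in> orbit ?v x" by (intro orbit.intros)
      then show ?thesis unfolding True vi vk .
    next
      case False
      then have "?v x = u x" using v x k by metis
      then show ?thesis using orbit.base[of ?v x] by metis
    qed
  next
    case (step y)
    have "y \<noteq> k" using step.hyps S k by blast
    show ?case
    proof (cases "y = i")
      case True
      have "?v (?v y) \<in> orbit ?v x" by (intro orbit.step step.IH)
      then show ?thesis unfolding True vi vk .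
    next
      case False
      then have "?v y = u y" using v \<open>y \<noteq> k\<close> by metis
      then show ?thesis using orbit.step[OF step.IH] by metis
    qed
  qed
  moreover have "k \<in> orbit ?v x" if "i \<in> orbit u x"
    using orbit.step[OF sub[OF that]] by (simp only: vi)
  ultimately show ?thesis by (cases "i \<in> orbit u x") (simp_all only: if_True if_False, blast+)
qed

text \<open>The point k joins the orbit of i instead of forming one of its own, and adjoining it
  keeps distinct orbits distinct.\<close>

lemma card_orbits_comp_tr:
  assumes u: "u permutes S" "finite S" and k: "k \<notin> S" and i: "i \<in> S"
  shows "card (orbit (u \<circ> tr i k) ` insert k S) = card (orbit u ` S)"
proof -
  let ?v = "u \<circ> tr i k" and ?\<phi> = "\<lambda>C. C \<union> (if i \<in> C then {k} else {})"
  have "?v permutes insert k S"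
    using u(1) i by (intro permutes_comp_tr) (auto intro: permutes_subset)
  then have "permutation ?v" using u(2) by (auto simp: permutation_permutes)
  then have "orbit ?v (?v i) = orbit ?v i" by (rule permutation_orbit_step)
  moreover have "?v i = k" using u(1) k by (simp add: permutes_def)
  ultimately have "orbit ?v k = orbit ?v i" by simp
  then have "orbit ?v ` insert k S = orbit ?v ` S" using i by auto
  also have "\<dots> = ?\<phi> ` (orbit u ` S)"
    unfolding image_image by (intro image_cong refl orbit_comp_tr[OF u(1) u(2) k i])
  also have "card \<dots> = card (orbit u ` S)"
  proof (rule card_image, rule inj_onI)
    fix C D assume *: "C \<in> orbit u ` S" "D \<in> orbit u ` S" "?\<phi> C = ?\<phi> D"
    have "k \<notin> C" "k \<notin> D" using *(1,2) permutes_orbit_subset[OF u(1)] k by blast+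
    then have "C = ?\<phi> C - {k}" "D = ?\<phi> D - {k}" by auto
    then show "C = D" using *(3) by metis
  qed
  finally show ?thesis .
qed

lemma card_orbits_insert_fixed:
  assumes u: "u permutes S" "finite S" and k: "k \<notin> S"
  shows "card (orbit u ` insert k S) = Suc (card (orbit u ` S))"
proof -
  have "orbit u k = {k}" using u(1) k by (simp add: orbit_eq_singleton_iff permutes_def)
  moreover have "{k} \<notin> orbit u ` S"
    using permutes_orbit_subset[OF u(1)] k by blast
  ultimately show ?thesis using u(2) by simp
qed

lemma num_cycles_conj:
  assumes w: "w permutes {1..n}" and u: "u permutes {1..n}"
  shows "num_cycles n (w \<circ> u \<circ> Hilbert_Choice.inv w) = num_cycles n u"
proof -
  let ?c = "w \<circ> u \<circ> Hilbert_Choice.inv w"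
  have perm: "permutation u" using u by (auto simp: permutation_permutes)
  have inj: "inj w" using w by (rule permutes_inj)
  have "orbit ?c (w x) = w ` orbit u x" for x
    by (rule orbit_inverse[symmetric]) (simp_all add: permutation_self_in_orbit[OF perm] permutes_inverses[OF w])
  then have "orbit ?c ` (w ` {1..n}) = (`) w ` (orbit u ` {1..n})"
    by (simp add: image_image)
  moreover have "inj_on ((`) w) (orbit u ` {1..n})"
    using inj by (auto intro!: inj_onI simp: inj_image_eq_iff)
  ultimately show ?thesis
    unfolding num_cycles_def permutes_image[OF w] by (simp add: card_image)
qed

text \<open>Symmetric and with loops, as \<open>twin_clique\<close> expects;
  \<open>graph_module_symmetric\<close> shows that the module is the same as for the edges i < j
  alone.\<close>

definition hess_edges :: "nat \<Rightarrow> (nat \<Rightarrow> nat) \<Rightarrow> (nat \<times> nat) set" where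
  "hess_edges n h = {(i, j). i \<in> {1..n} \<and> j \<in> {1..n} \<and> (i \<le> j \<and> j \<le> h i \<or> j \<le> i \<and> i \<le> h j)}"

abbreviation hess_module :: "nat \<Rightarrow> (nat \<Rightarrow> nat) \<Rightarrow> tuple set" where
  "hess_module n h \<equiv> graph_module n (hess_edges n h) {}"

definition class_length_poly :: "nat \<Rightarrow> ((nat \<Rightarrow> nat) \<Rightarrow> rat) \<Rightarrow> rat poly" where
  "class_length_poly n \<tau> = Polynomial.smult (1 / fact n)
     (\<Sum>\<sigma> | \<sigma> permutes {1..n}. Polynomial.monom (\<tau> \<sigma>) (num_cycles n \<sigma>))"

section \<open>Idempotent Hessenberg functions: blocks and their Young subgroup\<close>

context
  fixes n :: nat and h :: "nat \<Rightarrow> nat"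
  assumes hess: "hessenberg_function n h" and idem: "\<And>x. x \<in> {1..n} \<Longrightarrow> h (h x) = h x"
begin

definition block_edges :: "(nat \<times> nat) set" where
  "block_edges = {(i, j). i \<in> {1..n} \<and> j \<in> {1..n} \<and> h i = h j}"

text \<open>For k = 1 this is the Young subgroup of the blocks; larger k give its subgroups fixing
  every point below k, a chain that changes by one point at a time.\<close>

definition block_perms :: "nat \<Rightarrow> (nat \<Rightarrow> nat) set" where
  "block_perms k = {u. u permutes {k..n} \<and> (\<forall>x\<in>{1..n}. h (u x) = h x)}"

text \<open>Equality of the left cosets of \<open>w\<close> and \<open>x\<close> modulo the Young
  subgroup, in a form whose symmetry is visible.\<close>

definition same_coset :: "(nat \<Rightarrow> nat) \<Rightarrow> (nat \<Rightarrow> nat) \<Rightarrow> bool" where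
  "same_coset w x \<longleftrightarrow> (\<forall>y\<in>{1..n}. h (Hilbert_Choice.inv w y) = h (Hilbert_Choice.inv x y))"

lemma h_bounds: "i \<in> {1..n} \<Longrightarrow> h i \<in> {1..n} \<and> i \<le> h i"
  using hess unfolding hessenberg_function_def by blast

lemma h_mono: "i \<in> {1..n} \<Longrightarrow> j \<in> {1..n} \<Longrightarrow> i \<le> j \<Longrightarrow> h i \<le> h j"
  using hess unfolding hessenberg_function_def mono_on_def by blast

text \<open>By monotonicity and idempotence h is constant on {i..h(i)}; its fibres are intervals,
  each ending at the common value of h on it.\<close>

lemma block_interval:
  assumes ij: "i \<in> {1..n}" "j \<in> {1..n}" "i \<le> j"
  shows "h i = h j \<longleftrightarrow> j \<le> h i"
proof
  show "j \<le> h i" if "h i = h j" using that h_bounds[OF ij(2)] by simp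
  assume "j \<le> h i"
  then have "h j \<le> h (h i)" using h_mono[OF ij(2)] h_bounds[OF ij(1)] by blast
  then show "h i = h j" using h_mono[OF ij] idem[OF ij(1)] by simp
qed

lemma hess_edges_eq_block_edges: "hess_edges n h = block_edges"
proof -
  have "(i \<le> j \<and> j \<le> h i \<or> j \<le> i \<and> i \<le> h j) \<longleftrightarrow> h i = h j" if "i \<in> {1..n}" "j \<in> {1..n}" for i j
    using block_interval[OF that] block_interval[OF that(2,1)] by (metis nle_le)
  then show ?thesis unfolding hess_edges_def block_edges_def by blast
qed

lemma block_eq:
  assumes k: "k \<in> {1..n}"
  shows "j \<in> {k..h k} \<longleftrightarrow> j \<in> {k..n} \<and> h j = h k"
proof
  assume j: "j \<in> {k..h k}"
  then have "j \<in> {k..n}" using h_bounds[OF k] by simp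
  then show "j \<in> {k..n} \<and> h j = h k" using block_interval[OF k, of j] j k by simp
next
  assume j: "j \<in> {k..n} \<and> h j = h k"
  then show "j \<in> {k..h k}" using block_interval[OF k, of j] k by simp
qed

lemma block_twin_clique: "k \<in> {1..n} \<Longrightarrow> twin_clique n block_edges {k..h k}"
proof -
  assume k: "k \<in> {1..n}"
  have T: "{k..h k} \<subseteq> {1..n}" using h_bounds[OF k] k by auto
  have "h (tr a b i) = h i" if "a \<in> {k..h k}" "b \<in> {k..h k}" for a b i
    using that block_eq[OF k] by (auto simp: Transposition.transpose_def)
  moreover have "tr a b i \<in> {1..n}" if "a \<in> {k..h k}" "b \<in> {k..h k}" "i \<in> {1..n}" for a b i
    using that T by (metis subsetD tr_in_iff)
  moreover have "{k..h k} \<times> {k..h k} \<subseteq> block_edges"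
  proof (rule subsetI)
    fix p assume "p \<in> {k..h k} \<times> {k..h k}"
    then obtain i j where p: "p = (i, j)" "i \<in> {k..h k}" "j \<in> {k..h k}" by (rule SigmaE)
    then have "h i = h k" "h j = h k" using block_eq[OF k] by blast+
    moreover have "i \<in> {1..n}" "j \<in> {1..n}" using T p(2,3) by blast+
    ultimately show "p \<in> block_edges" by (simp add: p(1) block_edges_def)
  qed
  moreover have "block_edges \<subseteq> {1..n} \<times> {1..n}" by (auto simp: block_edges_def)
  ultimately show ?thesis using T unfolding twin_clique_def
    by (intro conjI ballI allI impI) (simp_all add: block_edges_def)
qed

text \<open>A filtration from the Hessenberg module, which has no invariance and occurs at k = n +
  1, to the invariants under the whole Young subgroup at k = 1.\<close>

definition block_module :: "nat \<Rightarrow> tuple set" where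
  "block_module k = graph_module n block_edges (block_edges \<inter> {k..n} \<times> {k..n})"

text \<open>Invariance at level k + 1 already covers the permutations of {k + 1..h(k)};
  interpolation over the clique {k..h(k)} adds k to them.\<close>

lemma block_module_direct_sum:
  assumes k: "k \<in> {1..n}"
  shows "direct_sum n (block_module (Suc k)) {..<card {k..h k}} (xpow k) (\<lambda>_. block_module k)"
proof -
  let ?T = "{k..h k}"
  have T: "?T \<subseteq> {1..n}" using h_bounds[OF k] k by auto
  have kT: "k \<in> ?T" using h_bounds[OF k] by simp
  have TT: "?T \<times> ?T \<subseteq> block_edges" using block_twin_clique[OF k] by (simp add: twin_clique_def)
  have up: "j \<in> ?T \<longleftrightarrow> h j = h k" if "j \<in> {Suc k..n}" for j
    using block_eq[OF k, of j] that by auto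
  have "direct_sum n (graph_module n block_edges (block_edges \<inter> {Suc k..n} \<times> {Suc k..n})) {..<card ?T}
      (xpow k) (\<lambda>_. graph_module n block_edges (block_edges \<inter> {Suc k..n} \<times> {Suc k..n} \<union> ?T \<times> ?T))"
  proof (rule newton_direct_sum[OF block_twin_clique[OF k] kT])
    show "block_edges \<inter> {Suc k..n} \<times> {Suc k..n} \<subseteq> {1..n} \<times> {1..n}" by (auto simp: block_edges_def)
    have "?T - {k} \<subseteq> {Suc k..n}" using T by auto
    then show "(?T - {k}) \<times> (?T - {k}) \<subseteq> block_edges \<inter> {Suc k..n} \<times> {Suc k..n}" using TT by blast
    fix i j assume ij: "(i, j) \<in> block_edges \<inter> {Suc k..n} \<times> {Suc k..n}"
    then have "h i = h j" by (auto simp: block_edges_def)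
    then have "i \<in> ?T \<longleftrightarrow> j \<in> ?T" using ij up[of i] up[of j] by auto
    then show "(i, j) \<in> (?T - {k}) \<times> (?T - {k}) \<or> i \<notin> ?T \<and> j \<notin> ?T" using ij by auto
  qed
  moreover have "block_edges \<inter> {Suc k..n} \<times> {Suc k..n} \<union> ?T \<times> ?T = block_edges \<inter> {k..n} \<times> {k..n}"
  proof -
    have *: "(i, j) \<in> ?T \<times> ?T" if "(i, j) \<in> block_edges" "i \<in> {k..n}" "j \<in> {k..n}" "i = k \<or> j = k" for i j
    proof -
      have "h i = h k" "h j = h k" using that(1,4) by (auto simp: block_edges_def)
      then show ?thesis using that(2,3) block_eq[OF k] by blast
    qed
    have "block_edges \<inter> {k..n} \<times> {k..n} \<subseteq> block_edges \<inter> {Suc k..n} \<times> {Suc k..n} \<union> ?T \<times> ?T"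
    proof (rule subsetI)
      fix p assume "p \<in> block_edges \<inter> {k..n} \<times> {k..n}"
      then obtain i j where p: "p = (i, j)" "(i, j) \<in> block_edges" "i \<in> {k..n}" "j \<in> {k..n}" by blast
      show "p \<in> block_edges \<inter> {Suc k..n} \<times> {Suc k..n} \<union> ?T \<times> ?T"
      proof (cases "i = k \<or> j = k")
        case True
        then show ?thesis using * p by blast
      next
        case False
        then have "i \<in> {Suc k..n}" "j \<in> {Suc k..n}" using p(3,4) by auto
        then show ?thesis using p(1,2) by blast
      qed
    qed
    moreover have "?T \<subseteq> {k..n}" "{Suc k..n} \<subseteq> {k..n}" using T by auto
    then have "block_edges \<inter> {Suc k..n} \<times> {Suc k..n} \<union> ?T \<times> ?T \<subseteq> block_edges \<inter> {k..n} \<times> {k..n}"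
      using TT by blast
    ultimately show ?thesis by (rule subset_antisym[rotated])
  qed
  ultimately show ?thesis by (simp add: block_module_def)
qed

text \<open>The index i is the preimage of k. Undoing the transposition makes k a fixed point, which
  leaves an element of the next subgroup in the chain.\<close>

lemma block_perms_bij:
  assumes k: "k \<in> {1..n}"
  shows "bij_betw (\<lambda>(i, u). u \<circ> tr i k) ({k..h k} \<times> block_perms (Suc k)) (block_perms k)"
proof (rule bij_betwI[where g = "\<lambda>u. (Hilbert_Choice.inv u k, u \<circ> tr (Hilbert_Choice.inv u k) k)"])
  have kn: "{k..n} = insert k {Suc k..n}" using k by auto
  show "(\<lambda>(i, u). u \<circ> tr i k) \<in> {k..h k} \<times> block_perms (Suc k) \<rightarrow> block_perms k"
  proof
    fix x assume "x \<in> {k..h k} \<times> block_perms (Suc k)"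
    then obtain i u where x: "x = (i, u)" and i: "i \<in> {k..h k}" and u: "u permutes {Suc k..n}"
      "\<And>x. x \<in> {1..n} \<Longrightarrow> h (u x) = h x" by (auto simp: block_perms_def)
    have "u permutes {k..n}" using u(1) by (rule permutes_subset) auto
    then have "(u \<circ> tr i k) permutes {k..n}" using i block_eq[OF k] k by (intro permutes_comp_tr) auto
    moreover have "h ((u \<circ> tr i k) y) = h y" if "y \<in> {1..n}" for y
    proof -
      have "h (tr i k y) = h y" using i block_eq[OF k] by (auto simp: Transposition.transpose_def)
      moreover have "tr i k y \<in> {1..n}" using that i k block_eq[OF k] by (auto simp: Transposition.transpose_def)
      ultimately show ?thesis using u(2) by simp
    qed
    ultimately show "(\<lambda>(i, u). u \<circ> tr i k) x \<in> block_perms k" by (simp add: x block_perms_def)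
  qed
  show "(\<lambda>u. (Hilbert_Choice.inv u k, u \<circ> tr (Hilbert_Choice.inv u k) k))
      \<in> block_perms k \<rightarrow> {k..h k} \<times> block_perms (Suc k)"
  proof
    fix u assume "u \<in> block_perms k"
    then have u: "u permutes {k..n}" "\<And>x. x \<in> {1..n} \<Longrightarrow> h (u x) = h x" by (auto simp: block_perms_def)
    let ?i = "Hilbert_Choice.inv u k"
    have i: "?i \<in> {k..n}" using permutes_in_image[OF permutes_inv[OF u(1)]] k by auto
    have ui: "u ?i = k" using permutes_inverses(1)[OF u(1)] .
    have "h ?i = h k" using u(2)[of ?i] i k ui by auto
    then have iT: "?i \<in> {k..h k}" using block_eq[OF k] i by blast
    have p1: "(u \<circ> tr ?i k) permutes insert k {Suc k..n}"
      unfolding kn[symmetric] using u(1) i k by (intro permutes_comp_tr) auto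
    have "(u \<circ> tr ?i k) k = k" using ui by simp
    then have "(u \<circ> tr ?i k) permutes {Suc k..n}"
      by (intro permutes_superset[OF p1]) auto
    moreover have "h ((u \<circ> tr ?i k) y) = h y" if "y \<in> {1..n}" for y
    proof -
      have "h (tr ?i k y) = h y" using \<open>h ?i = h k\<close> by (auto simp: Transposition.transpose_def)
      moreover have "tr ?i k y \<in> {1..n}" using that i k by (auto simp: Transposition.transpose_def)
      ultimately show ?thesis using u(2) by simp
    qed
    ultimately show "(?i, u \<circ> tr ?i k) \<in> {k..h k} \<times> block_perms (Suc k)"
      using iT by (simp add: block_perms_def)
  qed
next
  fix x assume "x \<in> {k..h k} \<times> block_perms (Suc k)"
  then obtain i u where x: "x = (i, u)" and i: "i \<in> {k..h k}" and u: "u permutes {Suc k..n}"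
    by (auto simp: block_perms_def)
  have "u permutes {k..n}" using u(1) by (rule permutes_subset) auto
  then have p: "(u \<circ> tr i k) permutes {k..n}" using i block_eq[OF k] k by (intro permutes_comp_tr) auto
  have "(u \<circ> tr i k) i = k" using u by (simp add: permutes_def)
  then have "Hilbert_Choice.inv (u \<circ> tr i k) k = i" using permutes_inv_eq[OF p] by blast
  then show "(Hilbert_Choice.inv ((\<lambda>(i, u). u \<circ> tr i k) x) k, (\<lambda>(i, u). u \<circ> tr i k) x \<circ>
      tr (Hilbert_Choice.inv ((\<lambda>(i, u). u \<circ> tr i k) x) k) k) = x"
    by (simp add: x comp_assoc)
qed (simp add: comp_assoc)

lemma block_perms_last: "block_perms (Suc n) = {id}"
  by (auto simp: block_perms_def)

lemma finite_block_perms: "finite (block_perms k)"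
  by (rule finite_subset[OF _ finite_permutations[of "{k..n}"]]) (auto simp: block_perms_def)

text \<open>Permutations are built by adjoining the points in decreasing order. A cycle consisting
  of k alone contributes m; splicing k in after one of the h(k) - k later points of its block keeps
  the number of cycles. This is the origin of the factor m + h(k) - k.\<close>

lemma block_perms_cycle_poly:
  assumes "k \<in> {1..Suc n}"
  shows "(\<Sum>u\<in>block_perms k. Polynomial.monom 1 (card (orbit u ` {k..n})))
       = (\<Prod>i=k..n. [:of_nat (h i) - of_nat i, 1 :: rat:])"
proof -
  let ?m = "\<lambda>k u. Polynomial.monom (1::rat) (card (orbit u ` {k..n}))"
  have "k \<le> Suc n" "1 \<le> k" using assms by auto
  then show ?thesis
  proof (induction rule: inc_induct)
    case base
    show ?case by (simp add: block_perms_last monom_eq_1_iff)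
  next
    case (step k)
    have k: "k \<in> {1..n}" using step.prems step.hyps by auto
    let ?T = "{k..h k}"
    have kT: "k \<in> ?T" using h_bounds[OF k] by simp
    have kn: "{k..n} = insert k {Suc k..n}" using k by auto
    have m: "?m k (u \<circ> tr i k) = (if i = k then [:0, 1:] * ?m (Suc k) u else ?m (Suc k) u)"
      if "i \<in> ?T" "u \<in> block_perms (Suc k)" for i u
    proof -
      have u: "u permutes {Suc k..n}" using that(2) by (simp add: block_perms_def)
      show ?thesis
      proof (cases "i = k")
        case True
        then show ?thesis using card_orbits_insert_fixed[OF u] by (simp add: kn monom_Suc)
      next
        case False
        then have "i \<in> {Suc k..n}" using that(1) h_bounds[OF k] by auto
        then show ?thesis using False card_orbits_comp_tr[OF u, of k i] by (simp add: kn)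
      qed
    qed
    have "(\<Sum>u\<in>block_perms k. ?m k u) = (\<Sum>(i, u)\<in>?T \<times> block_perms (Suc k). ?m k (u \<circ> tr i k))"
      using sum.reindex_bij_betw[OF block_perms_bij[OF k], of "?m k"] by (simp add: case_prod_unfold)
    also have "\<dots> = (\<Sum>i\<in>?T. \<Sum>u\<in>block_perms (Suc k). if i = k then [:0, 1:] * ?m (Suc k) u else ?m (Suc k) u)"
      unfolding sum.cartesian_product[symmetric] by (intro sum.cong refl m)
    also have "\<dots> = (\<Sum>i\<in>?T. (if i = k then [:0, 1:] else 1) * (\<Sum>u\<in>block_perms (Suc k). ?m (Suc k) u))"
      by (intro sum.cong refl) (simp add: sum_distrib_left)
    also have "\<dots> = (\<Sum>i\<in>?T. if i = k then [:0, 1:] else 1) * (\<Sum>u\<in>block_perms (Suc k). ?m (Suc k) u)"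
      by (rule sum_distrib_right[symmetric])
    also have "(\<Sum>i\<in>?T. if i = k then [:0, 1:] else 1) = [:of_nat (h k) - of_nat k, 1 :: rat:]"
    proof -
      have "(\<Sum>i\<in>?T. if i = k then [:0, 1:] else 1) = [:0, 1:] + (\<Sum>i\<in>?T - {k}. (1 :: rat poly))"
        using kT by (subst sum.remove[of _ k]) (auto intro!: sum.cong)
      also have "\<dots> = [:0, 1:] + of_nat (h k - k)" using kT by simp
      finally show ?thesis using h_bounds[OF k] by (simp add: of_nat_poly of_nat_diff)
    qed
    also have "(\<Sum>u\<in>block_perms (Suc k). ?m (Suc k) u) = (\<Prod>i=Suc k..n. [:of_nat (h i) - of_nat i, 1 :: rat:])"
      by (rule step.IH) simp
    also have "[:of_nat (h k) - of_nat k, 1 :: rat:] * \<dots> = (\<Prod>i=k..n. [:of_nat (h i) - of_nat i, 1 :: rat:])"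
      by (simp only: kn) (simp add: prod.insert)
    finally show ?case .
  qed
qed

lemma card_block_perms: "of_nat (card (block_perms 1)) = (\<Prod>i=1..n. of_nat (h i) - of_nat i + (1::rat))"
proof -
  have "of_nat (card (block_perms 1)) =
      poly (\<Sum>u\<in>block_perms 1. Polynomial.monom 1 (card (orbit u ` {1..n}))) (1::rat)"
    by (simp add: poly_sum poly_monom)
  also have "\<dots> = (\<Prod>i=1..n. of_nat (h i) - of_nat i + (1::rat))"
    by (subst block_perms_cycle_poly) (simp_all add: poly_prod)
  finally show ?thesis .
qed

text \<open>Each level multiplies the character by the size of {i..h(i)}; at k = n + 1 the product
  is the order of the Young subgroup, by \<open>card_block_perms\<close>.\<close>

lemma block_module_character:
  assumes "has_character n (block_module 1) \<tau>" and "k \<in> {1..Suc n}"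
  shows "has_character n (block_module k) (\<lambda>\<sigma>. (\<Prod>i=1..<k. of_nat (h i) - of_nat i + 1) * \<tau> \<sigma>)"
proof -
  have "1 \<le> k" "k \<le> Suc n" using assms(2) by auto
  then show ?thesis
  proof (induction k rule: dec_induct)
    case base
    show ?case using assms(1) by simp
  next
    case (step k)
    have k: "k \<in> {1..n}" using step.prems step.hyps by auto
    then have "of_nat (card {k..h k}) = of_nat (h k) - of_nat k + (1::rat)"
      using h_bounds[OF k] by (simp add: of_nat_diff Suc_diff_le)
    moreover have "has_character n (block_module k) (\<lambda>\<sigma>. (\<Prod>i=1..<k. of_nat (h i) - of_nat i + 1) * \<tau> \<sigma>)"
      using step.prems by (intro step.IH) simp
    ultimately show ?case
      using has_character_direct_sum_const[OF block_module_direct_sum[OF k]] step.hyps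
      by (fastforce simp: mult_ac prod.atLeastLessThan_Suc)
  qed
qed

text \<open>The decomposition in \<open>block_perms_bij\<close> writes a block-preserving
  permutation as a product of transpositions inside blocks.\<close>

lemma block_module_perms_invariant:
  assumes f: "f \<in> block_module 1" and "k \<in> {1..Suc n}" and "u \<in> block_perms k" and "w permutes {1..n}"
  shows "f (w \<circ> u) = f w"
proof -
  have "k \<le> Suc n" "1 \<le> k" using assms by auto
  then show ?thesis using assms(3,4)
  proof (induction k arbitrary: u w rule: inc_induct)
    case base
    then show ?case by (simp add: block_perms_last)
  next
    case (step k)
    have k: "k \<in> {1..n}" using step.prems step.hyps by auto
    obtain i u' where u: "u = u' \<circ> tr i k" and i: "i \<in> {k..h k}" and u': "u' \<in> block_perms (Suc k)"
      using bij_betw_imp_surj_on[OF block_perms_bij[OF k]] step.prems(2) by force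
    have i1: "i \<in> {1..n}" using i h_bounds[OF k] k by auto
    have "u' permutes {Suc k..n}" using u' by (simp add: block_perms_def)
    then have "u' permutes {1..n}" by (rule permutes_subset) auto
    then have wu: "(w \<circ> u') permutes {1..n}" using step.prems(3) by (rule permutes_compose)
    have "(i, k) \<in> block_edges \<inter> {1..n} \<times> {1..n}"
      using i i1 k block_eq[OF k] by (auto simp: block_edges_def)
    then have "f (w \<circ> u' \<circ> tr i k) = f (w \<circ> u')"
      using graph_moduleD(4)[OF f[unfolded block_module_def] wu] by blast
    also have "\<dots> = f w" by (rule step.IH[OF _ u' step.prems(3)]) simp
    finally show ?case unfolding u comp_assoc .
  qed
qed

section \<open>Functions on the cosets of the Young subgroup\<close>

lemma same_coset_iff:
  assumes w: "w permutes {1..n}" and x: "x permutes {1..n}"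
  shows "same_coset w x \<longleftrightarrow> Hilbert_Choice.inv w \<circ> x \<in> block_perms 1"
proof -
  have "(\<forall>y\<in>{1..n}. h (Hilbert_Choice.inv w y) = h (Hilbert_Choice.inv x y)) \<longleftrightarrow>
      (\<forall>y\<in>x ` {1..n}. h (Hilbert_Choice.inv w y) = h (Hilbert_Choice.inv x y))"
    by (simp only: permutes_image[OF x])
  also have "\<dots> \<longleftrightarrow> (\<forall>z\<in>{1..n}. h ((Hilbert_Choice.inv w \<circ> x) z) = h z)"
    by (simp add: permutes_inverses[OF x])
  finally show ?thesis
    using permutes_compose[OF x permutes_inv[OF w]] by (simp add: same_coset_def block_perms_def)
qed

lemma same_coset_sym: "same_coset w x \<longleftrightarrow> same_coset x w"
  by (auto simp: same_coset_def)

lemma same_coset_invariant: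
  assumes f: "f \<in> block_module 1" and w: "w permutes {1..n}" and x: "x permutes {1..n}" and "same_coset w x"
  shows "f x = f w"
proof -
  have "Hilbert_Choice.inv w \<circ> x \<in> block_perms 1" using same_coset_iff[OF w x] assms(4) by blast
  then have "f (w \<circ> (Hilbert_Choice.inv w \<circ> x)) = f w"
    by (intro block_module_perms_invariant[OF f, of 1] w) auto
  then show ?thesis by (simp add: comp_assoc[symmetric] permutes_inv_o[OF w])
qed

lemma card_coset:
  assumes x: "x permutes {1..n}"
  shows "card {w. w permutes {1..n} \<and> same_coset w x} = card (block_perms 1)"
proof -
  have "bij_betw (\<lambda>w. Hilbert_Choice.inv x \<circ> w) {w. w permutes {1..n} \<and> same_coset w x} (block_perms 1)"
  proof (rule bij_betwI[where g = "\<lambda>u. x \<circ> u"])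
    show "(\<lambda>w. Hilbert_Choice.inv x \<circ> w) \<in> {w. w permutes {1..n} \<and> same_coset w x} \<rightarrow> block_perms 1"
      using same_coset_iff[OF x] same_coset_sym by blast
    show "(\<lambda>u. x \<circ> u) \<in> block_perms 1 \<rightarrow> {w. w permutes {1..n} \<and> same_coset w x}"
    proof
      fix u assume u: "u \<in> block_perms 1"
      then have xu: "(x \<circ> u) permutes {1..n}"
        using x by (auto simp: block_perms_def intro: permutes_compose)
      moreover have "Hilbert_Choice.inv x \<circ> (x \<circ> u) = u"
        by (simp add: comp_assoc[symmetric] permutes_inv_o[OF x])
      ultimately show "x \<circ> u \<in> {w. w permutes {1..n} \<and> same_coset w x}"
        using same_coset_iff[OF x xu] same_coset_sym u by auto
    qed
  qed (simp_all add: comp_assoc[symmetric] permutes_inv_o[OF x])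
  then show ?thesis by (rule bij_betw_same_card)
qed

lemma block_module_1: "block_module 1 = graph_module n block_edges block_edges"
proof -
  have "block_edges \<inter> {1..n} \<times> {1..n} = block_edges" by (auto simp: block_edges_def)
  then show ?thesis by (simp add: block_module_def)
qed

text \<open>Invariance under all block transpositions makes the edge differences vanish, so
  divisibility is automatic: the module consists of all polynomial-valued functions on the
  cosets.\<close>

lemma block_module_1I:
  assumes "\<And>w. w permutes {1..n} \<Longrightarrow> f w \<in> tpolys n" "\<And>w. \<not> w permutes {1..n} \<Longrightarrow> f w = 0"
    and "\<And>w i j. w permutes {1..n} \<Longrightarrow> (i, j) \<in> block_edges \<Longrightarrow> f (w \<circ> tr i j) = f w"
  shows "f \<in> block_module 1"
  unfolding block_module_1 using assms by (intro graph_moduleI) simp_all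

definition coset_indicator :: "(nat \<Rightarrow> nat) \<Rightarrow> tuple" where
  "coset_indicator w x = (if x permutes {1..n} \<and> same_coset w x then 1 else 0)"

lemma coset_indicator_in_block_module: "coset_indicator w \<in> block_module 1"
proof (rule block_module_1I)
  fix x i j assume x: "x permutes {1..n}" and ij: "(i, j) \<in> block_edges"
  have p: "(x \<circ> tr i j) permutes {1..n}" using x ij by (intro permutes_comp_tr) (auto simp: block_edges_def)
  have "Hilbert_Choice.inv (x \<circ> tr i j) = tr i j \<circ> Hilbert_Choice.inv x"
    using permutes_bij[OF x] by (simp add: o_inv_distrib)
  then have "h (Hilbert_Choice.inv (x \<circ> tr i j) y) = h (Hilbert_Choice.inv x y)" for y
    using ij by (auto simp: block_edges_def Transposition.transpose_def)
  then show "coset_indicator w (x \<circ> tr i j) = coset_indicator w x"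
    using x p by (simp add: coset_indicator_def same_coset_def)
qed (simp_all add: coset_indicator_def)

lemma block_module_augmentation:
  assumes g: "g \<in> block_module 1" and 0: "\<And>w. lookp (g w) 0 = 0"
  shows "g \<in> augmentation n (block_module 1)"
proof -
  \<comment> \<open>Cofactors are chosen for each polynomial, not for each permutation: equal values
    of g receive equal cofactors, so every \<open>G i\<close> is again constant on cosets.\<close>
  have "\<exists>q. \<forall>p. p \<in> tpolys n \<longrightarrow> lookp p 0 = 0 \<longrightarrow>
      (\<forall>i\<in>{1..n}. q p i \<in> tpolys n) \<and> p = (\<Sum>i\<in>{1..n}. tvar i * q p i)"
    using tpolys_without_constant[of _ n] by (intro choice) blast
  then obtain q where q: "\<And>p i. p \<in> tpolys n \<Longrightarrow> lookp p 0 = 0 \<Longrightarrow> i \<in> {1..n} \<Longrightarrow> q p i \<in> tpolys n"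
    "\<And>p. p \<in> tpolys n \<Longrightarrow> lookp p 0 = 0 \<Longrightarrow> p = (\<Sum>i\<in>{1..n}. tvar i * q p i)"
    by blast
  define G :: "nat \<Rightarrow> tuple" where "G i w = (if w permutes {1..n} then q (g w) i else 0)" for i w
  note gD = graph_moduleD[OF g[unfolded block_module_1]]
  have "G i \<in> block_module 1" if "i \<in> {1..n}" for i
  proof (rule block_module_1I)
    fix x a b assume x: "x permutes {1..n}" and ab: "(a, b) \<in> block_edges"
    have p: "(x \<circ> tr a b) permutes {1..n}" using x ab by (intro permutes_comp_tr) (auto simp: block_edges_def)
    then show "G i (x \<circ> tr a b) = G i x" using x gD(4)[OF x ab] by (simp add: G_def)
  qed (use that q(1) gD(1) 0 in \<open>simp_all add: G_def\<close>)
  moreover have "g = (\<Sum>i\<in>{1..n}. pscale (tvar i) (G i))"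
  proof
    fix w show "g w = (\<Sum>i\<in>{1..n}. pscale (tvar i) (G i)) w"
    proof (cases "w permutes {1..n}")
      case True
      have "(\<Sum>i\<in>{1..n}. pscale (tvar i) (G i)) w = (\<Sum>i\<in>{1..n}. tvar i * q (g w) i)"
        unfolding sum_tuple_apply using True by (simp only: pscale_apply G_def if_True)
      then show ?thesis using q(2)[OF gD(1)[OF True] 0] by (rule trans[rotated, OF sym])
    next
      case False
      then show ?thesis using gD(2) by (simp add: sum_tuple_apply pscale_apply G_def)
    qed
  qed
  ultimately show ?thesis using augmentationI[of n G "block_module 1"] by simp
qed

lemma lookup_sum_tuple: "lookp ((\<Sum>i\<in>I. f i) w) 0 = (\<Sum>i\<in>I. lookp ((f i :: tuple) w) 0)"
  by (simp only: sum_tuple_apply lookup_sum)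

text \<open>Taking constant coefficients identifies the quotient with the rational functions on the
  cosets. The frame is indexed by all permutations, so each coset indicator is repeated once per
  element of its coset; division by the order of the Young subgroup compensates, and no
  representatives are chosen.\<close>

lemma block_invariants_character:
  "has_character n (block_module 1) (\<lambda>\<sigma>. (\<Sum>w | w permutes {1..n}.
     (if same_coset w (Hilbert_Choice.inv \<sigma> \<circ> w) then 1 else 0) / of_nat (card (block_perms 1))))"
  unfolding has_character_def
proof (intro allI impI)
  fix \<sigma> assume \<sigma>: "\<sigma> permutes {1..n}"
  let ?A = "block_module 1" and ?N = "of_nat (card (block_perms 1)) :: rat"
  let ?\<xi> = "\<lambda>w (f::tuple). lookp (f w) 0 / ?N"
  have id: "id \<in> block_perms 1" by (simp add: block_perms_def permutes_id)
  have N: "?N \<noteq> 0" using id finite_block_perms[of 1] by (auto simp: card_eq_0_iff)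
  have rm: "rmodule n ?A" unfolding block_module_1 by (rule rmodule_graph_module)
  note qs = rmodule_qsubspace[OF rm]
  have "is_frame ?A (augmentation n ?A) {w. w permutes {1..n}} coset_indicator ?\<xi>"
    unfolding is_frame_def
  proof (intro conjI ballI)
    show "finite {w. w permutes {1..n}}" by (simp add: finite_permutations)
  next
    fix w assume "w \<in> {w. w permutes {1..n}}"
    show "coset_indicator w \<in> ?A" by (rule coset_indicator_in_block_module)
    show "qfunctional_on ?A (?\<xi> w)"
      by (simp add: qfunctional_on_def lookup_add add_divide_distrib pscale_apply)
    fix f assume "f \<in> augmentation n ?A"
    then obtain g where "f = (\<Sum>i\<in>{1..n}. pscale (tvar i) (g i))" unfolding augmentation_def by blast
    then show "?\<xi> w f = 0" by (simp add: lookup_sum_tuple pscale_apply)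
  next
    fix f assume f: "f \<in> ?A"
    let ?s = "\<Sum>w | w permutes {1..n}. qscale (?\<xi> w f) (coset_indicator w)"
    have s: "?s \<in> ?A" by (intro qsubspace_sum[OF qs] qsubspace_scale[OF qs] coset_indicator_in_block_module)
    show "f - ?s \<in> augmentation n ?A"
    proof (rule block_module_augmentation)
      show "f - ?s \<in> ?A" by (rule qsubspace_diff[OF qs f s])
      fix x
      have fsx: "(f - ?s) x = f x - ?s x" by simp
      show "lookp ((f - ?s) x) 0 = 0"
      proof (cases "x permutes {1..n}")
        case x: True
        have "lookp (?s x) 0 = (\<Sum>w | w permutes {1..n}. ?\<xi> w f * lookp (coset_indicator w x) 0)"
          by (simp only: lookup_sum_tuple pscale_apply lookup_0_tconst_mult)
        also have "\<dots> = (\<Sum>w | w permutes {1..n} \<and> same_coset w x. ?\<xi> x f)"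
        proof (rule sum.mono_neutral_cong_right)
          show "finite {w. w permutes {1..n}}" by (simp add: finite_permutations)
          show "?\<xi> w f * lookp (coset_indicator w x) 0 = ?\<xi> x f"
            if "w \<in> {w. w permutes {1..n} \<and> same_coset w x}" for w
            using that x same_coset_invariant[OF f _ x, of w] by (simp add: coset_indicator_def)
        qed (auto simp: coset_indicator_def)
        also have "\<dots> = lookp (f x) 0" unfolding sum_constant card_coset[OF x] using N by simp
        finally show ?thesis by (simp only: fsx lookup_minus diff_self)
      next
        case False
        then have "(f - ?s) x = 0"
          using graph_moduleD(2)[OF qsubspace_diff[OF qs f s, unfolded block_module_1]] by blast
        then show ?thesis by simp
      qed
    qed
  qed
  then show "has_trace ?A (augmentation n ?A) (dot_action \<sigma>) (\<Sum>w | w permutes {1..n}.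
     (if same_coset w (Hilbert_Choice.inv \<sigma> \<circ> w) then 1 else 0) / ?N)"
  proof (rule has_traceI)
    \<comment> \<open>The diagonal entry at w is 1 exactly when \<sigma> fixes the coset of
      w.\<close>
    have "lookp (dot_action \<sigma> (coset_indicator w) w) 0
        = (if same_coset w (Hilbert_Choice.inv \<sigma> \<circ> w) then 1 else 0)" if "w permutes {1..n}" for w
      using permutes_compose[OF that permutes_inv[OF \<sigma>]]
      by (simp add: dot_action_def coset_indicator_def)
    then show "(\<Sum>w | w permutes {1..n}. (if same_coset w (Hilbert_Choice.inv \<sigma> \<circ> w) then 1 else 0) / ?N)
        = (\<Sum>w\<in>{w. w permutes {1..n}}. ?\<xi> w (dot_action \<sigma> (coset_indicator w)))"
      by (intro sum.cong refl) simp
  qed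
qed

text \<open>The stabiliser of the coset of w is the Young subgroup conjugated by w, and conjugation
  preserves the number of cycles.\<close>

lemma conjugates_sum:
  assumes w: "w permutes {1..n}"
  shows "(\<Sum>\<sigma> | \<sigma> permutes {1..n} \<and> same_coset w (Hilbert_Choice.inv \<sigma> \<circ> w). Polynomial.monom 1 (num_cycles n \<sigma>))
       = (\<Sum>u\<in>block_perms 1. Polynomial.monom (1::rat) (num_cycles n u))"
proof -
  have iff: "same_coset w (Hilbert_Choice.inv \<sigma> \<circ> w) \<longleftrightarrow> Hilbert_Choice.inv w \<circ> \<sigma> \<circ> w \<in> block_perms 1"
    if \<sigma>: "\<sigma> permutes {1..n}" for \<sigma>
  proof -
    have p: "(Hilbert_Choice.inv \<sigma> \<circ> w) permutes {1..n}" by (rule permutes_compose[OF w permutes_inv[OF \<sigma>]])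
    have "Hilbert_Choice.inv (Hilbert_Choice.inv \<sigma> \<circ> w) = Hilbert_Choice.inv w \<circ> \<sigma>"
      using permutes_bij[OF w] permutes_bij[OF \<sigma>] permutes_bij[OF permutes_inv[OF \<sigma>]]
      by (simp add: o_inv_distrib inv_inv_eq)
    then show ?thesis using same_coset_iff[OF p w] same_coset_sym by simp
  qed
  let ?c = "\<lambda>u. w \<circ> u \<circ> Hilbert_Choice.inv w"
  have "bij_betw ?c (block_perms 1) {\<sigma>. \<sigma> permutes {1..n} \<and> same_coset w (Hilbert_Choice.inv \<sigma> \<circ> w)}"
  proof (rule bij_betwI[where g = "\<lambda>\<sigma>. Hilbert_Choice.inv w \<circ> \<sigma> \<circ> w"])
    have unconj: "Hilbert_Choice.inv w \<circ> ?c u \<circ> w = u" for u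
      by (simp add: fun_eq_iff permutes_inverses[OF w])
    show "?c \<in> block_perms 1 \<rightarrow> {\<sigma>. \<sigma> permutes {1..n} \<and> same_coset w (Hilbert_Choice.inv \<sigma> \<circ> w)}"
    proof
      fix u assume u: "u \<in> block_perms 1"
      then have "?c u permutes {1..n}"
        using w by (auto simp: block_perms_def intro: permutes_compose permutes_inv)
      then show "?c u \<in> {\<sigma>. \<sigma> permutes {1..n} \<and> same_coset w (Hilbert_Choice.inv \<sigma> \<circ> w)}"
        using iff unconj u by simp
    qed
    show "(\<lambda>\<sigma>. Hilbert_Choice.inv w \<circ> \<sigma> \<circ> w)
        \<in> {\<sigma>. \<sigma> permutes {1..n} \<and> same_coset w (Hilbert_Choice.inv \<sigma> \<circ> w)} \<rightarrow> block_perms 1"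
      using iff by blast
    show "Hilbert_Choice.inv w \<circ> ?c u \<circ> w = u" for u by (rule unconj)
    show "?c (Hilbert_Choice.inv w \<circ> \<sigma> \<circ> w) = \<sigma>" for \<sigma>
      by (simp add: fun_eq_iff permutes_inverses[OF w])
  qed
  then have "(\<Sum>\<sigma> | \<sigma> permutes {1..n} \<and> same_coset w (Hilbert_Choice.inv \<sigma> \<circ> w). Polynomial.monom 1 (num_cycles n \<sigma>))
      = (\<Sum>u\<in>block_perms 1. Polynomial.monom (1::rat) (num_cycles n (?c u)))"
    by (rule sum.reindex_bij_betw[symmetric])
  also have "\<dots> = (\<Sum>u\<in>block_perms 1. Polynomial.monom (1::rat) (num_cycles n u))"
    by (intro sum.cong refl arg_cong[where f = "Polynomial.monom 1"] num_cycles_conj[OF w])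
       (auto simp: block_perms_def)
  finally show ?thesis .
qed

text \<open>The order of the Young subgroup, gained in the interpolation steps, cancels the
  denominator of the averaged frame. What remains is the number of permutations w whose coset is
  fixed.\<close>

lemma clique_union_character:
  "\<exists>\<tau>. has_character n (hess_module n h) \<tau> \<and>
     class_length_poly n \<tau> = (\<Prod>i=1..n. [:of_nat (h i) - of_nat i, 1:])"
proof -
  let ?N = "of_nat (card (block_perms 1)) :: rat"
  let ?P = "{w. w permutes {1..n}}"
  define \<tau>0 where "\<tau>0 \<sigma> = (\<Sum>w\<in>?P. (if same_coset w (Hilbert_Choice.inv \<sigma> \<circ> w) then 1 else 0) / ?N)" for \<sigma>
  have id: "id \<in> block_perms 1" by (simp add: block_perms_def permutes_id)
  have N: "?N \<noteq> 0" using id finite_block_perms[of 1] by (auto simp: card_eq_0_iff)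
  have fin: "finite ?P" by (simp add: finite_permutations)
  have "has_character n (block_module 1) \<tau>0" unfolding \<tau>0_def by (rule block_invariants_character)
  from block_module_character[OF this, of "Suc n"]
  have "has_character n (block_module (Suc n)) (\<lambda>\<sigma>. ?N * \<tau>0 \<sigma>)"
    unfolding card_block_perms atLeastLessThanSuc_atLeastAtMost by simp
  moreover have "block_module (Suc n) = hess_module n h"
    by (simp add: block_module_def hess_edges_eq_block_edges)
  ultimately have "has_character n (hess_module n h) (\<lambda>\<sigma>. ?N * \<tau>0 \<sigma>)" by simp
  moreover have "class_length_poly n (\<lambda>\<sigma>. ?N * \<tau>0 \<sigma>) = (\<Prod>i=1..n. [:of_nat (h i) - of_nat i, 1:])"
  proof -
    have \<tau>: "?N * \<tau>0 \<sigma> = (\<Sum>w\<in>?P. if same_coset w (Hilbert_Choice.inv \<sigma> \<circ> w) then 1 else 0)" for \<sigma>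
      using N by (simp add: \<tau>0_def sum_distrib_left)
    have monom: "Polynomial.monom (\<Sum>w\<in>?P. if same_coset w (Hilbert_Choice.inv \<sigma> \<circ> w) then 1 else 0 :: rat) m
        = (\<Sum>w\<in>?P. if same_coset w (Hilbert_Choice.inv \<sigma> \<circ> w) then Polynomial.monom 1 m else 0)" for \<sigma> m
    proof -
      have "Polynomial.monom (\<Sum>w\<in>A. g w) m = (\<Sum>w\<in>A. Polynomial.monom (g w) m)"
        for g :: "(nat \<Rightarrow> nat) \<Rightarrow> rat" and A
        by (induction A rule: infinite_finite_induct) (simp_all add: add_monom[symmetric])
      then show ?thesis by (simp add: if_distrib[of "\<lambda>a. Polynomial.monom a m"] cong: if_cong)
    qed
    have "(\<Sum>\<sigma>\<in>?P. Polynomial.monom (?N * \<tau>0 \<sigma>) (num_cycles n \<sigma>))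
        = (\<Sum>w\<in>?P. \<Sum>\<sigma>\<in>?P. if same_coset w (Hilbert_Choice.inv \<sigma> \<circ> w)
             then Polynomial.monom 1 (num_cycles n \<sigma>) else 0)"
      unfolding \<tau> monom by (rule sum.swap)
    also have "\<dots> = (\<Sum>w\<in>?P. \<Sum>\<sigma> | \<sigma> permutes {1..n} \<and> same_coset w (Hilbert_Choice.inv \<sigma> \<circ> w).
             Polynomial.monom 1 (num_cycles n \<sigma>))"
      by (rule sum.cong[OF refl]) (simp only: sum.inter_filter[OF fin, symmetric] mem_Collect_eq)
    also have "\<dots> = (\<Sum>w\<in>?P. \<Sum>u\<in>block_perms 1. Polynomial.monom 1 (num_cycles n u))"
      by (intro sum.cong refl conjugates_sum) simp
    \<comment> \<open>Each w contributes the same sum; the n! equal terms absorb the factor 1 / n!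
      of \<open>class_length_poly\<close>.\<close>
    also have "\<dots> = of_nat (fact n) * (\<Sum>u\<in>block_perms 1. Polynomial.monom 1 (num_cycles n u))"
      using card_permutations[of "{1..n}" n] by simp
    also have "(\<Sum>u\<in>block_perms 1. Polynomial.monom 1 (num_cycles n u))
        = (\<Prod>i=1..n. [:of_nat (h i) - of_nat i, 1::rat:])"
      unfolding num_cycles_def by (rule block_perms_cycle_poly) simp
    finally show ?thesis
      by (simp add: class_length_poly_def of_nat_poly)
  qed
  ultimately show ?thesis by blast
qed

end

section \<open>Reduction of Hessenberg functions by the modular law\<close>

definition hess_poly :: "nat \<Rightarrow> (nat \<Rightarrow> nat) \<Rightarrow> rat poly" where
  "hess_poly n h = (\<Prod>i=1..n. [:of_nat (h i) - of_nat i, 1:])"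

definition good :: "nat \<Rightarrow> (nat \<Rightarrow> nat) \<Rightarrow> bool" where
  "good n h \<longleftrightarrow> (\<exists>\<tau>. has_character n (hess_module n h) \<tau> \<and> class_length_poly n \<tau> = hess_poly n h)"

lemma graph_module_symmetric:
  assumes "E \<subseteq> E'" "E' \<subseteq> E \<union> E\<inverse> \<union> Id"
  shows "graph_module n E Q = graph_module n E' Q"
proof
  show "graph_module n E' Q \<subseteq> graph_module n E Q" by (rule graph_module_mono[OF assms(1) subset_refl])
  show "graph_module n E Q \<subseteq> graph_module n E' Q"
  proof
    fix f assume f: "f \<in> graph_module n E Q"
    show "f \<in> graph_module n E' Q"
    proof (rule graph_moduleI)
      fix w i j assume w: "w permutes {1..n}" and "(i, j) \<in> E'"
      then consider "(i, j) \<in> E" | "(j, i) \<in> E" | "i = j" using assms(2) by blast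
      then show "tvar (w i) - tvar (w j) dvd f w - f (w \<circ> tr i j)"
      proof cases
        case 1
        then show ?thesis by (rule graph_moduleD(3)[OF f w])
      next
        case 2
        from graph_moduleD(3)[OF f w 2] have "- (tvar (w j) - tvar (w i)) dvd f w - f (w \<circ> tr j i)"
          by (simp only: minus_dvd_iff)
        then show ?thesis by (simp only: minus_diff_eq transpose_commute[of i j])
      next
        case 3
        then show ?thesis by simp
      qed
    qed (use f in \<open>simp_all add: graph_moduleD\<close>)
  qed
qed

lemma class_length_poly_add:
  "class_length_poly n (\<lambda>\<sigma>. f \<sigma> + g \<sigma>) = class_length_poly n f + class_length_poly n g"
  by (simp add: class_length_poly_def add_monom[symmetric] sum.distrib smult_add_right)

lemma class_length_poly_linear:
  assumes "\<And>\<sigma>. \<sigma> permutes {1..n} \<Longrightarrow> of_nat r * \<tau>1 \<sigma> = \<tau>2 \<sigma> + of_nat s * \<tau>0 \<sigma>"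
  shows "of_nat r * class_length_poly n \<tau>1 = class_length_poly n \<tau>2 + of_nat s * class_length_poly n \<tau>0"
proof -
  have scale: "of_nat r * class_length_poly n \<tau> = class_length_poly n (\<lambda>\<sigma>. of_nat r * \<tau> \<sigma>)" for r \<tau>
  proof -
    have "of_nat r * (\<Sum>\<sigma> | \<sigma> permutes {1..n}. Polynomial.monom (\<tau> \<sigma>) (num_cycles n \<sigma>))
        = (\<Sum>\<sigma> | \<sigma> permutes {1..n}. Polynomial.monom (of_nat r * \<tau> \<sigma>) (num_cycles n \<sigma>))"
      unfolding sum_distrib_left by (simp add: of_nat_poly smult_monom)
    then show ?thesis unfolding class_length_poly_def by (simp only: mult_smult_right)
  qed
  have "class_length_poly n (\<lambda>\<sigma>. of_nat r * \<tau>1 \<sigma>) = class_length_poly n (\<lambda>\<sigma>. \<tau>2 \<sigma> + of_nat s * \<tau>0 \<sigma>)"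
    unfolding class_length_poly_def by (intro arg_cong[where f = "Polynomial.smult _"] sum.cong refl) (simp add: assms)
  then show ?thesis by (simp only: scale class_length_poly_add)
qed

text \<open>Characters and products obey the same linear relation \<open>P\<close>, and
  \<open>card T\<close> is nonzero, so two of the three polynomials determine the third; the
  character belonging to it is supplied by the corresponding form of the modular law.\<close>

lemma good_modular_law:
  assumes tw: "twin_clique n (hess_edges n h0) T" "k \<in> T" and v: "v \<in> {1..n}" "v \<notin> T"
    and E1: "hess_edges n h1 = hess_edges n h0 \<union> {(v, k), (k, v)}"
    and E2: "hess_edges n h2 = hess_edges n h0 \<union> {v} \<times> T \<union> T \<times> {v}"
    and P: "of_nat (card T) * hess_poly n h1 = hess_poly n h2 + of_nat (card T - 1) * hess_poly n h0"
    and g0: "good n h0"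
  shows "good n h2 \<Longrightarrow> good n h1" "good n h1 \<Longrightarrow> good n h2"
proof -
  let ?E = "hess_edges n h0"
  \<comment> \<open>The modular law adds edges directed away from v only; the reverse edges impose
    the same conditions.\<close>
  have M1: "graph_module n (insert (v, k) ?E) {} = hess_module n h1"
    unfolding E1 by (rule graph_module_symmetric) auto
  have M2: "graph_module n (?E \<union> {v} \<times> T) {} = hess_module n h2"
    unfolding E2 by (rule graph_module_symmetric) auto
  obtain \<tau>0 where 0: "has_character n (hess_module n h0) \<tau>0" "class_length_poly n \<tau>0 = hess_poly n h0"
    using g0 by (auto simp: good_def)
  have "card T \<noteq> 0" using tw twin_clique_finite by auto
  then have r: "of_nat (card T) \<noteq> (0 :: rat poly)" by simp
  show "good n h1" if g2: "good n h2"
  proof -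
    obtain \<tau>2 where 2: "has_character n (hess_module n h2) \<tau>2" "class_length_poly n \<tau>2 = hess_poly n h2"
      using g2 by (auto simp: good_def)
    obtain \<tau>1 where 1: "has_character n (hess_module n h1) \<tau>1"
      and law: "\<And>\<sigma>. \<sigma> permutes {1..n} \<Longrightarrow> of_nat (card T) * \<tau>1 \<sigma> = \<tau>2 \<sigma> + of_nat (card T - 1) * \<tau>0 \<sigma>"
      using modular_law_middle[OF tw v 0(1)] 2(1) unfolding M1 M2 by blast
    have "of_nat (card T) * class_length_poly n \<tau>1 = of_nat (card T) * hess_poly n h1"
      using class_length_poly_linear[of n "card T" \<tau>1 \<tau>2 "card T - 1" \<tau>0, OF law] by (simp only: P 0(2) 2(2))
    then have "class_length_poly n \<tau>1 = hess_poly n h1" using r by (simp only: mult_cancel_left) simp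
    then show ?thesis using 1 by (auto simp: good_def)
  qed
  show "good n h2" if g1: "good n h1"
  proof -
    obtain \<tau>1 where 1: "has_character n (hess_module n h1) \<tau>1" "class_length_poly n \<tau>1 = hess_poly n h1"
      using g1 by (auto simp: good_def)
    obtain \<tau>2 where 2: "has_character n (hess_module n h2) \<tau>2"
      and law: "\<And>\<sigma>. \<sigma> permutes {1..n} \<Longrightarrow> of_nat (card T) * \<tau>1 \<sigma> = \<tau>2 \<sigma> + of_nat (card T - 1) * \<tau>0 \<sigma>"
      using modular_law_top[OF tw v 0(1)] 1(1) unfolding M1 M2 by blast
    have "class_length_poly n \<tau>2 + of_nat (card T - 1) * hess_poly n h0
        = hess_poly n h2 + of_nat (card T - 1) * hess_poly n h0"
      using class_length_poly_linear[of n "card T" \<tau>1 \<tau>2 "card T - 1" \<tau>0, OF law] by (simp only: P[symmetric] 0(2) 1(2))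
    then have "class_length_poly n \<tau>2 = hess_poly n h2" by (rule add_right_imp_eq)
    then show ?thesis using 2 by (auto simp: good_def)
  qed
qed

lemma twin_cliqueI:
  assumes T: "T \<subseteq> {1..n}" and E: "E \<subseteq> {1..n} \<times> {1..n}" "T \<times> T \<subseteq> E" "sym E"
    and nb: "\<And>x y z. x \<in> T \<Longrightarrow> z \<in> T \<Longrightarrow> y \<notin> T \<Longrightarrow> (x, y) \<in> E \<Longrightarrow> (z, y) \<in> E"
  shows "twin_clique n E T"
proof -
  have "(tr a b i, tr a b j) \<in> E" if ab: "a \<in> T" "b \<in> T" and ij: "(i, j) \<in> E" for a b i j
  proof -
    have out: "tr a b x = x" if "x \<notin> T" for x using that ab by (intro transpose_apply_other) auto
    consider "i \<in> T" "j \<in> T" | "i \<in> T" "j \<notin> T" | "i \<notin> T" "j \<in> T" | "i \<notin> T" "j \<notin> T" by blast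
    then show ?thesis
    proof cases
      case 1
      then have "tr a b i \<in> T" "tr a b j \<in> T" using tr_in_iff[OF ab] by blast+
      then show ?thesis using E(2) by blast
    next
      case 2
      then have "tr a b i \<in> T" using tr_in_iff[OF ab] by blast
      then show ?thesis using nb[OF 2(1) _ 2(2) ij] out[OF 2(2)] by simp
    next
      case 3
      then have "tr a b j \<in> T" using tr_in_iff[OF ab] by blast
      then have "(tr a b j, i) \<in> E" using nb[OF 3(2) _ 3(1)] symD[OF E(3) ij] by blast
      then show ?thesis using symD[OF E(3)] out[OF 3(1)] by simp
    next
      case 4
      then show ?thesis using ij out by simp
    qed
  qed
  then show ?thesis using T E(1,2) by (simp add: twin_clique_def)
qed

section \<open>Relations along a row and along a column of a Hessenberg function\<close>

lemma hess_edges_subset: "hess_edges n h \<subseteq> {1..n} \<times> {1..n}" and sym_hess_edges: "sym (hess_edges n h)"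
  by (auto simp: hess_edges_def sym_def)

lemma hess_edges_less: "x \<in> {1..n} \<Longrightarrow> y \<in> {1..n} \<Longrightarrow> x < y \<Longrightarrow> (x, y) \<in> hess_edges n h \<longleftrightarrow> y \<le> h x"
  and hess_edges_greater: "x \<in> {1..n} \<Longrightarrow> y \<in> {1..n} \<Longrightarrow> y < x \<Longrightarrow> (x, y) \<in> hess_edges n h \<longleftrightarrow> x \<le> h y"
  by (auto simp: hess_edges_def)

lemma hessD:
  assumes "hessenberg_function n h"
  shows "x \<in> {1..n} \<Longrightarrow> h x \<le> n" "x \<in> {1..n} \<Longrightarrow> x \<le> h x"
    and "x \<in> {1..n} \<Longrightarrow> y \<in> {1..n} \<Longrightarrow> x \<le> y \<Longrightarrow> h x \<le> h y"
  using assms by (auto simp: hessenberg_function_def mono_on_def)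

lemma hessI:
  assumes "\<And>x. x \<in> {1..n} \<Longrightarrow> x \<le> h x \<and> h x \<le> n"
    and "\<And>x y. x \<in> {1..n} \<Longrightarrow> y \<in> {1..n} \<Longrightarrow> x < y \<Longrightarrow> h x \<le> h y"
  shows "hessenberg_function n h"
  unfolding hessenberg_function_def
proof (intro conjI ballI mono_onI)
  show "h i \<in> {1..n}" "i \<le> h i" if "i \<in> {1..n}" for i using assms(1)[OF that] that by auto
  show "h x \<le> h y" if "x \<in> {1..n}" "y \<in> {1..n}" "x \<le> y" for x y
    using assms(2)[OF that(1,2)] that(3) by (cases "x = y") auto
qed

lemma hess_upd:
  assumes "hessenberg_function n h" "i \<in> {1..n}" "i \<le> b" "b \<le> n"
    and "\<And>x. x \<in> {1..n} \<Longrightarrow> x < i \<Longrightarrow> h x \<le> b" "\<And>x. x \<in> {1..n} \<Longrightarrow> i < x \<Longrightarrow> b \<le> h x"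
  shows "hessenberg_function n (h(i := b))"
  by (rule hessI) (use assms(2-) hessD[OF assms(1)] in \<open>auto simp: less_imp_le\<close>)

text \<open>Factors at level a + 1, shifted by one index, are factors at level a, so all three
  products share \<open>C * D\<close>. What remains, with r = i - q + 1, is r (m + a + 1 - i) = (m +
  a + 1 - q) + (r - 1) (m + a - i).\<close>

lemma row_hess_poly:
  assumes q: "1 \<le> q" "q \<le> i" "i \<le> n" and eq: "\<And>x. q \<le> x \<Longrightarrow> x < i \<Longrightarrow> h x = a" and hi: "h i = Suc a"
  shows "of_nat (card {q..i}) * hess_poly n h =
     hess_poly n (\<lambda>x. if q \<le> x \<and> x \<le> i then Suc a else h x) +
     of_nat (card {q..i} - 1) * hess_poly n (h(i := a))"
    (is "_ = hess_poly n ?h2 + _ * hess_poly n ?h0")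
proof -
  let ?f = "\<lambda>b x. [:of_nat b - of_nat x, 1 :: rat:]"
  define C where "C = (\<Prod>x\<in>{1..n} - {q..i}. ?f (h x) x)"
  define D where "D = (\<Prod>x=q..<i. ?f a x)"
  have split: "hess_poly n g = C * (\<Prod>x=q..i. ?f (g x) x)"
    if "\<And>x. x \<notin> {q..i} \<Longrightarrow> g x = h x" for g
  proof -
    have "hess_poly n g = (\<Prod>x\<in>{1..n} - {q..i}. ?f (g x) x) * (\<Prod>x=q..i. ?f (g x) x)"
      unfolding hess_poly_def by (rule prod.subset_diff) (use q in auto)
    also have "(\<Prod>x\<in>{1..n} - {q..i}. ?f (g x) x) = C"
      unfolding C_def by (rule prod.cong) (use that in auto)
    finally show ?thesis .
  qed
  have last: "(\<Prod>x=q..i. g x) = (\<Prod>x=q..<i. g x) * g i" for g :: "nat \<Rightarrow> rat poly"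
    using q(2) by (simp add: prod.last_plus[of q i] mult.commute)
  have "(\<Prod>x=q..<i. ?f (h x) x) = D" unfolding D_def by (rule prod.cong) (simp_all add: eq)
  then have 1: "hess_poly n h = C * (D * ?f (Suc a) i)"
    unfolding split[OF refl] last hi by (simp only:)
  have 0: "hess_poly n ?h0 = C * (D * ?f a i)"
    by (subst split) (use eq q in \<open>auto simp: last D_def intro!: prod.cong\<close>)
  have "(\<Prod>x=q..i. ?f (?h2 x) x) = (\<Prod>x=q..i. ?f (Suc a) x)"
    by (rule prod.cong) auto
  also have "\<dots> = ?f (Suc a) q * (\<Prod>x=Suc q..i. ?f (Suc a) x)"
    using q(2) by (rule prod.atLeast_Suc_atMost)
  also have "(\<Prod>x=Suc q..i. ?f (Suc a) x) = D"
    unfolding D_def atLeastLessThanSuc_atLeastAtMost[symmetric]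
    by (subst prod.atLeast_Suc_lessThan_Suc_shift) simp
  finally have h2: "(\<Prod>x=q..i. ?f (?h2 x) x) = ?f (Suc a) q * D" .
  have "hess_poly n ?h2 = C * (\<Prod>x=q..i. ?f (?h2 x) x)" by (rule split) auto
  then have 2: "hess_poly n ?h2 = C * (?f (Suc a) q * D)" unfolding h2 .
  have "of_nat (card {q..i}) * ?f (Suc a) i = ?f (Suc a) q + of_nat (card {q..i} - 1) * ?f a i"
    using q(2) by (simp add: of_nat_poly of_nat_diff algebra_simps)
  then have "C * D * (of_nat (card {q..i}) * ?f (Suc a) i)
      = C * D * (?f (Suc a) q + of_nat (card {q..i} - 1) * ?f a i)" by (simp only:)
  then show ?thesis unfolding 0 1 2 by (simp only: algebra_simps)
qed

text \<open>The clique is {q..i} and v is a + 1: in h only i is joined to v, in the lowered function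
  no vertex of the clique, in the raised one all of them. The hypothesis \<open>low\<close> makes
  every earlier vertex see all of the clique or none of it.\<close>

lemma good_row:
  assumes h: "hessenberg_function n h" and q: "1 \<le> q" "q \<le> i" "i \<le> a" "a < n"
    and eq: "\<And>x. q \<le> x \<Longrightarrow> x < i \<Longrightarrow> h x = a" and hi: "h i = Suc a"
    and low: "\<And>x. 1 \<le> x \<Longrightarrow> x < q \<Longrightarrow> h x < q \<or> i \<le> h x"
    and g0: "good n (h(i := a))" and g2: "good n (\<lambda>x. if q \<le> x \<and> x \<le> i then Suc a else h x)"
  shows "good n h"
proof -
  let ?h0 = "h(i := a)" and ?h2 = "\<lambda>x. if q \<le> x \<and> x \<le> i then Suc a else h x"
  let ?E = "hess_edges n ?h0" and ?T = "{q..i}"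
  have h0T: "?h0 x = a" if "x \<in> ?T" for x using that eq[of x] by (cases "x = i") auto
  show ?thesis
  proof (rule good_modular_law(1)[where ?h0.0 = ?h0 and ?h2.0 = ?h2 and T = ?T and k = i and v = "Suc a"])
    show "twin_clique n ?E ?T"
    proof (rule twin_cliqueI[OF _ hess_edges_subset _ sym_hess_edges])
      show "?T \<subseteq> {1..n}" using q by auto
      have "(x, y) \<in> ?E" if "x \<in> ?T" "y \<in> ?T" for x y
        unfolding hess_edges_def mem_Collect_eq prod.case h0T[OF that(1)] h0T[OF that(2)]
        using that q by auto
      then show "?T \<times> ?T \<subseteq> ?E" by blast
      fix x y z assume x: "x \<in> ?T" and z: "z \<in> ?T" and y: "y \<notin> ?T" and xy: "(x, y) \<in> ?E"
      have yn: "y \<in> {1..n}" using xy hess_edges_subset by blast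
      have xz: "x \<in> {1..n}" "z \<in> {1..n}" using x z q by auto
      show "(z, y) \<in> ?E"
      proof (cases "i < y")
        case True
        then have "x < y" "z < y" using x z by auto
        then show ?thesis
          using xy h0T[OF x] h0T[OF z] hess_edges_less[OF xz(1) yn] hess_edges_less[OF xz(2) yn] by simp
      next
        case False
        then have "y < q" using y by auto
        then have "y < x" "y < z" "?h0 y = h y" using x z q by auto
        then have "x \<le> h y" using xy hess_edges_greater[OF xz(1) yn, of ?h0] by simp
        then have "i \<le> h y" using low[of y] \<open>y < q\<close> x yn by auto
        then show ?thesis
          using hess_edges_greater[OF xz(2) yn, of ?h0] \<open>y < z\<close> \<open>?h0 y = h y\<close> z by simp
      qed
    qed
    show "hess_edges n h = ?E \<union> {(Suc a, i), (i, Suc a)}"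
      using q hi by (auto simp: hess_edges_def split: if_splits)
    have h2: "y \<le> h x \<or> q \<le> x \<and> x \<le> i \<and> y \<le> Suc a \<longleftrightarrow> y \<le> ?h2 x" for x y
      using eq[of x] hi by (cases "x = i") auto
    have h2': "y \<le> ?h2 x \<longleftrightarrow> y \<le> ?h0 x \<or> x \<in> ?T \<and> y = Suc a" for x y
      using h0T[of x] q(2) by (cases "x \<in> ?T") (auto simp del: fun_upd_apply simp: le_Suc_eq, auto)
    have "(x, y) \<in> hess_edges n ?h2 \<longleftrightarrow> (x, y) \<in> ?E \<union> {Suc a} \<times> ?T \<union> ?T \<times> {Suc a}" for x y
      unfolding hess_edges_def h2' using q by (auto simp del: fun_upd_apply)
    then show "hess_edges n ?h2 = ?E \<union> {Suc a} \<times> ?T \<union> ?T \<times> {Suc a}"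
      by (intro equalityI subrelI) blast+
    show "of_nat (card ?T) * hess_poly n h = hess_poly n ?h2 + of_nat (card ?T - 1) * hess_poly n ?h0"
      by (rule row_hess_poly) (use q eq hi in auto)
  qed (use q g0 g2 in auto)
qed

text \<open>The clique is {j, j + 1} and v is i, joined to both in h, to j after lowering h(i) by 1,
  to neither after lowering by 2; so h is the top term. Vertices before i see neither by
  \<open>low\<close>, those between i and j see both by monotonicity.\<close>

lemma good_column:
  assumes h: "hessenberg_function n h" and ij: "1 \<le> i" "i < j" "Suc j \<le> n"
    and hi: "h i = Suc j" and tw: "h j = h (Suc j)" and low: "\<And>x. 1 \<le> x \<Longrightarrow> x < i \<Longrightarrow> h x < j"
    and g0: "good n (h(i := j - 1))" and g1: "good n (h(i := j))"
  shows "good n h"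
proof -
  let ?h0 = "h(i := j - 1)" and ?h1 = "h(i := j)"
  let ?E = "hess_edges n ?h0" and ?T = "{j, Suc j}"
  have hT: "?h0 x = h j" if "x \<in> ?T" for x using that ij tw by auto
  have up: "Suc j \<le> h j" using hessD(2)[OF h, of "Suc j"] ij tw by simp
  show ?thesis
  proof (rule good_modular_law(2)[where ?h0.0 = ?h0 and ?h1.0 = ?h1 and T = ?T and k = j and v = i])
    show "twin_clique n ?E ?T"
    proof (rule twin_cliqueI[OF _ hess_edges_subset _ sym_hess_edges])
      show T: "?T \<subseteq> {1..n}" using ij by auto
      show "?T \<times> ?T \<subseteq> ?E" using ij up tw by (auto simp: hess_edges_def)
      fix x y z assume x: "x \<in> ?T" and z: "z \<in> ?T" and y: "y \<notin> ?T" and xy: "(x, y) \<in> ?E"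
      have yn: "y \<in> {1..n}" using xy hess_edges_subset by blast
      have xz: "x \<in> {1..n}" "z \<in> {1..n}" using x z T by blast+
      show "(z, y) \<in> ?E"
      proof (cases "Suc j < y")
        case True
        then have "x < y" "z < y" using x z by auto
        then show ?thesis
          using xy hT[OF x] hT[OF z] hess_edges_less[OF xz(1) yn] hess_edges_less[OF xz(2) yn] by simp
      next
        case False
        then have "y < j" using y by auto
        then have "y < x" "y < z" using x z by auto
        then have "x \<le> ?h0 y" using xy hess_edges_greater[OF xz(1) yn, of ?h0] by blast
        then have "j \<le> ?h0 y" using x by auto
        then have "y \<noteq> i" using ij by auto
        moreover have "\<not> y < i" using low[of y] yn \<open>j \<le> ?h0 y\<close> by auto
        ultimately have "i < y" by simp
        then have "Suc j \<le> h y" using hessD(3)[OF h, of i y] yn ij hi by simp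
        then have "z \<le> ?h0 y" using z \<open>i < y\<close> by auto
        then show ?thesis using hess_edges_greater[OF xz(2) yn, of ?h0] \<open>y < z\<close> by blast
      qed
    qed
    show "hess_edges n ?h1 = ?E \<union> {(i, j), (j, i)}"
      using ij by (auto simp: hess_edges_def split: if_splits)
    show "hess_edges n h = ?E \<union> {i} \<times> ?T \<union> ?T \<times> {i}"
      using ij hi by (auto simp: hess_edges_def split: if_splits)
    have *: "hess_poly n (h(i := b)) = [:of_nat b - of_nat i, 1:] *
        (\<Prod>x\<in>{1..n} - {i}. [:of_nat (h x) - of_nat x, 1:])" for b
      unfolding hess_poly_def by (subst prod.remove[of _ i]) (use ij in \<open>auto intro!: prod.cong\<close>)
    have "hess_poly n h = hess_poly n (h(i := Suc j))" using hi by (metis fun_upd_triv)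
    then have 2: "hess_poly n h = [:of_nat (Suc j) - of_nat i, 1:] *
        (\<Prod>x\<in>{1..n} - {i}. [:of_nat (h x) - of_nat x, 1:])" unfolding * .
    have c: "card ?T = 2" by simp
    have "[:of_nat (Suc j) - of_nat i, 1 :: rat:] + [:of_nat (j - 1) - of_nat i, 1:] = 2 * [:of_nat j - of_nat i, 1:]"
      using ij by (simp add: of_nat_diff numeral_poly)
    then show "of_nat (card ?T) * hess_poly n ?h1 = hess_poly n h + of_nat (card ?T - 1) * hess_poly n ?h0"
      unfolding * 2 c by (simp add: mult.assoc[symmetric] distrib_right[symmetric] del: mult_pCons_left mult_pCons_right add_pCons)
  qed (use ij g0 g1 in auto)
qed

text \<open>Positions further left weigh more, so lowering h at i outweighs raising it by 1 at a
  later position. This trade, \<open>weight_move\<close>, occurs in \<open>good_gap\<close>.\<close>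

definition weight :: "nat \<Rightarrow> (nat \<Rightarrow> nat) \<Rightarrow> nat" where
  "weight n h = (\<Sum>x=1..n. h x * (Suc n - x))"

lemma weight_upd:
  assumes "i \<in> {1..n}"
  shows "weight n (h(i := b)) + h i * (Suc n - i) = weight n h + b * (Suc n - i)"
proof -
  have "weight n g = g i * (Suc n - i) + (\<Sum>x\<in>{1..n} - {i}. g x * (Suc n - x))" for g
    unfolding weight_def using assms by (intro sum.remove) auto
  moreover have "(\<Sum>x\<in>{1..n} - {i}. (h(i := b)) x * (Suc n - x)) = (\<Sum>x\<in>{1..n} - {i}. h x * (Suc n - x))"
    by (rule sum.cong) auto
  ultimately show ?thesis by simp
qed

lemma weight_decrease:
  assumes "i \<in> {1..n}" "b < h i"
  shows "weight n (h(i := b)) < weight n h"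
proof -
  have "b * (Suc n - i) < h i * (Suc n - i)" using assms by simp
  then show ?thesis using weight_upd[OF assms(1), of h b] by linarith
qed

lemma weight_move:
  assumes "i \<in> {1..n}" "j \<in> {1..n}" "i < j" "b < h i"
  shows "weight n (h(j := Suc (h j), i := b)) < weight n h"
proof -
  let ?g = "h(j := Suc (h j))"
  have "weight n ?g = weight n h + (Suc n - j)"
    using weight_upd[OF assms(2), of h "Suc (h j)"] by simp
  moreover have "weight n (?g(i := b)) + h i * (Suc n - i) = weight n ?g + b * (Suc n - i)"
    using weight_upd[OF assms(1), of ?g b] assms(3) by simp
  moreover have "Suc b * (Suc n - i) \<le> h i * (Suc n - i)" using assms(4) by (intro mult_right_mono) auto
  moreover have "Suc n - j < Suc n - i" using assms by auto
  ultimately show ?thesis by simp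
qed

text \<open>The jump of at least 2 at i keeps h below h(i) - 1 on all earlier vertices, and i \<le>
  h(i - 1) places i before h(i) - 1. Thus {h(i) - 1, h(i)} is a clique to which the column relation
  applies.\<close>

lemma good_column_gap:
  assumes h: "hessenberg_function n h" and i: "2 \<le> i" "i \<le> n"
    and gap: "h (i - 1) + 2 \<le> h i" "i \<le> h (i - 1)" and tw: "h (h i - 1) = h (h i)"
    and IH: "\<And>b. b < h i \<Longrightarrow> hessenberg_function n (h(i := b)) \<Longrightarrow> good n (h(i := b))"
  shows "good n h"
proof -
  define j where "j = h i - 1"
  have hi: "h i = Suc j" using gap by (simp add: j_def)
  have ij: "i < j" "Suc j \<le> n" using gap hi hessD(1)[OF h, of i] i by auto
  have low: "h x < j" if "1 \<le> x" "x < i" for x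
  proof -
    have "h x \<le> h (i - 1)" by (rule hessD(3)[OF h]) (use that i in auto)
    then show ?thesis using gap(1) hi by simp
  qed
  have up: "Suc j \<le> h x" if "x \<in> {1..n}" "i < x" for x
    using hessD(3)[OF h, of i x] that i hi by auto
  have hess: "hessenberg_function n (h(i := b))" if "b = j \<or> b = j - 1" for b
  proof (rule hess_upd[OF h])
    show "h x \<le> b" if "x \<in> {1..n}" "x < i" for x using low[of x] that \<open>b = j \<or> b = j - 1\<close> by auto
    show "b \<le> h x" if "x \<in> {1..n}" "i < x" for x using up[OF that] \<open>b = j \<or> b = j - 1\<close> by auto
  qed (use that i ij in auto)
  show ?thesis
  proof (rule good_column[OF h _ ij hi _ low])
    show "h j = h (Suc j)" using tw hi by simp
    show "good n (h(i := j - 1))" "good n (h(i := j))"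
      using hess hi by (auto intro!: IH)
  qed (use i in auto)
qed

text \<open>Let b = h(i). The column relation at i needs h(b - 1) = h(b). If these values differ by
  1, a row relation on {b - 1, b} equalises them; if they differ by more, there is a jump at b > i,
  and the search continues there. Nothing changes before \<open>i0\<close>, so \<open>IH\<close> is
  needed only for functions with the same initial segment.\<close>

lemma good_gap:
  assumes h: "hessenberg_function n h"
    and IH: "\<And>g. hessenberg_function n g \<Longrightarrow> (\<And>x. x < i0 \<Longrightarrow> g x = h x) \<Longrightarrow> weight n g < weight n h \<Longrightarrow> good n g"
    and i: "2 \<le> i" "i0 \<le> i" "i \<le> n" and gap: "h (i - 1) + 2 \<le> h i" "i \<le> h (i - 1)"
  shows "good n h"
  using i gap
proof (induction "n - i" arbitrary: i rule: less_induct)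
  case less
  note i = less.prems(1-3) and gap = less.prems(4,5)
  define b where "b = h i"
  have b: "b \<le> n" "i + 2 \<le> b" using hessD(1)[OF h, of i] i gap by (auto simp: b_def)
  have hb: "b \<le> h (b - 1)"
    using hessD(3)[OF h, of i "b - 1"] i b(1,2) unfolding b_def[symmetric] by simp
  have hb': "h (b - 1) \<le> h b" by (rule hessD(3)[OF h]) (use b in auto)
  have low: "h x < b - 1" if "1 \<le> x" "x < i" for x
  proof -
    have "h x \<le> h (i - 1)" by (rule hessD(3)[OF h]) (use that i in auto)
    then show ?thesis using gap(1) by (simp add: b_def)
  qed
  have up: "b \<le> h x" if "x \<in> {1..n}" "i \<le> x" for x
    using hessD(3)[OF h, of i x] that i by (auto simp: b_def)
  consider "h (b - 1) = h b" | "h b = Suc (h (b - 1))" | "h (b - 1) + 2 \<le> h b"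
    using hb' by linarith
  then show ?case
  proof cases
    case 1
    show ?thesis
    proof (rule good_column_gap[OF h i(1,3) gap])
      show "good n (h(i := c))" if "c < h i" "hessenberg_function n (h(i := c))" for c
        by (rule IH[OF that(2)]) (use that(1) i in \<open>auto intro!: weight_decrease\<close>)
    qed (use 1 in \<open>simp add: b_def\<close>)
  next
    case 2
    let ?a = "h (b - 1)"
    have a: "?a < n" using 2 hessD(1)[OF h, of b] b by auto
    show ?thesis
    proof (rule good_row[OF h, of "b - 1" b ?a])
      have "hessenberg_function n (h(b := ?a))"
      proof (rule hess_upd[OF h])
        show "h x \<le> ?a" if "x \<in> {1..n}" "x < b" for x
          using hessD(3)[OF h that(1), of "b - 1"] that b by auto
        show "?a \<le> h x" if "x \<in> {1..n}" "b < x" for x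
          using hessD(3)[OF h, of "b - 1" x] that b by auto
      qed (use b hb a in auto)
      then show "good n (h(b := ?a))"
        by (rule IH) (use b i 2 in \<open>auto intro!: weight_decrease\<close>)
      \<comment> \<open>Raising h(b - 1) increases the weight, so the hypothesis does not apply to
        \<open>?g\<close> itself. The column relation at i lowers h(i) in addition, and the combined
        change decreases the weight.\<close>
      let ?g = "h(b - 1 := Suc ?a)"
      have g_eq: "(\<lambda>x. if b - 1 \<le> x \<and> x \<le> b then Suc ?a else h x) = ?g"
      proof
        fix x
        consider "x = b - 1" | "x = b" | "\<not> (b - 1 \<le> x \<and> x \<le> b)" by linarith
        then show "(if b - 1 \<le> x \<and> x \<le> b then Suc ?a else h x) = ?g x"
        proof cases
          case 2
          have "b \<noteq> b - 1" using b(2) by linarith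
          then have "?g b = h b" by (rule fun_upd_other)
          then show ?thesis
            unfolding \<open>x = b\<close> \<open>h b = Suc ?a\<close> by (simp only: diff_le_self order_refl simp_thms if_True)
        next
          case 1
          then show ?thesis by (simp only: diff_le_self order_refl simp_thms if_True fun_upd_same)
        next
          case 3
          then have "x \<noteq> b - 1" by auto
          then show ?thesis using 3 by (simp only: if_False fun_upd_other not_False_eq_True)
        qed
      qed
      have hess_g: "hessenberg_function n ?g"
      proof (rule hess_upd[OF h])
        show "h x \<le> Suc ?a" if "x \<in> {1..n}" "x < b - 1" for x
          by (rule le_SucI, rule hessD(3)[OF h that(1)]) (use that b in auto)
        show "Suc ?a \<le> h x" if "x \<in> {1..n}" "b - 1 < x" for x
          using hessD(3)[OF h, of b x] that b 2 by auto
      qed (use b hb a in auto)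
      have gi: "?g i = b" "?g (i - 1) = h (i - 1)" using b by (auto simp: b_def)
      have "good n ?g"
      proof (rule good_column_gap[OF hess_g i(1,3)])
        show "?g (i - 1) + 2 \<le> ?g i" "i \<le> ?g (i - 1)" using gi gap by (simp_all add: b_def)
        have "b \<noteq> b - 1" using b(2) by linarith
        then show "?g (?g i - 1) = ?g (?g i)"
          unfolding gi(1) by (simp only: fun_upd_same fun_upd_other 2 not_False_eq_True)
        show "good n (?g(i := c))" if "c < ?g i" "hessenberg_function n (?g(i := c))" for c
          using that(2)
        proof (rule IH)
          show "weight n (?g(i := c)) < weight n h"
            by (rule weight_move) (use that(1) gi b i in \<open>auto simp: b_def\<close>)
          show "(?g(i := c)) x = h x" if "x < i0" for x using that i b by auto
        qed
      qed
      then show "good n (\<lambda>x. if b - 1 \<le> x \<and> x \<le> b then Suc ?a else h x)" unfolding g_eq .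
      show "h x < b - 1 \<or> b \<le> h x" if "1 \<le> x" "x < b - 1" for x
        using low[OF that(1)] up[of x] that b by (cases "x < i") auto
      show "h x = ?a" if "b - 1 \<le> x" "x < b" for x
      proof -
        have "x = b - 1" using that by auto
        then show ?thesis by simp
      qed
    qed (use b hb a 2 in auto)
  next
    case 3
    show ?thesis by (rule less.hyps[of b]) (use 3 b hb i in auto)
  qed
qed

lemma good_clique_union:
  assumes "hessenberg_function n h" "\<And>x. x \<in> {1..n} \<Longrightarrow> h (h x) = h x"
  shows "good n h"
  using clique_union_character[OF assms] by (simp add: good_def hess_poly_def)

text \<open>By induction, first on the length \<open>p\<close> of an initial union of complete graphs, then on the size
  of the next clique, then on the weight.\<close>

lemma good_prefix:
  assumes "hessenberg_function n h" "p \<le> n" "\<And>x. x \<in> {1..p} \<Longrightarrow> h (h x) = h x \<and> h x \<le> p"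
  shows "good n h"
  using assms
proof (induction "(p, h)" arbitrary: p h
    rule: wf_induct_rule[OF wf_measures[of "[\<lambda>(p, h). n - p, \<lambda>(p, h). n - h (Suc p), \<lambda>(p, h). weight n h]"]])
  case 1
  note h = "1.prems"(1) and p = "1.prems"(2) and prefix = "1.prems"(3)
  have IH: "good n g" if "n - q < n - p \<or> n - q = n - p \<and> (n - g (Suc q) < n - h (Suc p) \<or>
        n - g (Suc q) = n - h (Suc p) \<and> weight n g < weight n h)"
      "hessenberg_function n g" "q \<le> n" "\<And>x. x \<in> {1..q} \<Longrightarrow> g (g x) = g x \<and> g x \<le> q" for q g
    by (rule "1.hyps"[of q g]) (use that in auto)
  show ?case
  proof (cases "p = n")
    case True
    then show ?thesis using good_clique_union[OF h] prefix by blast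
  next
    case False
    then have pn: "p < n" using p by simp
    \<comment> \<open>{p + 1..a} is the next clique; it splits off as a block as soon as h(a) =
      a.\<close>
    define a where "a = h (Suc p)"
    have a: "Suc p \<le> a" "a \<le> n" using hessD(1,2)[OF h, of "Suc p"] pn by (auto simp: a_def)
    have ha: "a \<le> h x" if "x \<in> {1..n}" "Suc p \<le> x" for x
      using hessD(3)[OF h, of "Suc p" x] that by (auto simp: a_def)
    show ?thesis
    proof (cases "h a = a")
      case True
      have "h (h x) = h x \<and> h x \<le> a" if "x \<in> {1..a}" for x
      proof (cases "x \<le> p")
        case True
        then show ?thesis using prefix[of x] that a by auto
      next
        case False
        then have "h x = a" using ha[of x] hessD(3)[OF h, of x a] that a \<open>h a = a\<close> by auto
        then show ?thesis using \<open>h a = a\<close> by simp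
      qed
      then show ?thesis by (intro IH[of a h] h) (use a pn in auto)
    next
      case False
      \<comment> \<open>The first vertex after p with a neighbour beyond a. The vertices from p + 1
        to i - 1 end exactly at a, which gives the row relation its shape.\<close>
      define i where "i = (LEAST x. Suc p \<le> x \<and> a < h x)"
      have "a < h a" using False hessD(2)[OF h, of a] a by auto
      then have ex: "Suc p \<le> a \<and> a < h a" using a by simp
      have i: "Suc p \<le> i" "a < h i" using LeastI[of "\<lambda>x. Suc p \<le> x \<and> a < h x", OF ex] by (auto simp: i_def)
      have ia: "i \<le> a" unfolding i_def by (rule Least_le[of "\<lambda>x. Suc p \<le> x \<and> a < h x", OF ex])
      have below: "h x = a" if "Suc p \<le> x" "x < i" for x
        using not_less_Least[of x "\<lambda>x. Suc p \<le> x \<and> a < h x"] that ha[of x] ia a by (auto simp: i_def)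
      have ip: "Suc p < i" using i by (cases "i = Suc p") (auto simp: a_def)
      have him1: "h (i - 1) = a" using below[of "i - 1"] ip by auto
      \<comment> \<open>As p + 1 < i, functions unchanged before i keep the prefix and the value at
        p + 1, so only the last component of the measure has to drop.\<close>
      have smaller: "good n g" if "hessenberg_function n g" "\<And>x. x < i \<Longrightarrow> g x = h x" "weight n g < weight n h" for g
      proof (rule IH[of p g])
        have g: "g x = h x" if "x \<le> Suc p" for x using \<open>\<And>x. x < i \<Longrightarrow> g x = h x\<close> that ip by simp
        show "g (g x) = g x \<and> g x \<le> p" if "x \<in> {1..p}" for x
          using g[of x] g[of "h x"] prefix[OF that] that by auto
        show "n - p < n - p \<or> n - p = n - p \<and> (n - g (Suc p) < n - h (Suc p) \<or>
            n - g (Suc p) = n - h (Suc p) \<and> weight n g < weight n h)"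
          using g[of "Suc p"] that(3) by simp
      qed (use that p in auto)
      show ?thesis
      proof (cases "a + 2 \<le> h i")
        case True
        show ?thesis
          by (rule good_gap[OF h smaller, of i i]) (use True him1 ip ia a in auto)
      next
        case False
        then have hi: "h i = Suc a" using i by simp
        have an: "a < n" using hi hessD(1)[OF h, of i] ia a ip by auto
        show ?thesis
        proof (rule good_row[OF h _ _ ia an below hi])
          have "hessenberg_function n (h(i := a))"
          proof (rule hess_upd[OF h])
            show "h x \<le> a" if "x \<in> {1..n}" "x < i" for x
              using hessD(3)[OF h that(1), of "i - 1"] that him1 ia a by auto
            show "a \<le> h x" if "x \<in> {1..n}" "i < x" for x using ha[of x] that ip by auto
          qed (use ia a ip in auto)
          then show "good n (h(i := a))"
            by (rule smaller) (use hi ia a ip in \<open>auto intro!: weight_decrease\<close>)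
          \<comment> \<open>Here the weight may grow, but the value at p + 1 becomes a + 1: the
            clique grows, and the second component of the measure drops.\<close>
          let ?g = "\<lambda>x. if Suc p \<le> x \<and> x \<le> i then Suc a else h x"
          have hess_g: "hessenberg_function n ?g"
          proof (rule hessI)
            show "x \<le> ?g x \<and> ?g x \<le> n" if "x \<in> {1..n}" for x
              using hessD(1,2)[OF h that] ia an by auto
            show "?g x \<le> ?g y" if "x \<in> {1..n}" "y \<in> {1..n}" "x < y" for x y
              using hessD(3)[OF h that(1,2)] hessD(3)[OF h, of i y] hessD(3)[OF h, of x i] that hi ia a ip by auto
          qed
          show "good n ?g"
          proof (rule IH[of p ?g])
            show "?g (?g x) = ?g x \<and> ?g x \<le> p" if "x \<in> {1..p}" for x
              using prefix[OF that] that by auto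
            show "n - p < n - p \<or> n - p = n - p \<and> (n - ?g (Suc p) < n - h (Suc p) \<or>
              n - ?g (Suc p) = n - h (Suc p) \<and> weight n ?g < weight n h)"
            proof -
              have "n - Suc a < n - a" using an by linarith
              then show ?thesis using ip by (simp add: a_def)
            qed
          qed (use hess_g p in auto)
          show "h x < Suc p \<or> i \<le> h x" if "1 \<le> x" "x < Suc p" for x
            using prefix[of x] that by auto
        qed (use ip in auto)
      qed
    qed
  qed
qed

lemma hess_module_character:
  assumes "hessenberg_function n h"
  shows "\<exists>\<tau>. has_character n (hess_module n h) \<tau> \<and> class_length_poly n \<tau> = hess_poly n h"
  using good_prefix[OF assms, of 0] by (simp add: good_def)

section \<open>Log-concavity\<close>

text \<open>Unlike \<open>a\<^sub>k\<^sup>2 \<ge> a\<^sub>k\<^sub>-\<^sub>1 a\<^sub>k\<^sub>+\<^sub>1\<close>, this form is inherited by products with linear factors without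
  a separate hypothesis on internal zeros.\<close>

definition strongly_log_concave :: "rat poly \<Rightarrow> bool" where
  "strongly_log_concave p \<longleftrightarrow> (\<forall>i. 0 \<le> Polynomial.coeff p i) \<and>
     (\<forall>i j. i \<le> j \<longrightarrow> Polynomial.coeff p i * Polynomial.coeff p (Suc (Suc j)) \<le> Polynomial.coeff p (Suc i) * Polynomial.coeff p (Suc j))"

text \<open>Compare powers of r. The terms in r^2 and r^0 are instances of the hypothesis; among the
  terms in r the product of the coefficients of index i and j + 1 occurs on both sides and
  cancels.\<close>

lemma strongly_log_concave_linear_mult:
  assumes p: "strongly_log_concave p" and r: "0 \<le> r"
  shows "strongly_log_concave ([:r, 1:] * p)"
proof -
  let ?a = "Polynomial.coeff p"
  have nonneg: "0 \<le> ?a i" for i using p by (simp add: strongly_log_concave_def)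
  have lc: "?a i * ?a (Suc (Suc j)) \<le> ?a (Suc i) * ?a (Suc j)" if "i \<le> j" for i j
    using p that by (simp add: strongly_log_concave_def)
  have c0: "Polynomial.coeff ([:r, 1:] * p) 0 = r * ?a 0" by simp
  have cS: "Polynomial.coeff ([:r, 1:] * p) (Suc i) = r * ?a (Suc i) + ?a i" for i by simp
  have "Polynomial.coeff ([:r, 1:] * p) i * Polynomial.coeff ([:r, 1:] * p) (Suc (Suc j))
      \<le> Polynomial.coeff ([:r, 1:] * p) (Suc i) * Polynomial.coeff ([:r, 1:] * p) (Suc j)" if ij: "i \<le> j" for i j
  proof (cases i)
    case 0
    have "r * r * (?a 0 * ?a (Suc (Suc j))) \<le> r * r * (?a 1 * ?a (Suc j))"
      using lc[of 0 j] r by (intro mult_left_mono) auto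
    moreover have "0 \<le> r * (?a 1 * ?a j)" "0 \<le> ?a 0 * ?a j" using nonneg r by simp_all
    ultimately show ?thesis unfolding 0 c0 cS by (simp add: algebra_simps)
  next
    case (Suc k)
    have "r * r * (?a i * ?a (Suc (Suc j))) \<le> r * r * (?a (Suc i) * ?a (Suc j))"
      using lc[OF ij] r by (intro mult_left_mono) auto
    \<comment> \<open>Two exchanges of indices, from (k, j + 2) to (k + 1, j + 1) and on to (k + 2,
      j); for i = j the last two products coincide.\<close>
    moreover have "r * (?a k * ?a (Suc (Suc j))) \<le> r * (?a (Suc i) * ?a j)"
    proof (rule mult_left_mono[OF _ r])
      have 1: "?a k * ?a (Suc (Suc j)) \<le> ?a i * ?a (Suc j)" using lc[of k j] ij Suc by simp
      show "?a k * ?a (Suc (Suc j)) \<le> ?a (Suc i) * ?a j"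
      proof (cases "i = j")
        case True
        then show ?thesis using 1 by (simp add: mult.commute)
      next
        case False
        then obtain l where l: "j = Suc l" "i \<le> l" using ij by (cases j) auto
        then show ?thesis using 1 lc[of i l] by simp
      qed
    qed
    moreover have "?a k * ?a (Suc j) \<le> ?a i * ?a j"
    proof -
      obtain l where "j = Suc l" "k \<le> l" using ij Suc by (cases j) auto
      then show ?thesis using lc[of k l] Suc by simp
    qed
    ultimately show ?thesis unfolding Suc cS by (simp add: algebra_simps)
  qed
  moreover have "0 \<le> Polynomial.coeff ([:r, 1:] * p) i" for i
    using nonneg r by (cases i) (simp_all only: c0 cS, simp_all)
  ultimately show ?thesis unfolding strongly_log_concave_def by blast
qed

lemma strongly_log_concave_prod:
  assumes "finite A" "\<And>i. i \<in> A \<Longrightarrow> 0 \<le> r i"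
  shows "strongly_log_concave (\<Prod>i\<in>A. [:r i, 1:])"
  using assms
proof (induction A rule: finite_induct)
  case empty
  show ?case by (auto simp: strongly_log_concave_def coeff_1)
next
  case (insert a A)
  then show ?case unfolding prod.insert[OF insert.hyps] by (intro strongly_log_concave_linear_mult) auto
qed

lemma log_concave_hess_poly:
  assumes "hessenberg_function n h"
  shows "log_concave_coeffs (hess_poly n h)"
proof -
  have "0 \<le> (of_nat (h i) - of_nat i :: rat)" if "i \<in> {1..n}" for i
    using hessD(2)[OF assms that] by simp
  then have "strongly_log_concave (hess_poly n h)"
    unfolding hess_poly_def by (intro strongly_log_concave_prod) auto
  then show ?thesis unfolding log_concave_coeffs_def
  proof (intro allI impI)
    fix k :: nat assume "1 \<le> k"
    then obtain i where "k = Suc i" by (cases k) auto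
    then show "Polynomial.coeff (hess_poly n h) (k - 1) * Polynomial.coeff (hess_poly n h) (k + 1)
        \<le> (Polynomial.coeff (hess_poly n h) k)\<^sup>2"
      using \<open>strongly_log_concave (hess_poly n h)\<close>
      by (simp add: strongly_log_concave_def power2_eq_square)
  qed
qed

section \<open>Homogeneous components of tuples\<close>

definition hpart :: "nat \<Rightarrow> tuple \<Rightarrow> tuple" where
  "hpart k f = (\<lambda>w. hom_part k (f w))"

lemma hpart_apply: "hpart k f w = hom_part k (f w)"
  by (simp add: hpart_def)

lemma hpart_0 [simp]: "hpart k 0 = 0"
  by (simp add: fun_eq_iff hpart_apply)

lemma hpart_add: "hpart k (f + g) = hpart k f + hpart k g"
  and hpart_diff: "hpart k (f - g) = hpart k f - hpart k g"
  and hpart_qscale: "hpart k (qscale q f) = qscale q (hpart k f)"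
  by (simp_all add: fun_eq_iff hpart_apply hom_part_add hom_part_diff hom_part_tconst_mult pscale_apply)

lemma hpart_sum: "hpart k (\<Sum>i\<in>A. f i) = (\<Sum>i\<in>A. hpart k (f i))"
  using sum_comp_morphism[of "hpart k" f A] by (simp add: o_def hpart_add)

lemma hpart_tvar: "hpart k (pscale (tvar i) f) = (if k = 0 then 0 else pscale (tvar i) (hpart (k - 1) f))"
  by (simp add: fun_eq_iff hpart_apply hom_part_tvar_mult pscale_apply)

lemma dot_action_hpart: "dot_action \<sigma> (hpart k f) = hpart k (dot_action \<sigma> f)"
  by (simp add: fun_eq_iff hpart_apply dot_action_def hom_part_permute_vars)

text \<open>The divisors t_{w(i)} - t_{w(j)} are homogeneous of degree 1, so a component of a
  multiple is the multiple of the cofactor's component one degree lower.\<close>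

lemma hpart_in_graph_module:
  assumes f: "f \<in> graph_module n E {}"
  shows "hpart k f \<in> graph_module n E {}"
proof (rule graph_moduleI)
  fix w i j assume "w permutes {1..n}" "(i, j) \<in> E"
  then obtain q where "f w - f (w \<circ> tr i j) = (tvar (w i) - tvar (w j)) * q"
    using graph_moduleD(3)[OF f] unfolding dvd_def by blast
  then have "hom_part k (f w - f (w \<circ> tr i j)) = hom_part k ((tvar (w i) - tvar (w j)) * q)" by simp
  also have "\<dots> = (if k = 0 then 0 else (tvar (w i) - tvar (w j)) * hom_part (k - 1) q)"
    by (simp add: left_diff_distrib hom_part_diff hom_part_tvar_mult)
  finally show "tvar (w i) - tvar (w j) dvd hpart k f w - hpart k f (w \<circ> tr i j)"
    by (simp add: hpart_apply hom_part_diff[symmetric])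
qed (use f in \<open>simp_all add: hpart_apply hom_part_in_tpolys graph_moduleD\<close>)

lemma hpart_in_augmentation:
  assumes "f \<in> augmentation n M" "\<And>k g. g \<in> M \<Longrightarrow> hpart k g \<in> M" "rmodule n M"
  shows "hpart k f \<in> augmentation n M"
proof -
  obtain g where g: "\<And>i. i \<in> {1..n} \<Longrightarrow> g i \<in> M" "f = (\<Sum>i\<in>{1..n}. pscale (tvar i) (g i))"
    using assms(1) unfolding augmentation_def by blast
  show ?thesis
  proof (cases "k = 0")
    case True
    have "hpart k f = 0" unfolding g(2) hpart_sum hpart_tvar by (simp add: True)
    then show ?thesis
      using qsubspace_0[OF rmodule_qsubspace[OF rmodule_augmentation[OF assms(3)]]] by simp
  next
    case False
    have "hpart k f = (\<Sum>i\<in>{1..n}. pscale (tvar i) (hpart (k - 1) (g i)))"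
      unfolding g(2) hpart_sum hpart_tvar by (simp only: False if_False)
    also have "\<dots> \<in> augmentation n M" by (intro augmentationI assms(2) g(1))
    finally show ?thesis .
  qed
qed

lemma hpart_eventually_0:
  assumes f: "f \<in> graph_module n E Q"
  shows "\<exists>N. \<forall>k\<ge>N. hpart k f = 0"
proof -
  have "\<exists>N. \<forall>k\<ge>N. hom_part k (f w) = 0" for w by (rule hom_part_eventually_0)
  then obtain N where N: "\<And>w k. N w \<le> k \<Longrightarrow> hom_part k (f w) = 0" by metis
  have fin: "finite {w. w permutes {1..n}}" by (simp add: finite_permutations)
  have "hpart k f w = 0 w" if k: "(\<Sum>w | w permutes {1..n}. N w) \<le> k" for k w
  proof (cases "w permutes {1..n}")
    case True
    then have "N w \<le> (\<Sum>w | w permutes {1..n}. N w)" using fin by (intro member_le_sum) auto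
    then show ?thesis using N k by (simp add: hpart_apply)
  next
    case False
    then show ?thesis using graph_moduleD(2)[OF f False] by (simp add: hpart_apply)
  qed
  then show ?thesis by (intro exI[of _ "\<Sum>w | w permutes {1..n}. N w"]) (simp add: fun_eq_iff)
qed

lemma sum_hpart:
  assumes "\<forall>k\<ge>N. hpart k f = 0"
  shows "(\<Sum>k<N. hpart k f) = f"
proof
  fix w
  have "\<forall>k\<ge>N. hom_part k (f w) = 0" using assms by (simp add: fun_eq_iff hpart_apply)
  then show "(\<Sum>k<N. hpart k f) w = f w" by (simp only: sum_tuple_apply hpart_apply sum_hom_part)
qed

section \<open>Comparison with the cohomology modules\<close>

context
  fixes n :: nat and h :: "nat \<Rightarrow> nat"
  assumes hess: "hessenberg_function n h"
begin

abbreviation "HT \<equiv> equivariant_cohomology n h"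
abbreviation "HM \<equiv> hess_module n h"
abbreviation "HI \<equiv> augmentation n (hess_module n h)"

lemma rmodule_HM: "rmodule n HM" by (rule rmodule_graph_module)

lemmas qsub_HM = rmodule_qsubspace[OF rmodule_HM]
lemmas qsub_HI = rmodule_qsubspace[OF rmodule_augmentation[OF rmodule_HM]]
lemmas HI_subset = augmentation_subset[OF rmodule_HM]

lemma carrier_HT: "carrier HT = HM"
proof -
  let ?U = "{(i, j). 1 \<le> i \<and> i < j \<and> j \<le> h i \<and> i \<le> n}"
  have "carrier HT = graph_module n ?U {}"
    unfolding equivariant_cohomology_def graph_module_def by auto
  also have "\<dots> = HM"
  proof (rule graph_module_symmetric)
    have "h i \<le> n" if "1 \<le> i" "i \<le> n" for i using hessD(1)[OF hess, of i] that by simp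
    then show "?U \<subseteq> hess_edges n h" by (fastforce simp: hess_edges_def)
    show "hess_edges n h \<subseteq> ?U \<union> ?U\<inverse> \<union> Id" by (auto simp: hess_edges_def)
  qed
  finally show ?thesis .
qed

lemma HT_simps: "f \<otimes>\<^bsub>HT\<^esub> g = f * g" "f \<oplus>\<^bsub>HT\<^esub> g = f + g" "\<zero>\<^bsub>HT\<^esub> = 0"
    "\<one>\<^bsub>HT\<^esub> = constant_tuple n 1"
  by (simp_all add: equivariant_cohomology_def fun_eq_iff constant_tuple_def)

lemma HM_mult:
  assumes f: "f \<in> HM" and g: "g \<in> HM"
  shows "f * g \<in> HM"
proof (rule graph_moduleI)
  fix w i j assume w: "w permutes {1..n}" and ij: "(i, j) \<in> hess_edges n h"
  let ?u = "w \<circ> tr i j"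
  have "tvar (w i) - tvar (w j) dvd f w * (g w - g ?u) + (f w - f ?u) * g ?u"
    using graph_moduleD(3)[OF f w ij] graph_moduleD(3)[OF g w ij] by (intro dvd_add dvd_mult dvd_mult2)
  then show "tvar (w i) - tvar (w j) dvd (f * g) w - (f * g) (w \<circ> tr i j)"
    by (simp add: algebra_simps)
qed (use f g in \<open>simp_all add: tpolys_mult graph_moduleD\<close>)

lemma constant_tuple_in_HM: "p \<in> tpolys n \<Longrightarrow> constant_tuple n p \<in> HM"
proof (rule graph_moduleI)
  fix w i j assume w: "w permutes {1..n}" and ij: "(i, j) \<in> hess_edges n h"
  then have "(w \<circ> tr i j) permutes {1..n}" by (intro permutes_comp_tr) (auto simp: hess_edges_def)
  then show "tvar (w i) - tvar (w j) dvd constant_tuple n p w - constant_tuple n p (w \<circ> tr i j)"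
    using w by (simp add: constant_tuple_def)
qed (simp_all add: constant_tuple_def)

lemma constant_tuple_mult: "f \<in> HM \<Longrightarrow> constant_tuple n p * f = pscale p f"
proof
  fix w assume f: "f \<in> HM"
  show "(constant_tuple n p * f) w = pscale p f w"
    using graph_moduleD(2)[OF f, of w] by (cases "w permutes {1..n}") (simp_all add: constant_tuple_def pscale_apply)
qed

lemma HI_mult:
  assumes "f \<in> HI" "g \<in> HM"
  shows "g * f \<in> HI"
proof -
  obtain a where a: "\<And>i. i \<in> {1..n} \<Longrightarrow> a i \<in> HM" "f = (\<Sum>i\<in>{1..n}. pscale (tvar i) (a i))"
    using assms(1) unfolding augmentation_def by blast
  have "g * f = (\<Sum>i\<in>{1..n}. pscale (tvar i) (g * a i))"
    unfolding a(2) sum_distrib_left pscale_mult_right ..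
  also have "\<dots> \<in> HI" by (intro augmentationI HM_mult assms(2) a(1))
  finally show ?thesis .
qed

lemma ring_HT: "ring HT"
proof (rule ringI)
  show "abelian_group HT"
  proof (rule abelian_groupI)
    show "\<exists>g\<in>carrier HT. g \<oplus>\<^bsub>HT\<^esub> f = \<zero>\<^bsub>HT\<^esub>" if "f \<in> carrier HT" for f
      using that qsubspace_uminus[OF qsub_HM, of f] unfolding carrier_HT HT_simps
      by (intro bexI[of _ "- f"]) simp_all
  qed (simp_all add: carrier_HT HT_simps qsubspace_add[OF qsub_HM] qsubspace_0[OF qsub_HM] ac_simps)
  show "monoid HT"
    by (rule monoidI)
       (simp_all add: carrier_HT HT_simps HM_mult constant_tuple_in_HM constant_tuple_mult
         mult.commute[of _ "constant_tuple n 1"] mult.assoc)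
qed (simp_all add: carrier_HT HT_simps distrib_left distrib_right)

lemma t_ideal_eq: "t_ideal n h = HI"
proof
  interpret ring HT by (rule ring_HT)
  let ?S = "(\<lambda>i. constant_tuple n (tvar i)) ` {1..n}"
  have one: "constant_tuple n 1 \<in> HM" by (rule constant_tuple_in_HM) simp
  have ideal: "ideal HI HT"
  proof (rule idealI[OF ring_HT])
    show "subgroup HI (add_monoid HT)"
    proof (rule subgroup.intro)
      show "HI \<subseteq> carrier (add_monoid HT)" using HI_subset by (simp add: carrier_HT)
      show "x \<otimes>\<^bsub>add_monoid HT\<^esub> y \<in> HI" if "x \<in> HI" "y \<in> HI" for x y
        using qsubspace_add[OF qsub_HI that] by (simp add: HT_simps)
      show "\<one>\<^bsub>add_monoid HT\<^esub> \<in> HI" using qsubspace_0[OF qsub_HI] by (simp add: HT_simps)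
      show "inv\<^bsub>add_monoid HT\<^esub> x \<in> HI" if "x \<in> HI" for x
      proof -
        have x: "x \<in> carrier HT" "- x \<in> carrier HT"
          using that HI_subset qsubspace_uminus[OF qsub_HM] by (auto simp: carrier_HT)
        have "\<ominus>\<^bsub>HT\<^esub> x = - x"
          by (rule minus_equality) (use x in \<open>simp_all add: HT_simps\<close>)
        then show ?thesis using qsubspace_uminus[OF qsub_HI that] by (simp add: a_inv_def)
      qed
    qed
    show "x \<otimes>\<^bsub>HT\<^esub> a \<in> HI" "a \<otimes>\<^bsub>HT\<^esub> x \<in> HI" if "a \<in> HI" "x \<in> carrier HT" for a x
      using HI_mult[OF that(1)] that(2) by (simp_all add: carrier_HT HT_simps mult.commute[of a x])
  qed
  have "?S \<subseteq> HI"
  proof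
    fix c assume "c \<in> ?S"
    then obtain i where i: "i \<in> {1..n}" "c = constant_tuple n (tvar i)" by blast
    let ?g = "\<lambda>j. if j = i then constant_tuple n 1 else 0"
    have "(\<Sum>j\<in>{1..n}. pscale (tvar j) (?g j)) = (\<Sum>j\<in>{i}. pscale (tvar j) (?g j))"
      using i(1) by (intro sum.mono_neutral_right) auto
    also have "\<dots> = c" by (simp add: i(2) fun_eq_iff pscale_apply constant_tuple_def)
    finally have "c = (\<Sum>j\<in>{1..n}. pscale (tvar j) (?g j))" by (rule sym)
    also have "\<dots> \<in> HI" by (rule augmentationI) (use one qsubspace_0[OF qsub_HM] in auto)
    finally show "c \<in> HI" .
  qed
  then show "t_ideal n h \<subseteq> HI" unfolding t_ideal_def by (intro genideal_minimal ideal)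
  show "HI \<subseteq> t_ideal n h"
    unfolding t_ideal_def genideal_def
  proof (rule Inter_greatest)
    fix I assume "I \<in> {I. ideal I HT \<and> ?S \<subseteq> I}"
    then have I: "ideal I HT" and S: "?S \<subseteq> I" by auto
    interpret I: ideal I HT by (rule I)
    have add: "f + g \<in> I" if "f \<in> I" "g \<in> I" for f g using I.a_closed[OF that] by (simp add: HT_simps)
    have zero: "0 \<in> I" using I.zero_closed by (simp add: HT_simps)
    have gen: "pscale (tvar i) g \<in> I" if "i \<in> {1..n}" "g \<in> HM" for i g
    proof -
      have "constant_tuple n (tvar i) \<otimes>\<^bsub>HT\<^esub> g \<in> I"
        using S that by (intro I.I_r_closed) (auto simp: carrier_HT)
      then show ?thesis using constant_tuple_mult[OF that(2)] by (simp add: HT_simps)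
    qed
    show "HI \<subseteq> I"
    proof
      fix f assume "f \<in> HI"
      then obtain g where g: "\<And>i. i \<in> {1..n} \<Longrightarrow> g i \<in> HM" "f = (\<Sum>i\<in>{1..n}. pscale (tvar i) (g i))"
        unfolding augmentation_def by blast
      have "(\<Sum>i\<in>A. pscale (tvar i) (g i)) \<in> I" if "finite A" "A \<subseteq> {1..n}" for A
        using that
      proof (induction A rule: finite_induct)
        case empty
        show ?case unfolding sum.empty by (rule zero)
      next
        case (insert a A)
        show ?case unfolding sum.insert[OF insert.hyps]
          using insert.prems by (intro add gen g(1) insert.IH) auto
      qed
      then show "f \<in> I" unfolding g(2) by simp
    qed
  qed
qed

section \<open>Classes modulo the augmentation and the graded vector spaces\<close>

definition cls :: "tuple \<Rightarrow> tuple set" where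
  "cls f = (\<lambda>i. i + f) ` HI"

lemma a_r_coset_eq: "t_ideal n h +>\<^bsub>HT\<^esub> f = cls f"
  unfolding a_r_coset_def' t_ideal_eq cls_def HT_simps by blast

lemma cls_eq_iff: "cls f = cls g \<longleftrightarrow> f - g \<in> HI"
proof
  assume "cls f = cls g"
  moreover have "0 + f \<in> cls f" unfolding cls_def by (intro imageI qsubspace_0[OF qsub_HI])
  ultimately obtain i where "i \<in> HI" "0 + f = i + g" unfolding cls_def by blast
  then show "f - g \<in> HI" by (simp add: algebra_simps)
next
  assume fg: "f - g \<in> HI"
  have "cls a \<subseteq> cls b" if "a - b \<in> HI" for a b
  proof
    fix x assume "x \<in> cls a"
    then obtain i where i: "i \<in> HI" "x = i + a" unfolding cls_def by blast
    then have "x = (i + (a - b)) + b" by simp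
    moreover have "i + (a - b) \<in> HI" by (rule qsubspace_add[OF qsub_HI i(1) that])
    ultimately show "x \<in> cls b" unfolding cls_def by blast
  qed
  moreover have "g - f \<in> HI" using qsubspace_uminus[OF qsub_HI fg] by simp
  ultimately show "cls f = cls g" using fg by blast
qed

lemma cls_0: "cls 0 = HI"
  by (simp add: cls_def)

lemma set_add_cls: "cls f <+>\<^bsub>HT\<^esub> cls g = cls (f + g)"
proof -
  have "(i + f) + (j + g) \<in> cls (f + g)" if "i \<in> HI" "j \<in> HI" for i j
  proof -
    have "(i + f) + (j + g) = (i + j) + (f + g)" by (simp add: algebra_simps)
    then show ?thesis unfolding cls_def using qsubspace_add[OF qsub_HI that] by blast
  qed
  moreover have "i + (f + g) \<in> cls f <+>\<^bsub>HT\<^esub> cls g" if "i \<in> HI" for i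
  proof -
    have "i + (f + g) = (i + f) + (0 + g)" by (simp add: algebra_simps)
    then show ?thesis unfolding set_add_def' cls_def HT_simps using that qsubspace_0[OF qsub_HI] by blast
  qed
  ultimately show ?thesis
    unfolding set_add_def' HT_simps by (auto simp only: cls_def[of f] cls_def[of g]) (auto simp: cls_def)
qed

lemma rcoset_mult_cls:
  assumes c: "c \<in> HM" and f: "f \<in> HM"
  shows "rcoset_mult HT (t_ideal n h) (cls c) (cls f) = cls (c * f)"
proof -
  have "cls (a * b) = cls (c * f)" if ab: "a \<in> cls c" "b \<in> cls f" for a b
  proof -
    obtain i j where i: "i \<in> HI" "a = i + c" and j: "j \<in> HI" "b = j + f" using ab unfolding cls_def by blast
    have "a * b - c * f = (j + f) * i + c * j" by (simp add: i j algebra_simps)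
    also have "\<dots> \<in> HI"
      using i(1) j(1) c f HI_subset by (intro qsubspace_add[OF qsub_HI] HI_mult qsubspace_add[OF qsub_HM]) auto
    finally show ?thesis by (simp only: cls_eq_iff)
  qed
  moreover have "0 + c \<in> cls c" "0 + f \<in> cls f"
    unfolding cls_def by (intro imageI qsubspace_0[OF qsub_HI])+
  ultimately show ?thesis
    unfolding rcoset_mult_def a_r_coset_eq HT_simps by blast
qed

definition graded :: "nat \<Rightarrow> tuple set" where
  "graded k = {f \<in> HM. hpart k f = f}"

lemma graded_iff: "f \<in> graded k \<longleftrightarrow> f \<in> HM \<and> (\<forall>w. homogeneous k (f w))"
  by (simp add: graded_def homogeneous_iff_hom_part fun_eq_iff hpart_apply)

lemma qsub_graded: "qsubspace (graded k)"
  unfolding qsubspace_def graded_def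
  by (simp add: hpart_add hpart_qscale qsubspace_0[OF qsub_HM] qsubspace_add[OF qsub_HM] qsubspace_scale[OF qsub_HM])

lemma qsub_graded_HI: "qsubspace (graded k \<inter> HI)"
  using qsub_graded qsub_HI by (simp add: qsubspace_def)

lemma graded_HM: "f \<in> graded k \<Longrightarrow> f \<in> HM"
  by (simp add: graded_def)

lemma dot_action_graded: "\<sigma> permutes {1..n} \<Longrightarrow> f \<in> graded k \<Longrightarrow> dot_action \<sigma> f \<in> graded k"
  using stable_graph_module by (auto simp: graded_def stable_rmodule_def dot_action_hpart[symmetric])

abbreviation "HV k \<equiv> cohomology n h k"

lemma HV_simps:
  "carrier (HV k) = cls ` graded k" "\<zero>\<^bsub>HV k\<^esub> = cls 0" "cls f \<oplus>\<^bsub>HV k\<^esub> cls g = cls (f + g)"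
  "f \<in> HM \<Longrightarrow> q \<odot>\<^bsub>HV k\<^esub> cls f = cls (qscale q f)"
proof -
  show "carrier (HV k) = cls ` graded k"
    unfolding cohomology_def a_r_coset_eq carrier_HT using graded_iff by auto
  show "\<zero>\<^bsub>HV k\<^esub> = cls 0"
    by (simp add: cohomology_def cohomology_ring_def FactRing_def cls_0 t_ideal_eq)
  show "cls f \<oplus>\<^bsub>HV k\<^esub> cls g = cls (f + g)"
    by (simp add: cohomology_def cohomology_ring_def FactRing_def set_add_cls)
  assume f: "f \<in> HM"
  have c: "constant_tuple n (tconst q) \<in> HM" by (rule constant_tuple_in_HM) simp
  have "q \<odot>\<^bsub>HV k\<^esub> cls f = rcoset_mult HT (t_ideal n h) (cls (constant_tuple n (tconst q))) (cls f)"
    by (simp add: cohomology_def cohomology_ring_def FactRing_def a_r_coset_eq)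
  then show "q \<odot>\<^bsub>HV k\<^esub> cls f = cls (qscale q f)"
    by (simp only: rcoset_mult_cls[OF c f] constant_tuple_mult[OF f])
qed

lemma carrierE:
  assumes "x \<in> carrier (HV k)"
  obtains f where "f \<in> graded k" "x = cls f"
  using assms unfolding HV_simps by blast

lemma vectorspace_HV: "vectorspace class_ring (HV k)"
proof (rule vectorspace.intro)
  note [simp] = HV_simps(1-3) graded_HM HV_simps(4)[OF graded_HM]
  note q = qsub_graded[of k]
  show "field (class_ring :: rat ring)" by (rule class_field)
  show "module class_ring (HV k)"
  proof (rule module_criteria)
    show "cring (class_ring :: rat ring)" by (rule class_cring.cring_axioms)
    show "\<zero>\<^bsub>HV k\<^esub> \<in> carrier (HV k)" using qsubspace_0[OF q] by simp
    show "\<forall>v w. v \<in> carrier (HV k) \<and> w \<in> carrier (HV k) \<longrightarrow> v \<oplus>\<^bsub>HV k\<^esub> w \<in> carrier (HV k)"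
      using qsubspace_add[OF q] by auto
    show "\<forall>v\<in>carrier (HV k). \<exists>w\<in>carrier (HV k). v \<oplus>\<^bsub>HV k\<^esub> w = \<zero>\<^bsub>HV k\<^esub>"
    proof
      fix v assume "v \<in> carrier (HV k)"
      then obtain f where f: "f \<in> graded k" "v = cls f" by (rule carrierE)
      then have "v \<oplus>\<^bsub>HV k\<^esub> cls (- f) = \<zero>\<^bsub>HV k\<^esub>" by simp
      then show "\<exists>w\<in>carrier (HV k). v \<oplus>\<^bsub>HV k\<^esub> w = \<zero>\<^bsub>HV k\<^esub>"
        using qsubspace_uminus[OF q f(1)] by (intro bexI[of _ "cls (- f)"]) simp_all
    qed
    show "\<forall>c v. c \<in> carrier class_ring \<and> v \<in> carrier (HV k) \<longrightarrow> c \<odot>\<^bsub>HV k\<^esub> v \<in> carrier (HV k)"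
      using qsubspace_scale[OF q] by auto
    show "\<forall>v w. v \<in> carrier (HV k) \<and> w \<in> carrier (HV k) \<longrightarrow> v \<oplus>\<^bsub>HV k\<^esub> w = w \<oplus>\<^bsub>HV k\<^esub> v"
      by (auto simp: add.commute)
    show "\<forall>v w x. v \<in> carrier (HV k) \<and> w \<in> carrier (HV k) \<and> x \<in> carrier (HV k) \<longrightarrow>
        v \<oplus>\<^bsub>HV k\<^esub> w \<oplus>\<^bsub>HV k\<^esub> x = v \<oplus>\<^bsub>HV k\<^esub> (w \<oplus>\<^bsub>HV k\<^esub> x)"
      by (auto simp: add.assoc)
    show "\<forall>v\<in>carrier (HV k). v \<oplus>\<^bsub>HV k\<^esub> \<zero>\<^bsub>HV k\<^esub> = v" by auto
    have scale: "\<And>f q. f \<in> graded k \<Longrightarrow> qscale q f \<in> graded k" using qsubspace_scale[OF q] .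
    show "\<forall>a b v. a \<in> carrier class_ring \<and> b \<in> carrier class_ring \<and> v \<in> carrier (HV k) \<longrightarrow>
        (a \<otimes>\<^bsub>class_ring\<^esub> b) \<odot>\<^bsub>HV k\<^esub> v = a \<odot>\<^bsub>HV k\<^esub> (b \<odot>\<^bsub>HV k\<^esub> v)"
    proof (intro allI impI)
      fix a b :: rat and v assume "a \<in> carrier class_ring \<and> b \<in> carrier class_ring \<and> v \<in> carrier (HV k)"
      then obtain f where f: "f \<in> graded k" "v = cls f" using carrierE by metis
      have "a * b \<odot>\<^bsub>HV k\<^esub> cls f = a \<odot>\<^bsub>HV k\<^esub> (b \<odot>\<^bsub>HV k\<^esub> cls f)"
        unfolding HV_simps(4)[OF graded_HM[OF f(1)]] HV_simps(4)[OF graded_HM[OF scale[OF f(1)]]]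
          pscale_pscale tconst_mult ..
      then show "(a \<otimes>\<^bsub>class_ring\<^esub> b) \<odot>\<^bsub>HV k\<^esub> v = a \<odot>\<^bsub>HV k\<^esub> (b \<odot>\<^bsub>HV k\<^esub> v)"
        by (simp add: f(2))
    qed
    show "\<forall>v\<in>carrier (HV k). \<one>\<^bsub>class_ring\<^esub> \<odot>\<^bsub>HV k\<^esub> v = v" by auto
    show "\<forall>a b v. a \<in> carrier class_ring \<and> b \<in> carrier class_ring \<and> v \<in> carrier (HV k) \<longrightarrow>
        (a \<oplus>\<^bsub>class_ring\<^esub> b) \<odot>\<^bsub>HV k\<^esub> v = (a \<odot>\<^bsub>HV k\<^esub> v) \<oplus>\<^bsub>HV k\<^esub> (b \<odot>\<^bsub>HV k\<^esub> v)"
    proof -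
      have "qscale (a + b) f = qscale a f + qscale b f" for a b f
        by (simp add: fun_eq_iff pscale_apply tconst_add distrib_right)
      then show ?thesis by auto
    qed
    show "\<forall>a v w. a \<in> carrier class_ring \<and> v \<in> carrier (HV k) \<and> w \<in> carrier (HV k) \<longrightarrow>
        a \<odot>\<^bsub>HV k\<^esub> (v \<oplus>\<^bsub>HV k\<^esub> w) = (a \<odot>\<^bsub>HV k\<^esub> v) \<oplus>\<^bsub>HV k\<^esub> (a \<odot>\<^bsub>HV k\<^esub> w)"
    proof (intro allI impI)
      fix a :: rat and v w
      assume "a \<in> carrier class_ring \<and> v \<in> carrier (HV k) \<and> w \<in> carrier (HV k)"
      then obtain f g where f: "f \<in> graded k" "v = cls f" and g: "g \<in> graded k" "w = cls g"
        using carrierE by metis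
      show "a \<odot>\<^bsub>HV k\<^esub> (v \<oplus>\<^bsub>HV k\<^esub> w) = (a \<odot>\<^bsub>HV k\<^esub> v) \<oplus>\<^bsub>HV k\<^esub> (a \<odot>\<^bsub>HV k\<^esub> w)"
        unfolding f(2) g(2) HV_simps(3) HV_simps(4)[OF graded_HM[OF f(1)]] HV_simps(4)[OF graded_HM[OF g(1)]]
          HV_simps(4)[OF graded_HM[OF qsubspace_add[OF q f(1) g(1)]]] pscale_add ..
    qed
  qed
qed

lemma lincomb_cls:
  fixes r :: "tuple set \<Rightarrow> tuple" and a :: "tuple set \<Rightarrow> rat"
  assumes "finite B" "\<And>b. b \<in> B \<Longrightarrow> r b \<in> graded k \<and> cls (r b) = b"
  shows "module.lincomb (HV k) a B = cls (\<Sum>b\<in>B. qscale (a b) (r b))"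
proof -
  interpret V: vectorspace class_ring "HV k" by (rule vectorspace_HV)
  show ?thesis unfolding V.lincomb_def using assms
  proof (induction B rule: finite_induct)
    case empty
    show ?case unfolding sum.empty V.finsum_empty by (rule HV_simps(2))
  next
    case (insert b B)
    have carr: "x \<in> carrier (HV k)" if "x \<in> insert b B" for x
      using insert.prems[OF that] by (auto simp: HV_simps(1) image_iff)
    have "(\<Oplus>\<^bsub>HV k\<^esub>v\<in>insert b B. a v \<odot>\<^bsub>HV k\<^esub> v) = a b \<odot>\<^bsub>HV k\<^esub> b \<oplus>\<^bsub>HV k\<^esub> (\<Oplus>\<^bsub>HV k\<^esub>v\<in>B. a v \<odot>\<^bsub>HV k\<^esub> v)"
      using insert.hyps carr by (intro V.finsum_insert) (auto intro!: V.smult_closed)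
    also have "(\<Oplus>\<^bsub>HV k\<^esub>v\<in>B. a v \<odot>\<^bsub>HV k\<^esub> v) = cls (\<Sum>b\<in>B. qscale (a b) (r b))"
      by (rule insert.IH) (use insert.prems in blast)
    also have "a b \<odot>\<^bsub>HV k\<^esub> b = cls (qscale (a b) (r b))"
    proof -
      have "r b \<in> HM" "cls (r b) = b" using insert.prems[of b] graded_HM by auto
      then show ?thesis using HV_simps(4)[of "r b" k "a b"] by simp
    qed
    finally show ?case unfolding sum.insert[OF insert.hyps] HV_simps(3) .
  qed
qed

text \<open>A coset is mapped onto a whole coset because \<sigma> maps the augmentation onto itself:
  the inverse permutation preserves it too.\<close>

lemma tymoczko_action_cls:
  assumes \<sigma>: "\<sigma> permutes {1..n}"
  shows "tymoczko_action \<sigma> (cls f) = cls (dot_action \<sigma> f)"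
proof -
  have inv: "Hilbert_Choice.inv \<sigma> permutes {1..n}" using \<sigma> by (rule permutes_inv)
  have undo: "dot_action \<sigma> (dot_action (Hilbert_Choice.inv \<sigma>) g) = g" for g
    by (simp add: dot_action_def permute_vars_comp permutes_inv_inv[OF \<sigma>]
        comp_assoc[symmetric] permutes_inv_o[OF \<sigma>])
  have "dot_action \<sigma> ` HI = HI"
  proof
    show "dot_action \<sigma> ` HI \<subseteq> HI" using dot_action_augmentation[OF \<sigma> stable_graph_module] by blast
    show "HI \<subseteq> dot_action \<sigma> ` HI"
    proof
      fix i assume "i \<in> HI"
      then have "dot_action (Hilbert_Choice.inv \<sigma>) i \<in> HI"
        by (rule dot_action_augmentation[OF inv stable_graph_module])
      then show "i \<in> dot_action \<sigma> ` HI" using undo[of i] by (metis imageI)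
    qed
  qed
  moreover have "dot_action \<sigma> ` (\<lambda>i. i + f) ` HI = (\<lambda>i. i + dot_action \<sigma> f) ` dot_action \<sigma> ` HI"
    unfolding image_image dot_action_add ..
  ultimately show ?thesis by (simp only: tymoczko_action_def cls_def)
qed

text \<open>A basis with its coordinate functionals is a frame, so uniqueness of traces applies. The
  given frame also proves finite dimension, without which \<open>endo_trace\<close> would return its
  dummy value.\<close>

lemma endo_trace_eq:
  assumes \<sigma>: "\<sigma> permutes {1..n}"
    and tr: "has_trace (graded k) (graded k \<inter> HI) (dot_action \<sigma>) \<tau>"
  shows "endo_trace (HV k) (tymoczko_action \<sigma>) = \<tau>"
proof -
  interpret V: vectorspace class_ring "HV k" by (rule vectorspace_HV)
  note q = qsub_graded[of k]
  obtain J :: "nat set" and e \<xi> where fr: "is_frame (graded k) (graded k \<inter> HI) J e \<xi>"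
    and \<tau>: "\<tau> = (\<Sum>j\<in>J. \<xi> j (dot_action \<sigma> (e j)))"
    using tr unfolding has_trace_def by blast
  have J: "finite J" and e: "\<And>j. j \<in> J \<Longrightarrow> e j \<in> graded k"
    and rep: "\<And>f. f \<in> graded k \<Longrightarrow> f - (\<Sum>j\<in>J. qscale (\<xi> j f) (e j)) \<in> HI"
    using fr by (auto simp: is_frame_def)
  have "\<exists>B. finite B \<and> V.basis B"
  proof (rule V.finite_basis_exists)
    let ?S = "(\<lambda>j. cls (e j)) ` J"
    have S: "?S \<subseteq> carrier (HV k)" using e by (auto simp: HV_simps(1))
    have "\<forall>b\<in>?S. \<exists>f. f \<in> graded k \<and> cls f = b" using e by blast
    then obtain r where r: "\<And>b. b \<in> ?S \<Longrightarrow> r b \<in> graded k \<and> cls (r b) = b" by metis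
    have "carrier (HV k) \<subseteq> V.span ?S"
    proof
      fix x assume "x \<in> carrier (HV k)"
      then obtain f where f: "f \<in> graded k" "x = cls f" by (rule carrierE)
      \<comment> \<open>Different j may give the same class, so the coefficients belonging to one
        class are added up.\<close>
      define a where "a b = (\<Sum>j\<in>{j \<in> J. cls (e j) = b}. \<xi> j f)" for b
      have "tconst (\<Sum>j\<in>A. c j) = (\<Sum>j\<in>A. tconst (c j))" for c and A :: "nat set"
        by (induction A rule: infinite_finite_induct) (simp_all add: tconst_add)
      then have scale: "qscale (\<Sum>j\<in>A. c j) g = (\<Sum>j\<in>A. qscale (c j) g)" for c g and A :: "nat set"
        by (simp add: fun_eq_iff sum_tuple_apply pscale_apply sum_distrib_right)
      have "(\<Sum>b\<in>?S. qscale (a b) (r b)) = (\<Sum>b\<in>?S. \<Sum>j\<in>{j \<in> J. cls (e j) = b}. qscale (\<xi> j f) (r (cls (e j))))"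
        unfolding a_def scale by (intro sum.cong refl) simp
      also have "\<dots> = (\<Sum>j\<in>J. qscale (\<xi> j f) (r (cls (e j))))"
        by (rule sum.image_gen[OF J, symmetric])
      finally have sum: "(\<Sum>b\<in>?S. qscale (a b) (r b)) = (\<Sum>j\<in>J. qscale (\<xi> j f) (r (cls (e j))))" .
      have qdiff: "qscale c (g - g') = qscale c g - qscale c g'" for c g g'
        by (simp add: fun_eq_iff pscale_apply right_diff_distrib)
      have "(\<Sum>j\<in>J. qscale (\<xi> j f) (e j - r (cls (e j)))) \<in> HI"
      proof (intro qsubspace_sum[OF qsub_HI] qsubspace_scale[OF qsub_HI])
        fix j assume "j \<in> J"
        then show "e j - r (cls (e j)) \<in> HI" using r[of "cls (e j)"] cls_eq_iff by blast
      qed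
      then have "(f - (\<Sum>j\<in>J. qscale (\<xi> j f) (e j))) + (\<Sum>j\<in>J. qscale (\<xi> j f) (e j - r (cls (e j)))) \<in> HI"
        using rep[OF f(1)] by (intro qsubspace_add[OF qsub_HI])
      then have "f - (\<Sum>b\<in>?S. qscale (a b) (r b)) \<in> HI"
        unfolding sum by (simp add: qdiff sum_subtractf)
      then have "x = cls (\<Sum>b\<in>?S. qscale (a b) (r b))" using f(2) cls_eq_iff by blast
      also have "\<dots> = V.lincomb a ?S" by (rule lincomb_cls[symmetric]) (use J r in auto)
      finally show "x \<in> V.span ?S" using J by (auto simp: V.finite_span[OF _ S])
    qed
    then have "V.gen_set ?S" using V.span_closed[OF S] by blast
    then show "V.fin_dim" unfolding V.fin_dim_def using J S by blast
  qed
  define B where "B = (SOME B. finite B \<and> V.basis B)"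
  have B: "finite B" "V.basis B"
    unfolding B_def using someI_ex[OF \<open>\<exists>B. finite B \<and> V.basis B\<close>] by auto
  then have BV: "B \<subseteq> carrier (HV k)" and indep: "\<not> V.lin_dep B" and gen: "V.span B = carrier (HV k)"
    unfolding V.basis_def by auto
  have "\<forall>b\<in>B. \<exists>f. f \<in> graded k \<and> cls f = b" using BV unfolding HV_simps(1) by blast
  then obtain r where r: "\<And>b. b \<in> B \<Longrightarrow> r b \<in> graded k \<and> cls (r b) = b" by metis
  have lc: "V.lincomb a B = cls (\<Sum>b\<in>B. qscale (a b) (r b))" for a
    by (rule lincomb_cls[OF B(1)]) (rule r)
  have ex: "\<exists>a. V.lincomb a B = cls f" if "f \<in> graded k" for f
  proof -
    have "cls f \<in> V.span B" using that unfolding gen HV_simps(1) by blast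
    then show ?thesis using V.finite_span[OF B(1) BV] by auto
  qed
  have qdiff: "qscale (c - d) g = qscale c g - qscale d g" for c d g
    using tconst_add[of "c - d" d] by (simp add: fun_eq_iff pscale_apply left_diff_distrib[symmetric])
  have uniq: "a b = a' b" if "V.lincomb a B = V.lincomb a' B" "b \<in> B" for a a' b
  proof (rule ccontr)
    assume ne: "a b \<noteq> a' b"
    have "(\<Sum>b\<in>B. qscale (a b) (r b)) - (\<Sum>b\<in>B. qscale (a' b) (r b)) \<in> HI"
      using that(1) unfolding lc cls_eq_iff .
    then have "(\<Sum>b\<in>B. qscale (a b - a' b) (r b)) - 0 \<in> HI"
      unfolding qdiff sum_subtractf diff_0_right .
    then have "V.lincomb (\<lambda>b. a b - a' b) B = \<zero>\<^bsub>HV k\<^esub>"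
      unfolding lc HV_simps(2) cls_eq_iff .
    then have "V.lin_dep B" unfolding V.lin_dep_def
      using B(1) that(2) ne by (intro exI[of _ B] exI[of _ "\<lambda>b. a b - a' b"] exI[of _ b]) auto
    then show False using indep by blast
  qed
  have coord: "coordinate (HV k) B b (V.lincomb a B) = a b" if "b \<in> B" for a b
    unfolding coordinate_def by (rule the_equality) (use uniq that in auto)
  let ?\<zeta> = "\<lambda>b f. coordinate (HV k) B b (cls f)"
  have fr': "is_frame (graded k) (graded k \<inter> HI) B r ?\<zeta>"
    unfolding is_frame_def
  proof (intro conjI ballI)
    show "finite B" by (rule B(1))
  next
    fix b assume b: "b \<in> B"
    show "r b \<in> graded k" using r[OF b] by blast
    show "qfunctional_on (graded k) (?\<zeta> b)"
      unfolding qfunctional_on_def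
    proof (intro conjI ballI allI)
      fix f g assume f: "f \<in> graded k" and g: "g \<in> graded k"
      obtain a where a: "V.lincomb a B = cls f" using ex[OF f] by (elim exE)
      obtain a' where a': "V.lincomb a' B = cls g" using ex[OF g] by (elim exE)
      have "qscale (a b + a' b) (r b) = qscale (a b) (r b) + qscale (a' b) (r b)" for b
        by (simp add: fun_eq_iff pscale_apply tconst_add distrib_right)
      then have "V.lincomb (\<lambda>b. a b + a' b) B = cls (f + g)"
        using arg_cong2[where f = "\<lambda>x y. x \<oplus>\<^bsub>HV k\<^esub> y", OF a a'] by (simp only: lc HV_simps(3) sum.distrib)
      from coord[OF b, of "\<lambda>b. a b + a' b", unfolded this] coord[OF b, of a] coord[OF b, of a']
      show "?\<zeta> b (f + g) = ?\<zeta> b f + ?\<zeta> b g" by (simp only: a a')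
    next
      fix c f assume f: "f \<in> graded k"
      obtain a where a: "V.lincomb a B = cls f" using ex[OF f] by (elim exE)
      have "cls (\<Sum>b\<in>B. qscale (c * a b) (r b)) = cls (qscale c (\<Sum>b\<in>B. qscale (a b) (r b)))"
        by (simp only: pscale_sum pscale_pscale tconst_mult)
      also have "\<dots> = c \<odot>\<^bsub>HV k\<^esub> cls (\<Sum>b\<in>B. qscale (a b) (r b))"
      proof -
        have "(\<Sum>b\<in>B. qscale (a b) (r b)) \<in> graded k"
          by (intro qsubspace_sum[OF q] qsubspace_scale[OF q]) (use r in blast)
        then show ?thesis by (intro HV_simps(4)[symmetric] graded_HM)
      qed
      also have "\<dots> = cls (qscale c f)"
        unfolding lc[symmetric] a by (rule HV_simps(4)[OF graded_HM[OF f]])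
      finally have "V.lincomb (\<lambda>b. c * a b) B = cls (qscale c f)" unfolding lc .
      from coord[OF b, of "\<lambda>b. c * a b", unfolded this] coord[OF b, of a]
      show "?\<zeta> b (qscale c f) = c * ?\<zeta> b f" by (simp only: a)
    qed
    fix f assume "f \<in> graded k \<inter> HI"
    then have "cls f = cls 0" by (simp add: cls_eq_iff)
    also have "\<dots> = V.lincomb (\<lambda>_. 0) B" unfolding lc by simp
    finally show "?\<zeta> b f = 0" using coord[OF b, of "\<lambda>_. 0"] by simp
  next
    fix f assume f: "f \<in> graded k"
    obtain a where a: "V.lincomb a B = cls f" using ex[OF f] by (elim exE)
    have "(\<Sum>b\<in>B. qscale (?\<zeta> b f) (r b)) = (\<Sum>b\<in>B. qscale (a b) (r b))"
      by (rule sum.cong[OF refl]) (simp only: a[symmetric] coord)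
    moreover have "f - (\<Sum>b\<in>B. qscale (a b) (r b)) \<in> HI" unfolding cls_eq_iff[symmetric] lc[symmetric] a ..
    ultimately have "f - (\<Sum>b\<in>B. qscale (?\<zeta> b f) (r b)) \<in> HI" by (simp only:)
    moreover have "f - (\<Sum>b\<in>B. qscale (?\<zeta> b f) (r b)) \<in> graded k"
      using r by (intro qsubspace_diff[OF q f] qsubspace_sum[OF q] qsubspace_scale[OF q]) blast
    ultimately show "f - (\<Sum>b\<in>B. qscale (?\<zeta> b f) (r b)) \<in> graded k \<inter> HI" by blast
  qed
  have "\<tau> = (\<Sum>b\<in>B. ?\<zeta> b (dot_action \<sigma> (r b)))"
    unfolding \<tau>
    by (rule frame_trace_unique[OF fr fr' q qsub_graded_HI _ qlinear_on_dot_action])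
       (use dot_action_graded[OF \<sigma>] dot_action_augmentation[OF \<sigma> stable_graph_module] in auto)
  also have "\<dots> = (\<Sum>b\<in>B. coordinate (HV k) B b (tymoczko_action \<sigma> b))"
  proof (rule sum.cong[OF refl])
    fix b assume "b \<in> B"
    then have "tymoczko_action \<sigma> b = cls (dot_action \<sigma> (r b))"
      using r[of b] tymoczko_action_cls[OF \<sigma>, of "r b"] by simp
    then show "?\<zeta> b (dot_action \<sigma> (r b)) = coordinate (HV k) B b (tymoczko_action \<sigma> b)" by simp
  qed
  finally show ?thesis
    unfolding endo_trace_def using \<open>\<exists>B. finite B \<and> V.basis B\<close> by (simp add: B_def[symmetric] Let_def)
qed

text \<open>Taking homogeneous components of a frame of the ungraded quotient yields frames of all
  graded pieces.\<close>

lemma graded_traces: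
  assumes \<sigma>: "\<sigma> permutes {1..n}" and tr: "has_trace HM HI (dot_action \<sigma>) \<tau>"
  shows "\<exists>N. (\<forall>k\<ge>N. endo_trace (HV k) (tymoczko_action \<sigma>) = 0) \<and>
             \<tau> = (\<Sum>k<N. endo_trace (HV k) (tymoczko_action \<sigma>))"
proof -
  obtain J :: "nat set" and e \<xi> where fr: "is_frame HM HI J e \<xi>"
    and \<tau>: "\<tau> = (\<Sum>j\<in>J. \<xi> j (dot_action \<sigma> (e j)))"
    using tr unfolding has_trace_def by blast
  have J: "finite J" and e: "\<And>j. j \<in> J \<Longrightarrow> e j \<in> HM"
    and rep: "\<And>f. f \<in> HM \<Longrightarrow> f - (\<Sum>j\<in>J. qscale (\<xi> j f) (e j)) \<in> HI"
    and \<xi>: "\<And>j. j \<in> J \<Longrightarrow> qfunctional_on HM (\<xi> j)" "\<And>j f. j \<in> J \<Longrightarrow> f \<in> HI \<Longrightarrow> \<xi> j f = 0"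
    using fr by (auto simp: is_frame_def)
  have hp: "hpart k f \<in> graded k" if "f \<in> HM" for k f
    using hpart_in_graph_module[OF that] by (simp add: graded_def fun_eq_iff hpart_apply hom_part_hom_part)
  have dM: "dot_action \<sigma> f \<in> HM" if "f \<in> HM" for f
    using stable_graph_module \<sigma> that by (auto simp: stable_rmodule_def)
  \<comment> \<open>The functionals are the same in all degrees and only the vectors are replaced by
    components; hence the traces add up to the ungraded one when the components are summed.\<close>
  have "is_frame (graded k) (graded k \<inter> HI) J (\<lambda>j. hpart k (e j)) \<xi>" for k
    unfolding is_frame_def
  proof (intro conjI ballI J)
    fix j assume j: "j \<in> J"
    show "hpart k (e j) \<in> graded k" by (rule hp[OF e[OF j]])
    show "qfunctional_on (graded k) (\<xi> j)" using \<xi>(1)[OF j] graded_HM by (simp add: qfunctional_on_def)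
    show "\<xi> j f = 0" if "f \<in> graded k \<inter> HI" for f using \<xi>(2)[OF j] that by blast
  next
    fix f assume f: "f \<in> graded k"
    let ?s = "\<Sum>j\<in>J. qscale (\<xi> j f) (hpart k (e j))"
    have "hpart k (f - (\<Sum>j\<in>J. qscale (\<xi> j f) (e j))) \<in> HI"
      by (rule hpart_in_augmentation[OF rep[OF graded_HM[OF f]] hpart_in_graph_module rmodule_HM])
    moreover have "hpart k f = f" using f by (simp add: graded_def)
    ultimately have "f - ?s \<in> HI" by (simp only: hpart_diff hpart_sum hpart_qscale)
    moreover have "f - ?s \<in> graded k"
      by (intro qsubspace_diff[OF qsub_graded f] qsubspace_sum[OF qsub_graded]
          qsubspace_scale[OF qsub_graded] hp e)
    ultimately show "f - ?s \<in> graded k \<inter> HI" by blast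
  qed
  then have T: "endo_trace (HV k) (tymoczko_action \<sigma>) = (\<Sum>j\<in>J. \<xi> j (dot_action \<sigma> (hpart k (e j))))" for k
    by (intro endo_trace_eq[OF \<sigma>] has_traceI[OF _ refl])
  have "\<forall>j\<in>J. \<exists>N. \<forall>k\<ge>N. hpart k (e j) = 0" using hpart_eventually_0 e by blast
  then obtain N where N: "\<And>j k. j \<in> J \<Longrightarrow> N j \<le> k \<Longrightarrow> hpart k (e j) = 0" by metis
  define N0 where "N0 = (\<Sum>j\<in>J. N j)"
  have N0: "hpart k (e j) = 0" if "j \<in> J" "N0 \<le> k" for j k
    using N[OF that(1), of k] member_le_sum[OF that(1), of N] J that(2) by (simp add: N0_def)
  have "\<xi> j 0 = 0" if "j \<in> J" for j by (rule qfunctional_on_0[OF \<xi>(1)[OF that] qsub_HM])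
  then have "endo_trace (HV k) (tymoczko_action \<sigma>) = 0" if "N0 \<le> k" for k
    unfolding T using N0 that by simp
  moreover have "\<tau> = (\<Sum>k<N0. endo_trace (HV k) (tymoczko_action \<sigma>))"
  proof -
    have "\<xi> j (dot_action \<sigma> (e j)) = (\<Sum>k<N0. \<xi> j (dot_action \<sigma> (hpart k (e j))))" if j: "j \<in> J" for j
    proof -
      have "\<forall>k\<ge>N0. hpart k (e j) = 0" using N0[OF j] by blast
      then have "\<xi> j (dot_action \<sigma> (e j)) = \<xi> j (dot_action \<sigma> (\<Sum>k<N0. hpart k (e j)))" by (simp only: sum_hpart)
      also have "\<dots> = \<xi> j (\<Sum>k<N0. qscale 1 (dot_action \<sigma> (hpart k (e j))))" by (simp add: dot_action_sum)
      also have "\<dots> = (\<Sum>k<N0. 1 * \<xi> j (dot_action \<sigma> (hpart k (e j))))"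
        by (rule qfunctional_on_lincomb[OF \<xi>(1)[OF j] qsub_HM]) (rule dM, rule graded_HM, rule hp, rule e[OF j])
      finally show ?thesis by simp
    qed
    then show ?thesis unfolding \<tau> T by (simp add: sum.swap[of _ J])
  qed
  ultimately show ?thesis by blast
qed

lemma poly_hessenberg_length_poly: "poly (hessenberg_length_poly n h) 1 = hess_poly n h"
proof -
  obtain \<tau> where \<tau>: "has_character n HM \<tau>" "class_length_poly n \<tau> = hess_poly n h"
    using hess_module_character[OF hess] by blast
  define T where "T k \<sigma> = endo_trace (HV k) (tymoczko_action \<sigma>)" for k \<sigma>
  have "\<exists>N. (\<forall>k\<ge>N. T k \<sigma> = 0) \<and> \<tau> \<sigma> = (\<Sum>k<N. T k \<sigma>)" if "\<sigma> permutes {1..n}" for \<sigma>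
    unfolding T_def using graded_traces[OF that] \<tau>(1) that by (simp add: has_character_def)
  then obtain N where N: "\<And>\<sigma> k. \<sigma> permutes {1..n} \<Longrightarrow> N \<sigma> \<le> k \<Longrightarrow> T k \<sigma> = 0"
    "\<And>\<sigma>. \<sigma> permutes {1..n} \<Longrightarrow> \<tau> \<sigma> = (\<Sum>k<N \<sigma>. T k \<sigma>)"
    by metis
  \<comment> \<open>One bound for all of the finitely many permutations; from K on the summands of
    \<open>Sum_any\<close> vanish.\<close>
  define K where "K = (\<Sum>\<sigma> | \<sigma> permutes {1..n}. N \<sigma>)"
  have NK: "N \<sigma> \<le> K" if "\<sigma> permutes {1..n}" for \<sigma>
    unfolding K_def by (rule member_le_sum) (use that in \<open>auto simp: finite_permutations\<close>)
  have \<tau>K: "\<tau> \<sigma> = (\<Sum>k<K. T k \<sigma>)" if "\<sigma> permutes {1..n}" for \<sigma>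
    unfolding N(2)[OF that]
    by (rule sum.mono_neutral_left) (use NK[OF that] N(1)[OF that] in auto)
  have len: "length_poly n (HV k) tymoczko_action = class_length_poly n (T k)" for k
    by (simp add: length_poly_def class_length_poly_def T_def)
  have zero: "class_length_poly n (T k) = 0" if "K \<le> k" for k
  proof -
    have "T k \<sigma> = 0" if "\<sigma> permutes {1..n}" for \<sigma>
      using N(1)[OF that] NK[OF that] \<open>K \<le> k\<close> by simp
    then show ?thesis by (simp add: class_length_poly_def)
  qed
  have "hessenberg_length_poly n h = (\<Sum>k<K. Polynomial.monom (class_length_poly n (T k)) k)"
    unfolding hessenberg_length_poly_def len
    by (rule Sum_any.expand_superset) (use zero in \<open>auto simp: not_less[symmetric]\<close>)
  then have "poly (hessenberg_length_poly n h) 1 = (\<Sum>k<K. class_length_poly n (T k))"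
    by (simp add: poly_sum poly_monom)
  also have "\<dots> = class_length_poly n (\<lambda>\<sigma>. \<Sum>k<K. T k \<sigma>)"
    by (induction K) (simp_all add: class_length_poly_add class_length_poly_def[of n "\<lambda>_. 0"])
  also have "\<dots> = class_length_poly n \<tau>"
    unfolding class_length_poly_def
    by (intro arg_cong[where f = "Polynomial.smult _"] sum.cong refl) (simp add: \<tau>K)
  finally show ?thesis unfolding \<tau>(2) .
qed

end

theorem proposition4p15:
  fixes n :: nat and h :: "nat \<Rightarrow> nat"
  assumes "hessenberg_function n h"
  shows "poly (hessenberg_length_poly n h) 1 = (\<Prod>i=1..n. [:of_nat (h i) - of_nat i, 1:]) \<and>
         length_log_concave_at (hessenberg_length_poly n h) 1"
proof
  have P: "poly (hessenberg_length_poly n h) 1 = hess_poly n h"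
    by (rule poly_hessenberg_length_poly[OF assms])
  then show "poly (hessenberg_length_poly n h) 1 = (\<Prod>i=1..n. [:of_nat (h i) - of_nat i, 1:])"
    by (simp add: hess_poly_def)
  show "length_log_concave_at (hessenberg_length_poly n h) 1"
    unfolding length_log_concave_at_def one_pCons[symmetric] P by (rule log_concave_hess_poly[OF assms])
qed

end
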